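(* Let $T$ be an $n$-sufficiently subdivided finite tree with at least one essential vertex, $n\ge2$. Then the vertex set of $G(n,T)$ consists of the $n!$ critical $0$-cells, which are exactly the permutations of $(0,1,\dots,n-1)$, identified with $\mathcal S_n$ as in the context, and the edge set of $G(n,T)$ decomposes as a disjoint union $E(G(n,T))=\bigsqcup_{2\le j\le i\le n}E_{i,j}$, where for each such $i,j$ and each $\tau\in\mathcal S_n$ the set $E_{i,j}$ contains exactly $$\sum_{\ell=2}^{i}\binom{i-2}{\ell-2}m_\ell$$ edges oriented from $\tau$ to $\sigma_{i,j}^{-1}\circ\tau$, and these are all the edges of $E_{i,j}$. Here $\sigma_{i,j}\in\mathcal S_n$ is the cycle $n-i+1\mapsto n-i+2\mapsto\cdots\mapsto n-i+j\mapsto n-i+1$. Moreover, each $E_{i,j}$ is $\mathcal S_n$-invariant, and $\mu\in\mathcal S_n$ takes each oriented edge of $E_{i,j}$ from $\tau$ to $\sigma_{i,j}^{-1}\circ\tau$ homeomorphically onto an oriented edge of $E_{i,j}$ from $\tau\circ\mu$ to $\sigma_{i,j}^{-1}\circ\tau\circ\mu$.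
   Context: A tree $T$ is $n$-sufficiently subdivided if every path between distinct vertices of degree $\neq2$ passes through at least $n-1$ edges; an essential vertex has degree $\ge3$; $m_r=\sum_v\binom{d(v)-1}{r}$ over vertices $v$ with degree $d(v)>r$. The discretized configuration space $\mathcal D^nT$ is the subcomplex of the product cell complex $T^n$ of cells $(a_1,\dots,a_n)$ with pairwise disjoint closures; $\mathcal S_n$ acts by $(a_1,\dots,a_n)\cdot\sigma=(a_{\sigma(1)},\dots,a_{\sigma(n)})$. Fix a root vertex $0$ of degree one. For vertices $u,v$, $u\wedge v$ is the vertex $w$ with $[0,u]\cap[0,v]=[0,w]$ (paths in $T$). For $v\neq0$ number the edges at $v$ by $0,\dots,d(v)-1$, with $0$ for the edge towards $0$; the edge at $0$ gets number $1$. For $v\ne w$, $g(v,w)$ is the number of the edge at $v$ on the path from $v$ to $w$. Order vertices: for $u\neq v$, $w=u\wedge v$, $u<v$ iff $u=w$ or ($u\ne w$ and $g(w,u)<g(w,v)$); identify vertices with $0,1,2,\dots$ in this order. For $v\ne0$, $e(v)$ is the edge at $v$ towards $0$; edges are written $(x,y)$ with $x<y$. In a cell $a$, a vertex coordinate $a_i$ is blocked if $a_i=0$ or the closure of $e(a_i)$ meets the closure of another coordinate; otherwise $\mathrm{er}_i(a)$ replaces $a_i$ by $e(a_i)$, and $\mathrm{pr}(a)=\mathrm{er}_i(a)$ for the smallest unblocked vertex $a_i$. $W=\bigcup_kW_k$ where $W_0=\{(a,\mathrm{pr}(a)): a$ a $0$-cell, $\mathrm{pr}(a)$ defined$\}$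 and $W_{k+1}=\{(a,\mathrm{pr}(a)): a$ a $(k+1)$-cell, $\mathrm{pr}(a)$ defined, $a$ not a second entry of a pair in $W_k\}$; $W$ is a discrete gradient vector field (no closed gradient paths). A cell is critical if it is in no pair of $W$. For a $0$-cell $u$ define $\varphi(u)=u$ if $u$ is critical; otherwise $(u,W(u))\in W$ with $W(u)$ a $1$-cell with endpoints $u,u'$, and $\varphi(u)=\varphi(u')$ (this terminates). The directed multigraph $G(n,T)$ has as vertices the critical $0$-cells of $\mathcal D^nT$ and one edge for each critical $1$-cell $c$: $c$ has exactly one edge coordinate $(x,y)$, $x<y$; letting $c_x,c_y$ be the $0$-cells obtained by replacing it by $x$, resp. $y$, the edge goes from $\varphi(c_x)$ to $\varphi(c_y)$. $G(n,T)$ is homotopy equivalent to the complex obtained from the $1$-skeleton of $\mathcal D^nT$ by deleting redundant $1$-cells and collapsing collapsible ones, and inherits an $\mathcal S_n$-action. A critical $0$-cell $(a_1,\dots,a_n)$ with $\{a_1,\dots,a_n\}=\{0,\dots,n-1\}$ is identified with $\tau\in\mathcal S_n$, $\tau(i)=a_i+1$; then the action is right composition, $\tau\cdot\mu=\tau\circ\mu$. *)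

theory Defs
  imports "HOL-Combinatorics.Permutations"
begin

text \<open>Vertices of type 'a; edges are two-element vertex sets; root is the vertex 0 of the
paper; num v e is the number given to the edge e at the vertex v.\<close>

record 'a rtree =
  verts :: "'a set"
  edges :: "'a set set"
  root  :: 'a
  num   :: "'a \<Rightarrow> 'a set \<Rightarrow> nat"

definition edges_at :: "'a rtree \<Rightarrow> 'a \<Rightarrow> 'a set set" where
  "edges_at T v = {e \<in> edges T. v \<in> e}"

definition deg :: "'a rtree \<Rightarrow> 'a \<Rightarrow> nat" where
  "deg T v = card (edges_at T v)"

definition is_path :: "'a rtree \<Rightarrow> 'a list \<Rightarrow> 'a \<Rightarrow> 'a \<Rightarrow> bool" where
  "is_path T p u v \<longleftrightarrow> p \<noteq> [] \<and> hd p = u \<and> last p = v \<and> distinct p \<and> set p \<subseteq> verts T \<and>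
     (\<forall>k. k + 1 < length p \<longrightarrow> {p ! k, p ! (k + 1)} \<in> edges T)"

definition is_cycle :: "'a rtree \<Rightarrow> 'a list \<Rightarrow> bool" where
  "is_cycle T p \<longleftrightarrow> 3 \<le> length p \<and> distinct p \<and> set p \<subseteq> verts T \<and>
     (\<forall>k. k + 1 < length p \<longrightarrow> {p ! k, p ! (k + 1)} \<in> edges T) \<and> {last p, hd p} \<in> edges T"

definition is_tree :: "'a rtree \<Rightarrow> bool" where
  "is_tree T \<longleftrightarrow> finite (verts T) \<and> verts T \<noteq> {} \<and>
     (\<forall>e \<in> edges T. \<exists>u v. u \<noteq> v \<and> u \<in> verts T \<and> v \<in> verts T \<and> e = {u, v}) \<and>
     (\<forall>u \<in> verts T. \<forall>v \<in> verts T. \<exists>p. is_path T p u v) \<and>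
     \<not> (\<exists>p. is_cycle T p)"

definition sufficiently_subdivided :: "nat \<Rightarrow> 'a rtree \<Rightarrow> bool" where
  "sufficiently_subdivided n T \<longleftrightarrow>
     (\<forall>u \<in> verts T. \<forall>v \<in> verts T. \<forall>p. u \<noteq> v \<and> deg T u \<noteq> 2 \<and> deg T v \<noteq> 2 \<and> is_path T p u v
        \<longrightarrow> n - 1 \<le> length p - 1)"

definition essential :: "'a rtree \<Rightarrow> 'a \<Rightarrow> bool" where
  "essential T v \<longleftrightarrow> 3 \<le> deg T v"

definition m_num :: "'a rtree \<Rightarrow> nat \<Rightarrow> nat" where
  "m_num T r = (\<Sum>v \<in> {v \<in> verts T. deg T v > r}. (deg T v - 1) choose r)"

definition tpath :: "'a rtree \<Rightarrow> 'a \<Rightarrow> 'a \<Rightarrow> 'a list" where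
  "tpath T u v = (THE p. is_path T p u v)"

definition eup :: "'a rtree \<Rightarrow> 'a \<Rightarrow> 'a set" where
  "eup T v = {v, tpath T v (root T) ! 1}"

definition good_numbering :: "'a rtree \<Rightarrow> bool" where
  "good_numbering T \<longleftrightarrow>
     (\<forall>v \<in> verts T. v \<noteq> root T \<longrightarrow>
        bij_betw (num T v) (edges_at T v) {0..<deg T v} \<and> num T v (eup T v) = 0) \<and>
     (\<forall>e \<in> edges_at T (root T). num T (root T) e = 1)"

definition meet :: "'a rtree \<Rightarrow> 'a \<Rightarrow> 'a \<Rightarrow> 'a" where
  "meet T u v = (THE w. w \<in> verts T \<and>
      set (tpath T (root T) u) \<inter> set (tpath T (root T) v) = set (tpath T (root T) w))"

definition gnum :: "'a rtree \<Rightarrow> 'a \<Rightarrow> 'a \<Rightarrow> nat" where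
  "gnum T v w = num T v {v, tpath T v w ! 1}"

definition vless :: "'a rtree \<Rightarrow> 'a \<Rightarrow> 'a \<Rightarrow> bool" where
  "vless T u v \<longleftrightarrow> u \<noteq> v \<and>
     (let w = meet T u v in u = w \<or> (u \<noteq> w \<and> v \<noteq> w \<and> gnum T w u < gnum T w v))"

text \<open>Identification of vertices with 0,1,2,... along the order.\<close>
definition rank :: "'a rtree \<Rightarrow> 'a \<Rightarrow> nat" where
  "rank T v = card {u \<in> verts T. vless T u v}"

text \<open>A cell of T is represented by its vertex set: {v} for a vertex, e for an edge.
The closure of a cell is the set of cells of its closure.\<close>

definition is_cell :: "'a rtree \<Rightarrow> 'a set \<Rightarrow> bool" where
  "is_cell T c \<longleftrightarrow> (\<exists>v \<in> verts T. c = {v}) \<or> c \<in> edges T"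

definition cl :: "'a set \<Rightarrow> 'a set set" where
  "cl c = {c} \<union> {{x} | x. x \<in> c}"

definition is_vtx :: "'a set \<Rightarrow> bool" where
  "is_vtx c \<longleftrightarrow> (\<exists>v. c = {v})"

definition vx :: "'a set \<Rightarrow> 'a" where
  "vx c = the_elem c"

definition cells :: "'a rtree \<Rightarrow> nat \<Rightarrow> 'a set list set" where
  "cells T n = {a. length a = n \<and> (\<forall>i < n. is_cell T (a ! i)) \<and>
      (\<forall>i < n. \<forall>j < n. i \<noteq> j \<longrightarrow> cl (a ! i) \<inter> cl (a ! j) = {})}"

definition dim :: "'a rtree \<Rightarrow> 'a set list \<Rightarrow> nat" where
  "dim T a = card {i. i < length a \<and> a ! i \<in> edges T}"

definition blocked :: "'a rtree \<Rightarrow> 'a set list \<Rightarrow> nat \<Rightarrow> bool" where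
  "blocked T a i \<longleftrightarrow> vx (a ! i) = root T \<or>
     (\<exists>j < length a. j \<noteq> i \<and> cl (eup T (vx (a ! i))) \<inter> cl (a ! j) \<noteq> {})"

definition unblocked :: "'a rtree \<Rightarrow> 'a set list \<Rightarrow> nat \<Rightarrow> bool" where
  "unblocked T a i \<longleftrightarrow> i < length a \<and> is_vtx (a ! i) \<and> \<not> blocked T a i"

definition has_pr :: "'a rtree \<Rightarrow> 'a set list \<Rightarrow> bool" where
  "has_pr T a \<longleftrightarrow> (\<exists>i. unblocked T a i)"

definition pr_idx :: "'a rtree \<Rightarrow> 'a set list \<Rightarrow> nat" where
  "pr_idx T a = (THE i. unblocked T a i \<and>
      (\<forall>j. unblocked T a j \<and> j \<noteq> i \<longrightarrow> vless T (vx (a ! i)) (vx (a ! j))))"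

definition pr :: "'a rtree \<Rightarrow> 'a set list \<Rightarrow> 'a set list" where
  "pr T a = a[pr_idx T a := eup T (vx (a ! pr_idx T a))]"

primrec Wk :: "'a rtree \<Rightarrow> nat \<Rightarrow> nat \<Rightarrow> ('a set list \<times> 'a set list) set" where
  "Wk T n 0 = {(a, pr T a) | a. a \<in> cells T n \<and> dim T a = 0 \<and> has_pr T a}"
| "Wk T n (Suc k) = {(a, pr T a) | a. a \<in> cells T n \<and> dim T a = Suc k \<and> has_pr T a \<and>
      a \<notin> snd ` Wk T n k}"

definition Wf :: "'a rtree \<Rightarrow> nat \<Rightarrow> ('a set list \<times> 'a set list) set" where
  "Wf T n = (\<Union>k. Wk T n k)"

definition critical :: "'a rtree \<Rightarrow> nat \<Rightarrow> 'a set list \<Rightarrow> bool" where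
  "critical T n a \<longleftrightarrow> a \<in> cells T n \<and> a \<notin> fst ` Wf T n \<and> a \<notin> snd ` Wf T n"

definition eidx :: "'a rtree \<Rightarrow> 'a set list \<Rightarrow> nat" where
  "eidx T c = (THE i. i < length c \<and> c ! i \<in> edges T)"

definition elo :: "'a rtree \<Rightarrow> 'a set \<Rightarrow> 'a" where
  "elo T e = (THE x. \<exists>y. e = {x, y} \<and> vless T x y)"

definition ehi :: "'a rtree \<Rightarrow> 'a set \<Rightarrow> 'a" where
  "ehi T e = (THE y. \<exists>x. e = {x, y} \<and> vless T x y)"

definition lo_face :: "'a rtree \<Rightarrow> 'a set list \<Rightarrow> 'a set list" where
  "lo_face T c = c[eidx T c := {elo T (c ! eidx T c)}]"

definition hi_face :: "'a rtree \<Rightarrow> 'a set list \<Rightarrow> 'a set list" where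
  "hi_face T c = c[eidx T c := {ehi T (c ! eidx T c)}]"

inductive phi_rel :: "'a rtree \<Rightarrow> nat \<Rightarrow> 'a set list \<Rightarrow> 'a set list \<Rightarrow> bool"
  for T :: "'a rtree" and n :: nat where
  crit: "critical T n u \<Longrightarrow> dim T u = 0 \<Longrightarrow> phi_rel T n u u"
| step: "(u, w) \<in> Wf T n \<Longrightarrow> dim T u = 0 \<Longrightarrow> u' \<in> {lo_face T w, hi_face T w} \<Longrightarrow> u' \<noteq> u \<Longrightarrow>
         phi_rel T n u' c \<Longrightarrow> phi_rel T n u c"

definition phi :: "'a rtree \<Rightarrow> nat \<Rightarrow> 'a set list \<Rightarrow> 'a set list" where
  "phi T n u = (THE c. phi_rel T n u c)"

definition Gverts :: "'a rtree \<Rightarrow> nat \<Rightarrow> 'a set list set" where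
  "Gverts T n = {a. critical T n a \<and> dim T a = 0}"

definition Gedges :: "'a rtree \<Rightarrow> nat \<Rightarrow> 'a set list set" where
  "Gedges T n = {c. critical T n c \<and> dim T c = 1}"

definition Gsrc :: "'a rtree \<Rightarrow> nat \<Rightarrow> 'a set list \<Rightarrow> 'a set list" where
  "Gsrc T n c = phi T n (lo_face T c)"

definition Gtgt :: "'a rtree \<Rightarrow> nat \<Rightarrow> 'a set list \<Rightarrow> 'a set list" where
  "Gtgt T n c = phi T n (hi_face T c)"

text \<open>Permutation of {1..n} attached to a 0-cell: tau(i) = a_i + 1 (lists are 0-indexed).\<close>
definition perm_of :: "'a rtree \<Rightarrow> 'a set list \<Rightarrow> nat \<Rightarrow> nat" where
  "perm_of T a = (\<lambda>k. if 1 \<le> k \<and> k \<le> length a then rank T (vx (a ! (k - 1))) + 1 else k)"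

text \<open>Right action of S_n: (a . s)_i = a_{s(i)}.\<close>
definition act :: "'a set list \<Rightarrow> (nat \<Rightarrow> nat) \<Rightarrow> 'a set list" where
  "act a s = map (\<lambda>k. a ! (s (k + 1) - 1)) [0..<length a]"

definition sigma :: "nat \<Rightarrow> nat \<Rightarrow> nat \<Rightarrow> nat \<Rightarrow> nat" where
  "sigma n i j k = (if n - i + 1 \<le> k \<and> k < n - i + j then k + 1
                    else if k = n - i + j then n - i + 1 else k)"

end

(* Encode a vertex by the list of edge numbers read along the path from the root: the
   vertex order becomes the lexicographic order and passing to the parent becomes butlast.

   The smallest unblocked vertex coordinate slides past no other coordinate, so the reduction phi
   preserves the relative order of the coordinates; the permutation of phi(u) is therefore the
   list of ranks of the coordinates of u, and the 0-cells with everything blocked occupy the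
   first n vertices, which form a path by the subdivision hypothesis.

   A 1-cell with edge (x,y) is critical iff every vertex coordinate is blocked and some child v < y
   of x is a coordinate. Let E_{i,j} collect those with n-i coordinates below x and j-1 strictly
   between x and y; replacing x by y then shifts a block of j ranks cyclically. By subdivision
   such a cell consists of the first n-i vertices together with initial segments of the unbranched
   paths leaving x, of total length i; y starts one of the paths, and the segments before it have
   total length j-1. With d(x)-1 = D these are counted by C(D+i-2, i), which Vandermonde's identity
   expands into the sum over l. *)

theory Submission
  imports Defs "HOL-Library.List_Lexorder" "HOL-Library.Sublist"
begin

section \<open>Compositions with a marked partial sum\<close>

text \<open>Whether a 1-cell is critical depends only on the upper end y of its edge and on the set
  of its vertex coordinates, not on which coordinate sits where. The lower face has n distinct
  entries, and exactly one arrangement of them has a prescribed rank permutation. So the edges of a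
  class that leave a given permutation correspond one to one to pairs (y, set), and only these pairs
  have to be counted.

  The bound n-1 is just enough. In a critical cell, y and a smaller sibling head two different paths
  out of x, so no single path holds more than n-1 of the points, and this is how far a path is known
  not to branch. Likewise at most n-2 coordinates lie outside the subtree of x, so these stay on the
  stem.

  The count is the same for all j: the segment lengths describe a weakly increasing word of length i
  in D letters that must ascend strictly after position j-1. Adding k-1 to the k-th letter up to
  that position and k-2 beyond it gives all strictly increasing words in D+i-2 letters.\<close>

definition split_lists :: "nat \<Rightarrow> nat \<Rightarrow> nat \<Rightarrow> (nat \<times> nat list) set" where
  "split_lists d i s = {(q, f). q < d \<and> length f = d \<and> sum_list f = i \<and> sum_list (take q f) = s \<and> 0 < f ! q}"

lemma finite_lists_sum: "finite {f :: nat list. length f = d \<and> sum_list f = i}"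
proof (rule finite_subset)
  show "{f :: nat list. length f = d \<and> sum_list f = i} \<subseteq> {f. set f \<subseteq> {..i} \<and> length f = d}"
    using member_le_sum_list by fastforce
qed (simp add: finite_lists_length_eq)

lemma finite_split_lists: "finite (split_lists d i s)"
proof (rule finite_subset)
  show "split_lists d i s \<subseteq> {..<d} \<times> {f. length f = d \<and> sum_list f = i}"
    by (auto simp: split_lists_def)
qed (simp add: finite_lists_sum)

lemma split_lists_0: "split_lists 0 i s = {}"
  by (auto simp: split_lists_def)

lemma split_lists_SucE:
  assumes "z \<in> split_lists (Suc d) i s"
  obtains q h f where "z = (q, h # f)" "(q, h # f) \<in> split_lists (Suc d) i s"
proof -
  obtain q g where z: "z = (q, g)" by fastforce
  with assms have "length g = Suc d" by (simp add: split_lists_def)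
  then obtain h f where "g = h # f" by (cases g) auto
  with z assms that show ?thesis by blast
qed

text \<open>With prefix sum 0 the mark \<open>q\<close> can only be the first nonzero entry, so
  \<open>f\<close> determines it and all weak compositions of \<open>i\<close> into \<open>d\<close>
  parts are counted. The induction splits off a leading zero; without one, \<open>q = 0\<close> and
  lowering the first entry leaves an arbitrary composition of \<open>i - 1\<close>.\<close>

lemma card_split_lists_first:
  assumes "0 < i"
  shows "card (split_lists d i 0) = (d + i - 1) choose i"
proof (induction d)
  case 0
  then show ?case using assms by (simp add: split_lists_0)
next
  case (Suc d)
  let ?A = "(\<lambda>(q, f). (Suc q, 0 # f)) ` split_lists d i 0"
  let ?L = "{f :: nat list. length f = Suc d \<and> sum_list f = i - 1}"
  let ?B = "(\<lambda>f. (0, Suc (hd f) # tl f)) ` ?L"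
  have eq: "split_lists (Suc d) i 0 = ?A \<union> ?B"
  proof (intro equalityI subsetI)
    fix z assume "z \<in> split_lists (Suc d) i 0"
    then obtain q h f where "z = (q, h # f)" "(q, h # f) \<in> split_lists (Suc d) i 0"
      by (rule split_lists_SucE)
    then have z: "z = (q, h # f)" "q < Suc d" "length f = d" "h + sum_list f = i"
      "sum_list (take q (h # f)) = 0" "0 < (h # f) ! q"
      by (simp_all add: split_lists_def)
    show "z \<in> ?A \<union> ?B"
    proof (cases q)
      case 0
      then have "z = (\<lambda>f. (0, Suc (hd f) # tl f)) ((h - 1) # f)" "(h - 1) # f \<in> ?L"
        using z by auto
      then show ?thesis by blast
    next
      case (Suc p)
      then have "z = (\<lambda>(q, f). (Suc q, 0 # f)) (p, f)" "(p, f) \<in> split_lists d i 0"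
        using z by (auto simp: split_lists_def)
      then show ?thesis by blast
    qed
  next
    fix z assume "z \<in> ?A \<union> ?B"
    then show "z \<in> split_lists (Suc d) i 0"
      using assms by (auto simp: split_lists_def length_Suc_conv)
  qed
  have dis: "?A \<inter> ?B = {}" by auto
  have cA: "card ?A = (d + i - 1) choose i"
    by (subst card_image) (auto simp: inj_on_def Suc.IH)
  have cB: "card ?B = card ?L"
    by (intro card_image inj_onI) (auto intro: list.expand)
  have cL: "card ?L = (i - 1 + d) choose (i - 1)"
    using card_length_sum_list[of "Suc d" "i - 1"] by simp
  have fin: "finite ?A" "finite ?B"
    by (simp_all add: finite_split_lists finite_lists_sum)
  have "card (split_lists (Suc d) i 0) = ((d + i - 1) choose i) + ((i - 1 + d) choose (i - 1))"
    by (simp only: eq card_Un_disjoint[OF fin dis] cA cB cL)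
  also have "\<dots> = (Suc d + i - 1) choose i"
    using assms by (cases i) (simp_all add: add.commute)
  finally show ?case .
qed

text \<open>Equivalently, weakly increasing words of length \<open>i\<close> in \<open>d\<close> letters with a prescribed
  strict ascent.\<close>
lemma card_split_lists:
  assumes "0 < s" "s < i"
  shows "card (split_lists d i s) = (d + i - 2) choose i"
  using assms
proof (induction s arbitrary: i d)
  case 0
  then show ?case by simp
next
  case (Suc s)
  note IHs = Suc.IH
  from Suc.prems have i: "Suc s < i" by simp
  show ?case
  proof (induction d)
    case 0
    then show ?case using i by (simp add: split_lists_0)
  next
    case (Suc d)
    let ?A = "(\<lambda>(q, f). (Suc q, 0 # f)) ` split_lists d i (Suc s)"
    \<comment> \<open>A positive first entry is lowered by one, and the prefix sum with it, since
      \<open>q > 0\<close>. If the prefix sum would reach 0, the first entry is exactly 1 and is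
      dropped instead: keeping it as 0 would not hit the lists with prefix sum 0 that have
      \<open>q = 0\<close>.\<close>
    let ?C = "if s = 0 then (\<lambda>(q, f). (Suc q, 1 # f)) ` split_lists d (i - 1) 0
              else (\<lambda>(q, f). (q, Suc (hd f) # tl f)) ` split_lists (Suc d) (i - 1) s"
    have eq: "split_lists (Suc d) i (Suc s) = ?A \<union> ?C"
    proof (intro equalityI subsetI)
      fix z assume "z \<in> split_lists (Suc d) i (Suc s)"
      then obtain q h f where "z = (q, h # f)" "(q, h # f) \<in> split_lists (Suc d) i (Suc s)"
        by (rule split_lists_SucE)
      then have z: "z = (q, h # f)" "q < Suc d" "length f = d" "h + sum_list f = i"
        "sum_list (take q (h # f)) = Suc s" "0 < (h # f) ! q"
        by (simp_all add: split_lists_def)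
      from z obtain p where q: "q = Suc p" by (cases q) auto
      show "z \<in> ?A \<union> ?C"
      proof (cases h)
        case 0
        then have "z = (\<lambda>(q, f). (Suc q, 0 # f)) (p, f)" "(p, f) \<in> split_lists d i (Suc s)"
          using z q by (auto simp: split_lists_def)
        then show ?thesis by blast
      next
        case (Suc h')
        show ?thesis
        proof (cases "s = 0")
          case True
          then have "z = (\<lambda>(q, f). (Suc q, 1 # f)) (p, f)" "(p, f) \<in> split_lists d (i - 1) 0"
            using z q Suc by (auto simp: split_lists_def)
          then have "z \<in> (\<lambda>(q, f). (Suc q, 1 # f)) ` split_lists d (i - 1) 0"
            by (rule image_eqI)
          then show ?thesis by (simp only: True if_True refl Un_iff simp_thms)
        next
          case False
          then have "z = (\<lambda>(q, f). (q, Suc (hd f) # tl f)) (q, h' # f)"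
            "(q, h' # f) \<in> split_lists (Suc d) (i - 1) s"
            using z q Suc by (auto simp: split_lists_def)
          then have "z \<in> (\<lambda>(q, f). (q, Suc (hd f) # tl f)) ` split_lists (Suc d) (i - 1) s"
            by (rule image_eqI)
          then show ?thesis by (simp only: False if_False Un_iff simp_thms)
        qed
      qed
    next
      fix z assume z: "z \<in> ?A \<union> ?C"
      show "z \<in> split_lists (Suc d) i (Suc s)"
      proof (cases "z \<in> ?A")
        case True
        then show ?thesis by (auto simp: split_lists_def)
      next
        case False
        with z have zC: "z \<in> ?C" by simp
        show ?thesis
        proof (cases "s = 0")
          case True
          then show ?thesis using zC i by (auto simp: split_lists_def)
        next
          case False
          with zC obtain q f where f: "(q, f) \<in> split_lists (Suc d) (i - 1) s"
            "z = (q, Suc (hd f) # tl f)" by auto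
          from f(1) obtain h f' where "f = h # f'" by (auto simp: split_lists_def length_Suc_conv)
          moreover from f(1) False obtain p where "q = Suc p" by (cases q) (auto simp: split_lists_def)
          ultimately show ?thesis using f i by (auto simp: split_lists_def)
        qed
      qed
    qed
    have dis: "?A \<inter> ?C = {}" by (auto split: if_splits)
    have cA: "card ?A = (d + i - 2) choose i"
      by (subst card_image) (auto simp: inj_on_def Suc.IH)
    have cC: "card ?C = (d + i - 2) choose (i - 1)"
    proof (cases "s = 0")
      case True
      then show ?thesis using i card_split_lists_first[of "i - 1" d]
        by (simp add: card_image inj_on_def split: prod.splits) (simp add: numeral_2_eq_2)
    next
      case False
      have "inj_on (\<lambda>(q :: nat, f). (q, Suc (hd f) # tl f)) (split_lists (Suc d) (i - 1) s)"
        by (intro inj_onI) (auto simp: split_lists_def intro: list.expand)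
      then show ?thesis using i False IHs[of "i - 1" "Suc d"]
        by (simp add: card_image)
    qed
    have fin: "finite ?A" "finite ?C"
      by (simp_all add: finite_split_lists)
    have "card (split_lists (Suc d) i (Suc s)) =
        ((d + i - 2) choose i) + ((d + i - 2) choose (i - 1))"
      by (simp only: eq card_Un_disjoint[OF fin dis] cA cC)
    also have "\<dots> = (Suc d + i - 2) choose i"
    proof -
      obtain k where "i = Suc (Suc k)" using i by (metis less_iff_Suc_add add_Suc)
      then show ?thesis by simp
    qed
    finally show ?case .
  qed
qed

lemma choose_shifted_Vandermonde:
  assumes "2 \<le> i"
  shows "(\<Sum>l = 2..i. ((i - 2) choose (l - 2)) * (d choose l)) = (d + i - 2) choose i"
proof -
  have "(d + i - 2) choose i = (\<Sum>k\<le>i. (d choose k) * ((i - 2) choose (i - k)))"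
    using vandermonde[of d "i - 2" i] assms by simp
  also have "\<dots> = (\<Sum>k\<in>{2..i}. (d choose k) * ((i - 2) choose (i - k)))"
    \<comment> \<open>For \<open>k < 2\<close> the second factor vanishes because
      \<open>i - k > i - 2\<close>.\<close>
    using assms by (intro sum.mono_neutral_right) (auto simp: not_le)
  also have "\<dots> = (\<Sum>l = 2..i. ((i - 2) choose (l - 2)) * (d choose l))"
  proof (rule sum.cong)
    fix l assume "l \<in> {2..i}"
    then have "l - 2 \<le> i - 2" "i - 2 - (l - 2) = i - l" by auto
    then show "(d choose l) * ((i - 2) choose (i - l)) = ((i - 2) choose (l - 2)) * (d choose l)"
      using binomial_symmetric[of "l - 2" "i - 2"] by (simp only: mult.commute)
  qed simp
  finally show ?thesis ..
qed

section \<open>Address trees and configurations around a branching vertex\<close>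

lemma append_less_append [simp]: "as @ bs < as @ cs \<longleftrightarrow> bs < (cs :: 'b :: linorder list)"
  by (induction as) auto

lemma less_append [simp]: "as < as @ (bs :: 'b :: linorder list) \<longleftrightarrow> bs \<noteq> []"
  using append_less_append[of as "[]" bs] by (cases bs) auto

lemma not_append_less [simp]: "\<not> as @ bs < (as :: 'b :: linorder list)"
  using append_less_append[of as bs "[]"] by (simp only: append_Nil2 not_less_Nil simp_thms)

lemma butlast_replicate: "butlast (replicate m a) = replicate (m - 1) a"
  by (cases m) (simp_all flip: replicate_append_same)

lemma butlast_less: "y \<noteq> [] \<Longrightarrow> butlast y < (y :: 'b :: linorder list)"
  by (metis append_butlast_last_id less_append not_Cons_self2)

text \<open>Whatever exceeds \<open>x\<close> without extending it is larger at some digit of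
  \<open>x\<close>, hence exceeds every extension of \<open>x\<close> too. Below
  \<open>x @ [g]\<close> only proper extensions of \<open>x\<close> remain, and these must continue
  with a smaller digit.\<close>

lemma between_siblings:
  fixes x z :: "'b :: linorder list"
  assumes "x < z" "z < x @ [g]"
  obtains h \<gamma> where "z = x @ h # \<gamma>" "h < g"
proof -
  from assms have "\<exists>h \<gamma>. z = x @ h # \<gamma> \<and> h < g"
  proof (induction x arbitrary: z)
    case Nil
    then show ?case by (cases z) auto
  next
    case (Cons a x)
    then show ?case by (cases z) fastforce+
  qed
  then show thesis using that by blast
qed

text \<open>An element of length m brings its m + 1 prefixes along, so all lengths stay below the
  cardinality. Therefore \<open>rep\<close> is asked only for such short elements, the range in
  which subdivision excludes branching. The inclusion is then one between sets of equal
  size.\<close>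

lemma chain_set:
  fixes \<Gamma> :: "nat list set"
  assumes fin: "finite \<Gamma>"
    and closed: "\<And>\<gamma> h. \<gamma> @ [h] \<in> \<Gamma> \<Longrightarrow> \<gamma> \<in> \<Gamma>"
    and rep: "\<And>\<gamma>. \<gamma> \<in> \<Gamma> \<Longrightarrow> length \<gamma> < card \<Gamma> \<Longrightarrow> \<gamma> = replicate (length \<gamma>) 1"
  shows "\<Gamma> = (\<lambda>m. replicate m 1) ` {..<card \<Gamma>}"
proof (rule card_subset_eq)
  have pre: "\<gamma> @ \<delta> \<in> \<Gamma> \<Longrightarrow> \<gamma> \<in> \<Gamma>" for \<gamma> \<delta>
    by (induction \<delta> rule: rev_induct) (auto simp flip: append_assoc dest: closed)
  have "length \<gamma> < card \<Gamma>" if "\<gamma> \<in> \<Gamma>" for \<gamma>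
  proof -
    have "inj_on (\<lambda>k. take k \<gamma>) {..length \<gamma>}"
      by (intro inj_onI) (metis atMost_iff length_take min.absorb2)
    moreover have "(\<lambda>k. take k \<gamma>) ` {..length \<gamma>} \<subseteq> \<Gamma>"
      using pre that by (metis append_take_drop_id image_subsetI)
    ultimately have "card {..length \<gamma>} \<le> card \<Gamma>"
      using fin by (metis card_inj_on_le)
    then show ?thesis by simp
  qed
  with rep show "\<Gamma> \<subseteq> (\<lambda>m. replicate m 1) ` {..<card \<Gamma>}"
    by (metis image_eqI lessThan_iff subsetI)
  have "inj_on (\<lambda>m. replicate m (1 :: nat)) {..<card \<Gamma>}"
    by (intro inj_onI) (metis length_replicate)
  then show "card \<Gamma> = card ((\<lambda>m. replicate m (1 :: nat)) ` {..<card \<Gamma>})"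
    by (simp add: card_image)
qed simp

text \<open>Children are numbered from 1, since 0 is reserved for the edge towards the root. For
  \<open>k \<le> n\<close> these are the first \<open>k\<close> vertices of the whole order (see
  \<open>below_stem\<close> and \<open>rank_less_iff\<close>).\<close>

definition ones :: "nat \<Rightarrow> nat list set" where
  "ones k = (\<lambda>m. replicate m 1) ` {..<k}"

lemma ones_simps: "finite (ones k)" "card (ones k) = k"
proof -
  have "inj_on (\<lambda>m. replicate m (1 :: nat)) {..<k}"
    by (intro inj_onI) (metis length_replicate)
  then show "card (ones k) = k" by (simp add: ones_def card_image)
qed (simp add: ones_def)

text \<open>The first \<open>f ! g\<close> vertices of the unbranched path that leaves \<open>x\<close> along its edge number
  \<open>g + 1\<close>, for all \<open>g < k\<close>.\<close>
definition branches :: "nat list \<Rightarrow> nat list \<Rightarrow> nat \<Rightarrow> nat list set" where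
  "branches x f k = (\<lambda>(g, m). x @ Suc g # replicate m 1) ` (SIGMA g:{..<k}. {..<f ! g})"

lemma mem_branches: "b \<in> branches x f k \<longleftrightarrow> (\<exists>g m. b = x @ Suc g # replicate m 1 \<and> g < k \<and> m < f ! g)"
  by (auto simp: branches_def)

lemma append_mem_branches:
  "x @ Suc g # replicate m 1 \<in> branches x f k \<longleftrightarrow> g < k \<and> m < f ! g"
  by (auto simp: mem_branches replicate_eq_replicate)

lemmas append_mem_branches_Suc [simp] = append_mem_branches[unfolded One_nat_def]

lemma finite_branches [simp]: "finite (branches x f k)"
  by (simp add: branches_def)

lemma card_branches:
  assumes "k \<le> length f"
  shows "card (branches x f k) = sum_list (take k f)"
proof -
  have "card (branches x f k) = card (SIGMA g:{..<k}. {..<f ! g})"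
    unfolding branches_def
    by (intro card_image inj_onI) (auto simp: replicate_eq_replicate)
  also have "\<dots> = (\<Sum>g<k. f ! g)" by (simp add: card_SigmaI)
  also have "\<dots> = sum_list (take k f)"
    using assms by (simp add: sum_list_sum_nth atLeast0LessThan min_absorb2)
  finally show ?thesis .
qed

lemma branches_less:
  assumes "q \<le> k"
  shows "{b \<in> branches x f k. b < x @ [Suc q]} = branches x f q"
  using assms by (auto simp: mem_branches)

text \<open>The tree reduced to what the counting needs: \<open>D\<close> is the set of addresses,
  \<open>kids\<close> the number of children. \<open>stem\<close> and \<open>segment\<close> are the
  subdivision hypothesis for paths descending from the root and from a branching vertex. The value 1
  excludes leaves as well as branchings, so the unbranched paths also have a guaranteed
  length.\<close>

locale num_tree =
  fixes n :: nat and D :: "nat list set" and kids :: "nat list \<Rightarrow> nat"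
  assumes n2: "2 \<le> n"
    and fin: "finite D"
    and nil: "[] \<in> D"
    and closed1: "\<alpha> @ [g] \<in> D \<Longrightarrow> \<alpha> \<in> D"
    and kids: "\<alpha> \<in> D \<Longrightarrow> \<alpha> @ [g] \<in> D \<longleftrightarrow> 1 \<le> g \<and> g \<le> kids \<alpha>"
    and stem: "\<alpha> \<in> D \<Longrightarrow> length \<alpha> < n - 1 \<Longrightarrow> kids \<alpha> = 1"
    and segment: "\<alpha> \<in> D \<Longrightarrow> 2 \<le> kids \<alpha> \<Longrightarrow> \<alpha> @ \<beta> \<in> D \<Longrightarrow> \<beta> \<noteq> [] \<Longrightarrow> length \<beta> < n - 1 \<Longrightarrow>
      kids (\<alpha> @ \<beta>) = 1"
begin

lemma closed: "\<alpha> @ \<beta> \<in> D \<Longrightarrow> \<alpha> \<in> D"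
  by (induction \<beta> rule: rev_induct) (auto simp flip: append_assoc dest: closed1)

lemma butlast_mem: "\<alpha> \<in> D \<Longrightarrow> butlast \<alpha> \<in> D"
  by (cases \<alpha> rule: rev_cases) (auto dest: closed1)

lemma stem_eq: "\<alpha> \<in> D \<Longrightarrow> length \<alpha> \<le> n - 1 \<Longrightarrow> \<alpha> = replicate (length \<alpha>) 1"
proof (induction \<alpha> rule: rev_induct)
  case (snoc g \<alpha>)
  then have "\<alpha> \<in> D" "kids \<alpha> = 1" using closed1 stem by auto
  with snoc.prems kids[of \<alpha> g] have "g = 1" by auto
  moreover have "\<alpha> = replicate (length \<alpha>) 1" using snoc \<open>\<alpha> \<in> D\<close> by simp
  ultimately show ?case by (metis length_append_singleton replicate_Suc replicate_append_same)
qed simp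

lemma replicate_mem: "m \<le> n - 1 \<Longrightarrow> replicate m 1 \<in> D"
proof (induction m)
  case (Suc m)
  then have "replicate m 1 \<in> D" "kids (replicate m 1) = 1" using stem by auto
  then show ?case using kids[of "replicate m 1" 1] by (simp add: replicate_append_same)
qed (simp add: nil)

text \<open>The digit \<open>g\<close> is free because \<open>\<alpha>\<close> branches. Every later
  digit is chosen at a vertex at distance less than \<open>n - 1\<close> below
  \<open>\<alpha>\<close>, whose only child has number 1.\<close>

lemma segment_eq:
  "\<alpha> \<in> D \<Longrightarrow> 2 \<le> kids \<alpha> \<Longrightarrow> \<alpha> @ g # \<gamma> \<in> D \<Longrightarrow> length \<gamma> < n - 1 \<Longrightarrow> \<gamma> = replicate (length \<gamma>) 1"
proof (induction \<gamma> rule: rev_induct)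
  case (snoc h \<gamma>)
  then have *: "(\<alpha> @ g # \<gamma>) @ [h] \<in> D" by simp
  then have D: "\<alpha> @ g # \<gamma> \<in> D" by (rule closed1)
  with snoc.prems have "kids (\<alpha> @ g # \<gamma>) = 1" by (intro segment) auto
  with D * kids[of "\<alpha> @ g # \<gamma>" h] have "h = 1" by auto
  moreover have "\<gamma> = replicate (length \<gamma>) 1" using D snoc by simp
  ultimately show ?case by (metis length_append_singleton replicate_Suc replicate_append_same)
qed simp

lemma segment_mem:
  assumes "\<alpha> \<in> D" "2 \<le> kids \<alpha>" "1 \<le> g" "g \<le> kids \<alpha>" "m < n - 1"
  shows "\<alpha> @ g # replicate m 1 \<in> D"
  using assms(5)
proof (induction m)
  case 0
  then show ?case using assms kids by simp
next
  case (Suc m)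
  then have D: "\<alpha> @ g # replicate m 1 \<in> D" by simp
  then have "kids (\<alpha> @ g # replicate m 1) = 1" using assms Suc.prems by (intro segment) auto
  then show ?case using D kids[of "\<alpha> @ g # replicate m 1" 1] by (simp add: replicate_append_same)
qed

lemma length_branching: "\<alpha> \<in> D \<Longrightarrow> 2 \<le> kids \<alpha> \<Longrightarrow> n - 1 \<le> length \<alpha>"
  using stem[of \<alpha>] by linarith

lemma stem_less:
  assumes "x \<in> D" "m < length x" "m \<le> n - 1"
  shows "replicate m 1 < x"
proof -
  have "take m x \<in> D" using assms(1) closed[of "take m x" "drop m x"] by simp
  with assms stem_eq[of "take m x"] have "x = replicate m 1 @ drop m x"
    by (metis append_take_drop_id length_take less_imp_le min.absorb2)
  moreover have "drop m x \<noteq> []" using assms by simp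
  ultimately show ?thesis by (metis less_append)
qed

section \<open>Supports of critical 1-cells and their number\<close>

text \<open>\<open>y\<close> is the upper end of the edge of a critical 1-cell, \<open>butlast y\<close> its lower end, and \<open>A\<close>
  the set of the vertex coordinates.\<close>
definition conf :: "nat list \<Rightarrow> nat list set \<Rightarrow> bool" where
  "conf y A \<longleftrightarrow> y \<in> D \<and> y \<noteq> [] \<and> A \<subseteq> D \<and> y \<notin> A \<and> butlast y \<notin> A \<and>
     (\<forall>a\<in>A. a = [] \<or> butlast a \<in> A \<union> {y, butlast y}) \<and>
     (\<exists>v\<in>A. v \<noteq> [] \<and> butlast v = butlast y \<and> v < y)"

definition confs :: "nat \<Rightarrow> nat \<Rightarrow> (nat list \<times> nat list set) set" where
  "confs i j = {(y, A). conf y A \<and> card A = n - 1 \<and> card {a \<in> A. a < butlast y} = n - i \<and>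
     card {a \<in> A. butlast y < a \<and> a < y} = j - 1}"

text \<open>The vertex \<open>y = x @ [Suc q]\<close> heads branch \<open>q\<close> and is removed
  at the end, so the branches have total length \<open>i\<close> although they carry only
  \<open>i - 1\<close> vertex coordinates. The \<open>Suc\<close> arises because branches are
  indexed from 0 and the edges to children numbered from 1.\<close>

definition build :: "nat \<Rightarrow> nat list \<times> nat \<times> nat list \<Rightarrow> nat list \<times> nat list set" where
  "build i = (\<lambda>(x, q, f). (x @ [Suc q], ones (n - i) \<union> branches x f (kids x) - {x @ [Suc q]}))"

context
  fixes i j :: nat
  assumes ij: "2 \<le> j" "j \<le> i" "i \<le> n"
begin

text \<open>Since \<open>j - 1 > 0\<close>, some branch before \<open>q\<close> is nonempty, and so
  is branch \<open>q\<close>. Thus \<open>x\<close> branches, lies at depth at least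
  \<open>n - 1\<close>, and each single branch misses a vertex of another one. The resulting strict
  bound \<open>f ! g < i\<close> keeps every branch within the \<open>n - 1\<close> vertices that
  \<open>segment\<close> guarantees.\<close>

lemma split_listsD:
  assumes "x \<in> D" "(q, f) \<in> split_lists (kids x) i (j - 1)"
  shows "n - 1 \<le> length x" "2 \<le> kids x" "g < kids x \<Longrightarrow> f ! g < i" "\<exists>p<q. 0 < f ! p"
proof -
  have f: "q < kids x" "length f = kids x" "sum_list f = i" "sum_list (take q f) = j - 1" "0 < f ! q"
    using assms(2) by (auto simp: split_lists_def)
  have "\<exists>e\<in>set (take q f). 0 < e"
  proof (rule ccontr)
    assume "\<not> ?thesis"
    then have "sum_list (take q f) = 0" by (auto simp: sum_list_eq_0_iff)
    with f ij show False by simp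
  qed
  then obtain p where p: "p < q" "0 < f ! p" using f by (auto simp: in_set_conv_nth)
  then show "\<exists>p<q. 0 < f ! p" by blast
  show k: "2 \<le> kids x" using p f by simp
  show "n - 1 \<le> length x" using length_branching[OF assms(1) k] .
  show "f ! g < i" if "g < kids x"
  proof -
    \<comment> \<open>One of \<open>p\<close> and \<open>q\<close> is a nonempty branch different
      from \<open>g\<close>.\<close>
    obtain h where h: "h \<noteq> g" "h < kids x" "0 < f ! h"
      using p f by (metis less_trans nat_neq_iff)
    have "sum ((!) f) {g, h} \<le> sum ((!) f) {..<kids x}"
      using h that by (intro sum_mono2) auto
    also have "\<dots> = i" using f by (simp add: sum_list_sum_nth atLeast0LessThan)
    finally show ?thesis using h by simp
  qed
qed

lemma build_mem_confs:
  assumes x: "x \<in> D" and qf: "(q, f) \<in> split_lists (kids x) i (j - 1)"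
  shows "build i (x, q, f) \<in> confs i j"
proof -
  note s = split_listsD[OF assms]
  have f: "q < kids x" "length f = kids x" "sum_list f = i" "sum_list (take q f) = j - 1" "0 < f ! q"
    using qf by (auto simp: split_lists_def)
  let ?y = "x @ [Suc q]" and ?B = "branches x f (kids x)"
  let ?A = "ones (n - i) \<union> ?B - {?y}"
  obtain p where p: "p < q" "0 < f ! p" using s(4) by blast
  have yB: "?y \<in> ?B" using append_mem_branches[of x q 0 f "kids x"] f by simp
  have pB: "x @ [Suc p] \<in> ?B" using append_mem_branches[of x p 0 f "kids x"] f p by simp
  have short: "length a < n - i" if "a \<in> ones (n - i)" for a
    using that by (auto simp: ones_def)
  have long: "length x < length b \<and> x < b" if "b \<in> ?B" for b
    using that by (auto simp: mem_branches)
  \<comment> \<open>Here \<open>i \<ge> 2\<close> enters: the stem part consists of addresses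
    strictly shorter than \<open>x\<close>, so it precedes \<open>x\<close> and is disjoint from the
    branches.\<close>
  have nx: "n - i < length x" using s(1) ij n2 by linarith
  have ltx: "a < x" if "a \<in> ones (n - i)" for a
    using that nx ij by (auto simp: ones_def simp del: One_nat_def intro!: stem_less x)
  have disj: "ones (n - i) \<inter> ?B = {}"
    using short long nx by fastforce
  have D: "?A \<subseteq> D"
  proof
    fix a assume "a \<in> ?A"
    then consider "a \<in> ones (n - i)" | "a \<in> ?B" by blast
    then show "a \<in> D"
    proof cases
      case 1
      then obtain m where m: "a = replicate m 1" "m < n - i" by (auto simp: ones_def)
      then have "m \<le> n - 1" by linarith
      then show ?thesis unfolding m by (rule replicate_mem)
    next
      case 2
      then obtain g m where a: "a = x @ Suc g # replicate m 1" "g < kids x" "m < f ! g"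
        by (auto simp: mem_branches)
      then have "m < n - 1" using s(3)[of g] ij by linarith
      with a show ?thesis using segment_mem[OF x s(2), of "Suc g" m] by simp
    qed
  qed
  have "a = [] \<or> butlast a \<in> ?A \<union> {?y, x}" if "a \<in> ?A" for a
  proof -
    from that consider "a \<in> ones (n - i)" | "a \<in> ?B" by blast
    then show ?thesis
    proof cases
      case 1
      then obtain m where m: "a = replicate m 1" "m < n - i" by (auto simp: ones_def)
      then have "butlast a = replicate (m - 1) 1" "m - 1 < n - i" by (auto simp: butlast_replicate)
      then have "butlast a \<in> ones (n - i)" unfolding ones_def by blast
      then show ?thesis by auto
    next
      case 2
      then obtain g m where a: "a = x @ Suc g # replicate m 1" "g < kids x" "m < f ! g"
        by (auto simp: mem_branches)
      show ?thesis
      proof (cases m)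
        case 0
        then show ?thesis using a by (simp add: butlast_append)
      next
        case (Suc k)
        then have "butlast a = x @ Suc g # replicate k 1"
          using a by (simp add: butlast_append flip: replicate_append_same)
        then have "butlast a \<in> ?B" using a Suc by simp
        then show ?thesis by auto
      qed
    qed
  qed
  moreover have "x @ [Suc p] \<in> ?A" using pB p by simp
  moreover have "x \<notin> ?A" using ltx long by blast
  moreover have "?y \<in> D" using kids[OF x] f by simp
  ultimately have conf: "conf ?y ?A" using D p unfolding conf_def
    by (auto intro!: bexI[of _ "x @ [Suc p]"])
  have "?A = ones (n - i) \<union> (?B - {?y})" using disj yB by blast
  moreover have "card (ones (n - i) \<union> (?B - {?y})) = card (ones (n - i)) + card (?B - {?y})"
    using disj by (intro card_Un_disjoint) (auto simp: ones_simps)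
  moreover have "card (?B - {?y}) = i - 1"
    using yB f card_branches[of "kids x" f x] by simp
  ultimately have card: "card ?A = n - 1" using ij by (simp add: ones_simps)
  have lt: "{a \<in> ?A. a < x} = ones (n - i)"
  proof (intro equalityI subsetI)
    fix a assume "a \<in> {a \<in> ?A. a < x}"
    then show "a \<in> ones (n - i)" using long[of a] by auto
  next
    fix a assume a: "a \<in> ones (n - i)"
    then have "a \<noteq> ?y" using disj yB by blast
    then show "a \<in> {a \<in> ?A. a < x}" using a ltx by blast
  qed
  have "{a \<in> ?A. x < a \<and> a < ?y} = {b \<in> ?B. b < ?y}"
    using long ltx by fastforce
  also have "\<dots> = branches x f q" using f by (simp add: branches_less)
  finally have "card {a \<in> ?A. x < a \<and> a < ?y} = j - 1"
    using f by (simp add: card_branches)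
  then show ?thesis using conf card lt by (simp add: build_def confs_def ones_simps)
qed

text \<open>The first component gives \<open>x\<close> and \<open>q\<close>. Putting it back and
  keeping the addresses longer than \<open>x\<close> separates the branches from the stem part, and
  the branches give \<open>f\<close> entry by entry.\<close>

lemma inj_on_build: "inj_on (build i) (SIGMA x:D. split_lists (kids x) i (j - 1))"
proof (intro inj_onI)
  fix z z' assume z: "z \<in> (SIGMA x:D. split_lists (kids x) i (j - 1))"
    and z': "z' \<in> (SIGMA x:D. split_lists (kids x) i (j - 1))" and eq: "build i z = build i z'"
  obtain x q f where xqf: "z = (x, q, f)" by (metis surj_pair)
  obtain x' q' f' where "z' = (x', q', f')" by (metis surj_pair)
  with eq xqf have xqf': "z' = (x, q, f')" by (auto simp: build_def)
  have recover: "branches x g (kids x) =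
      {b \<in> snd (build i (x, q, g)) \<union> {x @ [Suc q]}. length x < length b}"
    if "(q, g) \<in> split_lists (kids x) i (j - 1)" for g
  proof -
    have "x @ [Suc q] \<in> branches x g (kids x)"
      using that append_mem_branches[of x q 0 g "kids x"] by (auto simp: split_lists_def)
    moreover have "length b \<le> length x" if "b \<in> ones (n - i)" for b
      using that split_listsD(1)[OF _ \<open>(q, g) \<in> _\<close>] z xqf ij by (auto simp: ones_def)
    ultimately show ?thesis by (fastforce simp: build_def mem_branches)
  qed
  have qf: "(q, f) \<in> split_lists (kids x) i (j - 1)" "(q, f') \<in> split_lists (kids x) i (j - 1)"
    using z z' xqf xqf' by auto
  then have eqB: "branches x f (kids x) = branches x f' (kids x)"
    using recover eq xqf xqf' by simp
  have "f = f'"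
  proof (rule nth_equalityI)
    show "length f = length f'" using qf by (auto simp: split_lists_def)
    fix g assume "g < length f"
    then have "g < kids x" using qf by (auto simp: split_lists_def)
    then have "m < f ! g \<longleftrightarrow> m < f' ! g" for m
      using eqB append_mem_branches[of x g m] by metis
    then show "f ! g = f' ! g" by (meson nat_neq_iff)
  qed
  then show "z = z'" using xqf xqf' by simp
qed

text \<open>The coordinates are split by whether they lie in the subtree of \<open>x\<close>. The
  blocking condition makes the outer part closed under parents, and also each branch once
  \<open>y\<close> is put back. The sibling \<open>v\<close> keeps the sizes small enough for
  \<open>chain_set\<close>: it is missing from the outer part, and its branch differs from that of
  \<open>y\<close>.\<close>

lemma confs_imp_build:
  assumes "(y, A) \<in> confs i j"
  shows "(y, A) \<in> build i ` (SIGMA x:D. split_lists (kids x) i (j - 1))"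
proof -
  define x where "x = butlast y"
  define q where "q = last y - 1"
  have c: "y \<in> D" "y \<noteq> []" "A \<subseteq> D" "y \<notin> A" "x \<notin> A"
      "\<And>a. a \<in> A \<Longrightarrow> a = [] \<or> butlast a \<in> A \<union> {y, x}"
      "card A = n - 1" "card {a \<in> A. a < x} = n - i" "card {a \<in> A. x < a \<and> a < y} = j - 1"
    using assms unfolding confs_def conf_def x_def by auto
  obtain v where v: "v \<in> A" "v \<noteq> []" "butlast v = x" "v < y"
    using assms unfolding confs_def conf_def x_def by auto
  have finA: "finite A" using c(3) fin finite_subset by blast
  have x: "x \<in> D" using c(1) butlast_mem x_def by simp
  have ylast: "y = x @ [last y]" using c(2) x_def by simp
  have vlast: "v = x @ [last v]" using v by (metis append_butlast_last_id)
  have last: "last v < last y" "1 \<le> last v" "last y \<le> kids x"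
    using v(4) ylast vlast kids[OF x, of "last v"] kids[OF x, of "last y"] c v
    by (metis (no_types, lifting) append_less_append Cons_less_Cons not_less_Nil, metis subsetD, metis)
  then have y: "y = x @ [Suc q]" "q < kids x" using ylast by (auto simp: q_def)
  have two: "2 \<le> kids x" using last by linarith
  have nx: "n - 1 \<le> length x" using length_branching[OF x two] .
  define A1 where "A1 = {a \<in> A. \<not> prefix x a}"
  \<comment> \<open>The set \<open>A1\<close> misses \<open>v\<close>, so it has at most
    \<open>n - 2\<close> elements and cannot leave the stem.\<close>
  have "card A1 < card A" using v vlast finA
    by (intro psubset_card_mono) (auto simp: A1_def prefix_def)
  then have cA1: "card A1 \<le> n - 2" using c by linarith
  have A1: "A1 = ones (card A1)" unfolding ones_def
  proof (rule chain_set)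
    fix \<gamma> h assume g: "\<gamma> @ [h] \<in> A1"
    then have "\<gamma> \<in> A \<union> {y, x}" "\<not> prefix x \<gamma>"
      using c(6)[of "\<gamma> @ [h]"] by (auto simp: A1_def)
    then show "\<gamma> \<in> A1" using y by (auto simp: A1_def)
  next
    fix \<gamma> assume "\<gamma> \<in> A1" "length \<gamma> < card A1"
    then show "\<gamma> = replicate (length \<gamma>) 1"
      using cA1 c(3) by (intro stem_eq) (auto simp: A1_def)
  qed (simp add: A1_def finA)
  have less_x: "a < x \<longleftrightarrow> a \<in> A1" if "a \<in> A" for a
  proof
    assume "a < x"
    then show "a \<in> A1" using that by (auto simp: A1_def prefix_def)
  next
    assume "a \<in> A1"
    then obtain m where "a = replicate m 1" "m < card A1" using A1 by (auto simp: ones_def)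
    then show "a < x" using x nx cA1 n2 by (auto simp del: One_nat_def intro!: stem_less)
  qed
  have "{a \<in> A. a < x} = A1" using less_x by (auto simp: A1_def)
  then have card_A1: "card A1 = n - i" using c by simp
  \<comment> \<open>Children of \<open>y\<close> may be coordinates, so the branches are closed
    under parents only after \<open>y\<close> is put back.\<close>
  define B where "B = insert y {a \<in> A. prefix x a}"
  have AB: "A = A1 \<union> (B - {y})" "A1 \<inter> (B - {y}) = {}" "y \<in> B"
    using c(4) by (auto simp: A1_def B_def)
  have finB: "finite B" using finA by (simp add: B_def)
  have "card A = card A1 + card (B - {y})"
    using AB finA finB by (metis card_Un_disjoint finite_Diff finite_Un)
  then have card_B: "card B = i" using AB(3) finB c(7) card_A1 ij n2
    by (simp add: card_Diff_singleton_if)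
  define \<Gamma> where "\<Gamma> g = {\<gamma>. x @ Suc g # \<gamma> \<in> B}" for g
  have fin\<Gamma>: "finite (\<Gamma> g)" for g
  proof (rule finite_imageD)
    show "finite ((\<lambda>\<gamma>. x @ Suc g # \<gamma>) ` \<Gamma> g)"
      by (rule finite_subset[OF _ finB]) (auto simp: \<Gamma>_def)
  qed (simp add: inj_on_def)
  define f where "f = map (\<lambda>g. card (\<Gamma> g)) [0..<kids x]"
  have vB: "v \<in> B" using v vlast by (auto simp: B_def prefix_def)
  have \<Gamma>: "\<Gamma> g = ones (card (\<Gamma> g))" for g unfolding ones_def
  proof (rule chain_set)
    fix \<gamma> h assume "\<gamma> @ [h] \<in> \<Gamma> g"
    then have "x @ Suc g # \<gamma> @ [h] \<in> B" by (simp add: \<Gamma>_def)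
    then have "x @ Suc g # \<gamma> @ [h] \<in> A" using y by (auto simp: B_def)
    then have "x @ Suc g # \<gamma> \<in> A \<union> {y, x}"
      using c(6)[of "x @ Suc g # \<gamma> @ [h]"] by (simp add: butlast_append)
    then show "\<gamma> \<in> \<Gamma> g" by (auto simp: \<Gamma>_def B_def prefix_def)
  next
    fix \<gamma> assume \<gamma>: "\<gamma> \<in> \<Gamma> g" "length \<gamma> < card (\<Gamma> g)"
    \<comment> \<open>The branches of \<open>v\<close> and \<open>y\<close> have different heads. At
      least one head lies outside branch \<open>g\<close>, which therefore has fewer than
      \<open>i\<close> elements.\<close>
    have "x @ [last v] \<in> B" "x @ [Suc q] \<in> B" "last v \<noteq> Suc q"
      using vB vlast AB(3) y(1) last(1) ylast by auto
    then obtain h where "x @ [h] \<in> B" "h \<noteq> Suc g" by metis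
    moreover from this have "x @ [h] \<notin> (\<lambda>\<gamma>. x @ Suc g # \<gamma>) ` \<Gamma> g" by auto
    moreover have "(\<lambda>\<gamma>. x @ Suc g # \<gamma>) ` \<Gamma> g \<subseteq> B" by (auto simp: \<Gamma>_def)
    ultimately have "(\<lambda>\<gamma>. x @ Suc g # \<gamma>) ` \<Gamma> g \<subset> B" by blast
    then have "card ((\<lambda>\<gamma>. x @ Suc g # \<gamma>) ` \<Gamma> g) < i"
      using finB card_B psubset_card_mono by metis
    then have "card (\<Gamma> g) < n" using ij by (simp add: card_image inj_on_def)
    moreover have "x @ Suc g # \<gamma> \<in> D" using \<gamma> c(1,3) by (auto simp: \<Gamma>_def B_def)
    ultimately show "\<gamma> = replicate (length \<gamma>) 1"
      using \<gamma> x two by (intro segment_eq[of x "Suc g"]) auto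
  qed (rule fin\<Gamma>)
  have Bf: "B = branches x f (kids x)"
  proof (intro equalityI subsetI)
    fix b assume b: "b \<in> B"
    then have bx: "b \<in> D" "prefix x b" "b \<noteq> x" using c y by (auto simp: B_def)
    then obtain h \<gamma> where h: "b = x @ h # \<gamma>" by (metis append_Nil2 neq_Nil_conv prefix_def)
    then have "x @ [h] \<in> D" using bx(1) closed[of "x @ [h]" \<gamma>] by simp
    then have "1 \<le> h" "h \<le> kids x" using kids[OF x] by auto
    then obtain g where g: "h = Suc g" "g < kids x" by (metis Suc_le_D One_nat_def Suc_le_eq)
    then have "\<gamma> \<in> ones (card (\<Gamma> g))" using b h \<Gamma>[of g] by (auto simp: \<Gamma>_def)
    then show "b \<in> branches x f (kids x)"
      using h g by (auto simp: ones_def mem_branches f_def)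
  next
    fix b assume "b \<in> branches x f (kids x)"
    then obtain g m where b: "b = x @ Suc g # replicate m 1" "g < kids x" "m < f ! g"
      by (auto simp: mem_branches)
    then have "replicate m 1 \<in> \<Gamma> g" using \<Gamma>[of g] by (auto simp: ones_def f_def)
    then show "b \<in> B" using b by (simp add: \<Gamma>_def)
  qed
  have "{a \<in> A. x < a \<and> a < y} = {b \<in> B. b < x @ [Suc q]}"
  proof (intro equalityI subsetI)
    fix a assume a: "a \<in> {a \<in> A. x < a \<and> a < y}"
    then have "a \<notin> A1" using less_x less_asym by blast
    then show "a \<in> {b \<in> B. b < x @ [Suc q]}" using a y(1) by (auto simp: A1_def B_def)
  next
    fix b assume b: "b \<in> {b \<in> B. b < x @ [Suc q]}"
    then have "b \<in> A" "prefix x b" using y(1) by (auto simp: B_def)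
    moreover from this have "b \<noteq> x" using c(5) by blast
    ultimately show "b \<in> {a \<in> A. x < a \<and> a < y}" using b y(1) by (auto simp: prefix_def)
  qed
  also have "\<dots> = branches x f q" unfolding Bf using y(2) by (simp add: branches_less)
  finally have "card (branches x f q) = j - 1" using c by simp
  then have "sum_list (take q f) = j - 1" using y by (simp add: card_branches f_def)
  moreover have "sum_list f = i"
    using card_B card_branches[of "kids x" f x] unfolding Bf by (simp add: f_def)
  moreover have "0 < f ! q"
    using AB(3) append_mem_branches[of x q 0 f "kids x"] unfolding Bf y by simp
  ultimately have "(q, f) \<in> split_lists (kids x) i (j - 1)"
    using y by (simp add: split_lists_def f_def)
  moreover have "build i (x, q, f) = (y, A)"
  proof -
    have "y \<notin> A1" using c(4) by (simp add: A1_def)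
    then have "A1 \<union> B - {y} = A" using AB by blast
    then show ?thesis using A1 card_A1 y Bf by (simp add: build_def)
  qed
  ultimately show ?thesis using x by (metis (no_types, lifting) SigmaI image_eqI)
qed

text \<open>The number does not depend on \<open>j\<close>. The summand vanishes at every vertex
  with at most one child, so only branching vertices contribute.\<close>

lemma card_confs:
  "finite (confs i j)" "card (confs i j) = (\<Sum>x\<in>D. (kids x + i - 2) choose i)"
proof -
  let ?S = "SIGMA x:D. split_lists (kids x) i (j - 1)"
  have "confs i j = build i ` ?S"
    using build_mem_confs confs_imp_build by auto
  moreover have "finite ?S" using fin by (simp add: finite_split_lists)
  moreover have "card ?S = (\<Sum>x\<in>D. (kids x + i - 2) choose i)"
    using fin ij by (simp add: card_SigmaI finite_split_lists card_split_lists)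
  ultimately show "finite (confs i j)" "card (confs i j) = (\<Sum>x\<in>D. (kids x + i - 2) choose i)"
    using inj_on_build by (simp_all add: card_image)
qed

end

end

section \<open>The rank permutation of a list\<close>

text \<open>Ranks are taken among the entries of the list, not in the tree. This makes sense for
  every 0-cell, critical or not, and sees only the relative order of the coordinates; for critical
  0-cells it agrees with \<open>perm_of\<close> (see \<open>perm_of_cell0\<close>).\<close>

definition order_perm :: "'b :: linorder list \<Rightarrow> nat \<Rightarrow> nat" where
  "order_perm ws k = (if 1 \<le> k \<and> k \<le> length ws then card {a \<in> set ws. a < ws ! (k - 1)} + 1 else k)"

lemma card_less_strict_mono:
  fixes B :: "'b :: linorder set"
  assumes "finite B" "a \<in> B" "a < b"
  shows "card {c \<in> B. c < a} < card {c \<in> B. c < b}"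
  using assms by (intro psubset_card_mono) auto

lemma bij_betw_card_less:
  fixes B :: "'b :: linorder set"
  assumes fin: "finite B"
  shows "bij_betw (\<lambda>a. card {c \<in> B. c < a}) B {..<card B}"
proof -
  let ?r = "\<lambda>a. card {c \<in> B. c < a}"
  have inj: "inj_on ?r B"
    by (rule linorder_inj_onI) (use card_less_strict_mono[OF fin] in \<open>auto dest: less_imp_neq\<close>)
  have "?r ` B \<subseteq> {..<card B}"
    using fin by (auto intro!: psubset_card_mono)
  moreover have "card (?r ` B) = card B" using inj by (rule card_image)
  ultimately have "?r ` B = {..<card B}" by (intro card_subset_eq) auto
  with inj show ?thesis by (simp add: bij_betw_def)
qed

lemma order_perm_permutes:
  assumes "distinct ws"
  shows "order_perm ws permutes {1..length ws}"
proof (rule bij_imp_permutes)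
  have r: "bij_betw (\<lambda>a. card {c \<in> set ws. c < a}) (set ws) {..<length ws}"
    using bij_betw_card_less[of "set ws"] distinct_card[OF assms] by simp
  have "inj_on (order_perm ws) {1..length ws}"
  proof (rule inj_onI)
    fix k l assume kl: "k \<in> {1..length ws}" "l \<in> {1..length ws}" "order_perm ws k = order_perm ws l"
    then have "ws ! (k - 1) \<in> set ws" "ws ! (l - 1) \<in> set ws" by auto
    with kl have "ws ! (k - 1) = ws ! (l - 1)"
      using bij_betw_imp_inj_on[OF r] by (auto simp: order_perm_def dest: inj_onD)
    moreover have "k - 1 < length ws" "l - 1 < length ws" using kl by auto
    ultimately have "k - 1 = l - 1" using assms by (simp add: nth_eq_iff_index_eq)
    with kl show "k = l" by auto
  qed
  moreover have "order_perm ws ` {1..length ws} \<subseteq> {1..length ws}"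
  proof
    fix m assume "m \<in> order_perm ws ` {1..length ws}"
    then obtain k where k: "k \<in> {1..length ws}" "m = order_perm ws k" by auto
    then have "ws ! (k - 1) \<in> set ws" by auto
    then have "card {c \<in> set ws. c < ws ! (k - 1)} < length ws"
      using bij_betwE[OF r] by auto
    with k show "m \<in> {1..length ws}" by (simp add: order_perm_def)
  qed
  ultimately show "bij_betw (order_perm ws) {1..length ws} {1..length ws}"
    by (simp add: bij_betw_def endo_inj_surj)
qed (auto simp: order_perm_def)

text \<open>A permutation prescribes the rank of every entry, and ranks within \<open>B\<close> can
  be inverted. For \<open>B = ones n\<close> this enumerates the critical 0-cells; for
  \<open>B\<close> the entries of the lower face of an edge it yields the one arrangement with a
  given source.\<close>

lemma bij_betw_order_perm:
  fixes B :: "'b :: linorder set"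
  assumes fin: "finite B"
  shows "bij_betw order_perm {ws. distinct ws \<and> set ws = B} {\<tau>. \<tau> permutes {1..card B}}"
  unfolding bij_betw_def
proof (intro conjI inj_onI equalityI subsetI)
  let ?r = "\<lambda>a. card {c \<in> B. c < a}"
  have r: "bij_betw ?r B {..<card B}" by (rule bij_betw_card_less[OF fin])
  {
    fix ws ws' assume ws: "ws \<in> {ws. distinct ws \<and> set ws = B}" "ws' \<in> {ws. distinct ws \<and> set ws = B}"
      and eq: "order_perm ws = order_perm ws'"
    then have len: "length ws = card B" "length ws' = card B"
      using distinct_card[of ws] distinct_card[of ws'] by auto
    show "ws = ws'"
    proof (rule nth_equalityI)
      fix k assume k: "k < length ws"
      have "order_perm ws (Suc k) = order_perm ws' (Suc k)" using eq by simp
      then have "?r (ws ! k) = ?r (ws' ! k)" using k len ws by (simp add: order_perm_def)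
      moreover have "ws ! k \<in> set ws" "ws' ! k \<in> set ws'" using k len by simp_all
      then have "ws ! k \<in> B" "ws' ! k \<in> B" using ws by simp_all
      ultimately show "ws ! k = ws' ! k" using r by (auto simp: bij_betw_def dest: inj_onD)
    qed (simp add: len)
  next
    fix \<tau> assume "\<tau> \<in> order_perm ` {ws. distinct ws \<and> set ws = B}"
    then show "\<tau> \<in> {\<tau>. \<tau> permutes {1..card B}}"
      using order_perm_permutes distinct_card by fastforce
  next
    fix \<tau> assume "\<tau> \<in> {\<tau>. \<tau> permutes {1..card B}}"
    then have \<tau>: "\<tau> permutes {1..card B}" by simp
    define ws where "ws = map (\<lambda>k. inv_into B ?r (\<tau> (Suc k) - 1)) [0..<card B]"
    have in1: "1 \<le> \<tau> (Suc k) \<and> \<tau> (Suc k) \<le> card B" if "k < card B" for k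
      using permutes_in_image[OF \<tau>, of "Suc k"] that by simp
    have rws: "?r (ws ! k) = \<tau> (Suc k) - 1" "ws ! k \<in> B" if "k < card B" for k
    proof -
      have "\<tau> (Suc k) - 1 \<in> ?r ` B" using r in1[OF that] by (auto simp: bij_betw_def)
      then show "?r (ws ! k) = \<tau> (Suc k) - 1" "ws ! k \<in> B"
        using that f_inv_into_f[of _ ?r B] inv_into_into[of _ ?r B] by (simp_all add: ws_def)
    qed
    have dist: "distinct ws"
    proof (rule distinct_conv_nth[THEN iffD2], intro allI impI)
      fix k l assume kl: "k < length ws" "l < length ws" "k \<noteq> l"
      then have "k < card B" "l < card B" by (simp_all add: ws_def)
      moreover have "\<tau> (Suc k) \<noteq> \<tau> (Suc l)"
        using kl permutes_inj[OF \<tau>] by (auto dest: injD)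
      ultimately show "ws ! k \<noteq> ws ! l" using rws(1)[of k] rws(1)[of l] in1[of k] in1[of l] by auto
    qed
    have len: "length ws = card B" by (simp add: ws_def)
    have "set ws \<subseteq> B" using rws(2) len by (auto simp: in_set_conv_nth)
    then have set: "set ws = B"
      using fin distinct_card[OF dist] len by (intro card_subset_eq) auto
    have "order_perm ws = \<tau>"
    proof
      fix k show "order_perm ws k = \<tau> k"
      proof (cases "k \<in> {1..card B}")
        case True
        then have "order_perm ws k = ?r (ws ! (k - 1)) + 1" by (simp add: order_perm_def len set)
        also have "\<dots> = \<tau> k"
        proof -
          have "k - 1 < card B" "Suc (k - 1) = k" using True by auto
          then show ?thesis using rws(1)[of "k - 1"] in1[of "k - 1"] by simp
        qed
        finally show ?thesis .
      next
        case False
        then show ?thesis using \<tau> by (auto simp: order_perm_def len permutes_def)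
      qed
    qed
    with dist set show "\<tau> \<in> order_perm ` {ws. distinct ws \<and> set ws = B}" by blast
  }
qed

text \<open>In a list without repetitions, counting smaller entries is counting positions of smaller
  entries, and the latter count involves comparisons only.\<close>

lemma order_perm_cong:
  assumes "length ws = length ws'" "distinct ws" "distinct ws'"
    and "\<And>l m. l < length ws \<Longrightarrow> m < length ws \<Longrightarrow> ws ! l < ws ! m \<longleftrightarrow> ws' ! l < ws' ! m"
  shows "order_perm ws = order_perm ws'"
proof -
  have idx: "card {a \<in> set us. a < us ! k} = card {l. l < length us \<and> us ! l < us ! k}"
    if "distinct us" for us :: "'c :: linorder list" and k
  proof -
    have "{a \<in> set us. a < us ! k} = (!) us ` {l. l < length us \<and> us ! l < us ! k}"
      by (auto simp: in_set_conv_nth)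
    moreover have "inj_on ((!) us) {l. l < length us \<and> us ! l < us ! k}"
      using that by (auto intro: inj_on_nth)
    ultimately show ?thesis by (simp add: card_image)
  qed
  show ?thesis
  proof
    fix k
    have "{l. l < length ws \<and> ws ! l < ws ! (k - 1)} = {l. l < length ws' \<and> ws' ! l < ws' ! (k - 1)}"
      if "1 \<le> k" "k \<le> length ws" using assms that by auto
    then show "order_perm ws k = order_perm ws' k"
      using assms by (simp add: order_perm_def idx)
  qed
qed

text \<open>This is the right action \<open>act\<close> at an arbitrary type, so that it also
  applies to lists of addresses. The shifts by one translate between permutations of
  \<open>{1..n}\<close> and list positions from 0.\<close>

definition reindex :: "(nat \<Rightarrow> nat) \<Rightarrow> 'b list \<Rightarrow> 'b list" where
  "reindex \<mu> ws = map (\<lambda>k. ws ! (\<mu> (k + 1) - 1)) [0..<length ws]"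

lemma length_reindex [simp]: "length (reindex \<mu> ws) = length ws"
  by (simp add: reindex_def)

lemma nth_reindex: "k < length ws \<Longrightarrow> reindex \<mu> ws ! k = ws ! (\<mu> (k + 1) - 1)"
  by (simp add: reindex_def)

context
  fixes \<mu> :: "nat \<Rightarrow> nat" and N :: nat
  assumes \<mu>: "\<mu> permutes {1..N}"
begin

lemma permutes_shift: "k < N \<Longrightarrow> \<mu> (k + 1) - 1 < N" "k < N \<Longrightarrow> 1 \<le> \<mu> (k + 1)"
  using permutes_in_image[OF \<mu>, of "k + 1"] by auto

lemma permutes_shift_surj:
  assumes "l < N"
  obtains k where "k < N" "\<mu> (k + 1) - 1 = l"
proof -
  have "l + 1 \<in> \<mu> ` {1..N}" using permutes_image[OF \<mu>] assms by simp
  then obtain k where k: "k \<in> {1..N}" "\<mu> k = l + 1" by (metis imageE)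
  then have "k - 1 < N" "\<mu> (k - 1 + 1) - 1 = l" by auto
  with that show ?thesis by blast
qed

lemma permutes_shift_inj:
  assumes "k < N" "l < N" "\<mu> (k + 1) - 1 = \<mu> (l + 1) - 1"
  shows "k = l"
proof -
  have "\<mu> (k + 1) = \<mu> (l + 1)"
    using assms permutes_shift(2)[of k] permutes_shift(2)[of l] by linarith
  then show ?thesis using permutes_inj[OF \<mu>] by (auto dest: injD)
qed

lemma set_reindex:
  assumes "length ws = N"
  shows "set (reindex \<mu> ws) = set ws"
proof (intro equalityI subsetI)
  fix a assume "a \<in> set (reindex \<mu> ws)"
  then obtain k where "k < N" "a = ws ! (\<mu> (k + 1) - 1)"
    using assms by (auto simp: in_set_conv_nth nth_reindex)
  then show "a \<in> set ws" using assms permutes_shift(1)[of k] by simp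
next
  fix a assume "a \<in> set ws"
  then obtain l where l: "l < N" "a = ws ! l" using assms by (auto simp: in_set_conv_nth)
  obtain k where "k < N" "\<mu> (k + 1) - 1 = l" using permutes_shift_surj[OF l(1)] .
  then show "a \<in> set (reindex \<mu> ws)" using l assms by (auto simp: in_set_conv_nth nth_reindex)
qed

lemma distinct_reindex:
  assumes "length ws = N" "distinct ws"
  shows "distinct (reindex \<mu> ws)"
  using assms set_reindex[of ws] card_distinct[of "reindex \<mu> ws"] distinct_card[of ws] by simp

lemma order_perm_reindex:
  assumes "length ws = N"
  shows "order_perm (reindex \<mu> ws) = order_perm ws \<circ> \<mu>"
proof
  fix k show "order_perm (reindex \<mu> ws) k = (order_perm ws \<circ> \<mu>) k"
  proof (cases "k \<in> {1..N}")
    case True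
    then have "\<mu> k \<in> {1..N}" using permutes_in_image[OF \<mu>] by blast
    moreover from True have "k - 1 < length ws" using assms by auto
    ultimately show ?thesis using True assms nth_reindex[of "k - 1" ws \<mu>]
      by (simp add: order_perm_def set_reindex)
  next
    case False
    then have "\<mu> k = k" using \<mu> by (simp add: permutes_def)
    then show ?thesis using False assms by (auto simp: order_perm_def)
  qed
qed

lemma reindex_update:
  assumes "length ws = N" "k < N"
  shows "reindex \<mu> (ws[\<mu> (k + 1) - 1 := x]) = (reindex \<mu> ws)[k := x]"
proof (rule nth_equalityI)
  fix l assume l: "l < length (reindex \<mu> (ws[\<mu> (k + 1) - 1 := x]))"
  then have "l < N" using assms by simp
  with assms l show "reindex \<mu> (ws[\<mu> (k + 1) - 1 := x]) ! l = (reindex \<mu> ws)[k := x] ! l"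
    using permutes_shift(1)[of k] permutes_shift(1)[of l] permutes_shift_inj[of k l]
    by (cases "k = l") (auto simp: nth_reindex nth_list_update)
qed (simp add: assms)

end

section \<open>The cyclic shift of ranks caused by moving one entry\<close>

lemma inj_sigma:
  assumes "2 \<le> j"
  shows "inj (sigma n i j)"
  using assms by (intro injI) (auto simp: sigma_def split: if_splits)

text \<open>Here \<open>ws\<close> plays the upper face and \<open>ws[k := x]\<close> the lower one;
  let n be the length. Going down, the moving entry passes from rank n-i+j to n-i+1, and the j-1
  entries it jumps over rise by one. So \<open>sigma\<close> composed with the upper permutation is
  the lower one, and the inverse occurs because edges are oriented upwards.\<close>

lemma order_perm_move:
  fixes ws :: "'b :: linorder list"
  assumes dist: "distinct ws" and k: "k < length ws" and x: "x < ws ! k" "x \<notin> set ws"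
    and ij: "2 \<le> j" "j \<le> i" "i \<le> length ws"
    and below: "card {a \<in> set ws - {ws ! k}. a < x} = length ws - i"
    and between: "card {a \<in> set ws - {ws ! k}. x < a \<and> a < ws ! k} = j - 1"
  shows "order_perm ws = inv (sigma (length ws) i j) \<circ> order_perm (ws[k := x])"
proof -
  define y where "y = ws ! k"
  define A where "A = set ws - {y}"
  define n where "n = length ws"
  \<comment> \<open>The moving entry is left out of the count, so both permutations can be expressed
    through the same function \<open>c\<close>.\<close>
  define c where "c z = card {a \<in> A. a < z}" for z
  have finA: "finite A" by (simp add: A_def)
  have y: "y \<in> set ws" using k by (simp add: y_def)
  have set: "set ws = insert y A" "y \<notin> A" "x \<notin> A" using y x by (auto simp: A_def)
  have set': "set (ws[k := x]) = insert x A"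
    using set_update_distinct[OF dist k] by (simp add: A_def y_def)
  have xy: "x < y" using x by (simp add: y_def)
  have cx: "c x = n - i" using below by (simp add: c_def A_def y_def n_def)
  have "{a \<in> A. a < y} = {a \<in> A. a < x} \<union> {a \<in> A. x < a \<and> a < y}"
    using set(3) xy by (auto simp: not_less le_less)
  moreover have "card ({a \<in> A. a < x} \<union> {a \<in> A. x < a \<and> a < y}) =
      card {a \<in> A. a < x} + card {a \<in> A. x < a \<and> a < y}"
    using finA by (intro card_Un_disjoint) auto
  ultimately have "c y = card {a \<in> A. a < x} + card {a \<in> A. x < a \<and> a < y}"
    by (simp only: c_def)
  then have cy: "c y = n - i + (j - 1)"
    using cx between unfolding c_def A_def y_def by simp
  have c_mono: "c z \<le> c z'" if "z \<le> z'" for z z'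
    unfolding c_def using finA that by (intro card_mono) auto
  have c_less: "c a < c z" if "a \<in> A" "a < z" for a z
    unfolding c_def using finA that by (rule card_less_strict_mono)
  have insert_y: "card {a \<in> insert y A. a < z} = c z + (if y < z then 1 else 0)" for z
  proof (cases "y < z")
    case True
    then have "{a \<in> insert y A. a < z} = insert y {a \<in> A. a < z}" by auto
    then show ?thesis using finA set True by (simp add: c_def)
  qed (auto simp: c_def intro!: arg_cong[of _ _ card])
  have insert_x: "card {a \<in> insert x A. a < z} = c z + (if x < z then 1 else 0)" for z
  proof (cases "x < z")
    case True
    then have "{a \<in> insert x A. a < z} = insert x {a \<in> A. a < z}" by auto
    then show ?thesis using finA set True by (simp add: c_def)
  qed (auto simp: c_def intro!: arg_cong[of _ _ card])
  have ijn: "2 \<le> j" "j \<le> i" "i \<le> n" using ij by (simp_all add: n_def)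
  have main: "sigma n i j (order_perm ws t) = order_perm (ws[k := x]) t" for t
  proof (cases "1 \<le> t \<and> t \<le> n")
    case False
    then show ?thesis using ijn by (auto simp: order_perm_def sigma_def n_def)
  next
    case True
    then have t: "1 \<le> t" "t \<le> length ws" "t - 1 < length ws" by (auto simp: n_def)
    show ?thesis
    proof (cases "t - 1 = k")
      case tk: True
      then have "order_perm ws t = n - i + j" "order_perm (ws[k := x]) t = n - i + 1"
        using t k insert_y[of y] insert_x[of x] cx cy ijn
        unfolding order_perm_def set' by (simp_all add: set(1) y_def[symmetric])
      then show ?thesis using ijn by (simp add: sigma_def)
    next
      case tk: False
      define a where "a = ws ! (t - 1)"
      have "a \<noteq> y" using tk k t dist by (simp add: a_def y_def nth_eq_iff_index_eq)
      then have aA: "a \<in> A" using t by (simp add: A_def a_def)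
      then have "a \<noteq> x" using set by blast
      have o: "order_perm ws t = c a + (if y < a then 1 else 0) + 1"
        "order_perm (ws[k := x]) t = c a + (if x < a then 1 else 0) + 1"
        using t tk insert_y[of a] insert_x[of a]
        unfolding order_perm_def set' by (simp_all add: set(1) a_def)
      consider "a < x" | "x < a" "a < y" | "y < a" using \<open>a \<noteq> y\<close> \<open>a \<noteq> x\<close> by fastforce
      then show ?thesis
      proof cases
        case 1
        then have "c a < n - i" using c_less[OF aA, of x] cx by simp
        moreover have "\<not> x < a" "\<not> y < a" using 1 xy by auto
        ultimately show ?thesis using o ijn by (auto simp: sigma_def)
      next
        case 2
        then have "n - i \<le> c a" "c a < n - i + (j - 1)"
          using c_less[OF aA, of y] c_mono[of x a] cx cy by simp_all
        moreover have "\<not> y < a" using 2 by simp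
        ultimately show ?thesis using o 2 by (auto simp: sigma_def)
      next
        case 3
        then have "n - i + (j - 1) \<le> c a" using c_mono[of y a] cy by simp
        moreover have "x < a" using 3 xy by simp
        ultimately show ?thesis using o 3 ijn by (auto simp: sigma_def)
      qed
    qed
  qed
  have "inv (sigma n i j) (sigma n i j s) = s" for s
    using inj_sigma[OF ijn(1)] by (simp add: inv_f_f)
  then show ?thesis unfolding n_def[symmetric] by (metis (no_types, lifting) comp_apply ext main)
qed

section \<open>Cells and the gradient field in addresses\<close>

text \<open>A cell in both closures is a nonempty vertex set contained in both cells; conversely a
  common vertex is a common cell. From here on, disjoint closures are simply disjoint vertex
  sets.\<close>

lemma cl_disjoint_iff:
  assumes "c \<noteq> {}" "c' \<noteq> {}"
  shows "cl c \<inter> cl c' = {} \<longleftrightarrow> c \<inter> c' = {}"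
proof
  assume "cl c \<inter> cl c' = {}"
  then show "c \<inter> c' = {}" by (auto simp: cl_def)
next
  assume d: "c \<inter> c' = {}"
  show "cl c \<inter> cl c' = {}"
  proof (rule ccontr)
    assume "cl c \<inter> cl c' \<noteq> {}"
    then obtain X where X: "X \<in> cl c" "X \<in> cl c'" by blast
    then have "X \<subseteq> c" "X \<subseteq> c'" "X \<noteq> {}" using assms by (auto simp: cl_def)
    with d show False by blast
  qed
qed

text \<open>The interface through which cells are studied, with \<open>vt\<close> decoding addresses
  into vertices. The root is treated apart in \<open>deg_eq\<close> because it has a child but no
  parent.\<close>

locale addr_tree = num_tree n D kids
  for n :: nat and D :: "nat list set" and kids :: "nat list \<Rightarrow> nat" +
  fixes T :: "'a rtree" and vt :: "nat list \<Rightarrow> 'a"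
  assumes inj_vt: "inj_on vt D"
    and verts_eq: "verts T = vt ` D"
    and edges_eq: "edges T = {{vt \<alpha>, vt (butlast \<alpha>)} | \<alpha>. \<alpha> \<in> D \<and> \<alpha> \<noteq> []}"
    and root_eq: "root T = vt []"
    and eup_eq: "\<alpha> \<in> D \<Longrightarrow> \<alpha> \<noteq> [] \<Longrightarrow> eup T (vt \<alpha>) = {vt \<alpha>, vt (butlast \<alpha>)}"
    and vless_iff: "\<alpha> \<in> D \<Longrightarrow> \<beta> \<in> D \<Longrightarrow> vless T (vt \<alpha>) (vt \<beta>) \<longleftrightarrow> \<alpha> < \<beta>"
    and deg_eq: "\<alpha> \<in> D \<Longrightarrow> \<alpha> \<noteq> [] \<Longrightarrow> deg T (vt \<alpha>) = kids \<alpha> + 1" "deg T (vt []) = 1"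
begin

lemma vt_eq_iff [simp]: "\<alpha> \<in> D \<Longrightarrow> \<beta> \<in> D \<Longrightarrow> vt \<alpha> = vt \<beta> \<longleftrightarrow> \<alpha> = \<beta>"
  using inj_vt by (auto dest: inj_onD)

definition edge :: "nat list \<Rightarrow> 'a set" where
  "edge \<alpha> = {vt \<alpha>, vt (butlast \<alpha>)}"

lemma edge_mem: "\<alpha> \<in> D \<Longrightarrow> \<alpha> \<noteq> [] \<Longrightarrow> edge \<alpha> \<in> edges T"
  by (auto simp: edge_def edges_eq)

lemma butlast_neq: "\<alpha> \<noteq> [] \<Longrightarrow> butlast \<alpha> \<noteq> \<alpha>"
  by (metis append_butlast_last_id not_Cons_self2 append_self_conv)

lemma singleton_not_edge: "{v} \<notin> edges T"
proof
  assume "{v} \<in> edges T"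
  then obtain \<alpha> where "\<alpha> \<in> D" "\<alpha> \<noteq> []" "vt \<alpha> = v" "vt (butlast \<alpha>) = v"
    unfolding edges_eq by auto
  then show False using butlast_neq[of \<alpha>] butlast_mem[of \<alpha>] by (metis vt_eq_iff)
qed

lemma edge_inj:
  assumes "\<alpha> \<in> D" "\<alpha> \<noteq> []" "\<beta> \<in> D" "\<beta> \<noteq> []" "edge \<alpha> = edge \<beta>"
  shows "\<alpha> = \<beta>"
proof (rule ccontr)
  assume "\<alpha> \<noteq> \<beta>"
  then have "\<alpha> = butlast \<beta>" "\<beta> = butlast \<alpha>"
    using assms butlast_mem by (auto simp: edge_def doubleton_eq_iff)
  then have "length \<alpha> = length \<beta> - 1" "length \<beta> = length \<alpha> - 1" by (metis length_butlast)+
  then show False using assms by (cases \<alpha>; cases \<beta>) auto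
qed

lemma vt_mem_edge:
  "\<alpha> \<in> D \<Longrightarrow> \<beta> \<in> D \<Longrightarrow> vt \<alpha> \<in> edge \<beta> \<longleftrightarrow> \<alpha> = \<beta> \<or> \<alpha> = butlast \<beta>"
  using butlast_mem[of \<beta>] by (auto simp: edge_def)

lemma is_cell_iff:
  "is_cell T c \<longleftrightarrow> (\<exists>\<alpha>\<in>D. c = {vt \<alpha>}) \<or> (\<exists>\<alpha>\<in>D. \<alpha> \<noteq> [] \<and> c = edge \<alpha>)"
  by (auto simp: is_cell_def verts_eq edges_eq edge_def)

lemma cell_nonempty: "is_cell T c \<Longrightarrow> c \<noteq> {}"
  by (auto simp: is_cell_iff edge_def)

lemma mem_cells_iff:
  "a \<in> cells T n \<longleftrightarrow> length a = n \<and> (\<forall>i<n. is_cell T (a ! i)) \<and>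
     (\<forall>i<n. \<forall>j<n. i \<noteq> j \<longrightarrow> a ! i \<inter> a ! j = {})"
proof -
  have "cl c \<inter> cl c' = {} \<longleftrightarrow> c \<inter> c' = {}" if "is_cell T c" "is_cell T c'" for c c'
    using that cell_nonempty by (simp add: cl_disjoint_iff)
  then show ?thesis by (simp add: cells_def cong: conj_cong)
qed

lemma cells_disjoint: "a \<in> cells T n \<Longrightarrow> i < n \<Longrightarrow> j < n \<Longrightarrow> i \<noteq> j \<Longrightarrow> a ! i \<inter> a ! j = {}"
  unfolding mem_cells_iff by blast

definition valid0 :: "nat list list \<Rightarrow> bool" where
  "valid0 ws \<longleftrightarrow> length ws = n \<and> distinct ws \<and> set ws \<subseteq> D"

text \<open>A 1-cell is encoded by its upper face and the position of its edge, the edge from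
  \<open>ws ! k\<close> to its parent. The conditions say that coordinate \<open>k\<close> is
  unblocked in \<open>cell0 ws\<close> (see \<open>unblocked_cell0\<close>), so the same data
  describe a candidate pair of the gradient field.\<close>

definition valid1 :: "nat \<Rightarrow> nat list list \<Rightarrow> bool" where
  "valid1 k ws \<longleftrightarrow> valid0 ws \<and> k < n \<and> ws ! k \<noteq> [] \<and> butlast (ws ! k) \<notin> set ws"

definition cell0 :: "nat list list \<Rightarrow> 'a set list" where
  "cell0 ws = map (\<lambda>\<alpha>. {vt \<alpha>}) ws"

definition cell1 :: "nat \<Rightarrow> nat list list \<Rightarrow> 'a set list" where
  "cell1 k ws = (cell0 ws)[k := edge (ws ! k)]"

lemma valid0D:
  assumes "valid0 ws"
  shows "length ws = n" "distinct ws" "k < n \<Longrightarrow> ws ! k \<in> D" "k < n \<Longrightarrow> butlast (ws ! k) \<in> D"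
    "k < n \<Longrightarrow> l < n \<Longrightarrow> ws ! k = ws ! l \<longleftrightarrow> k = l"
  using assms butlast_mem unfolding valid0_def by (auto simp: nth_eq_iff_index_eq subset_code(1))

lemma valid1D:
  assumes "valid1 k ws"
  shows "valid0 ws" "k < n" "ws ! k \<noteq> []" "butlast (ws ! k) \<notin> set ws"
    "l < n \<Longrightarrow> ws ! l \<noteq> butlast (ws ! k)"
  using assms nth_mem[of l ws] unfolding valid1_def valid0_def by (auto simp del: nth_mem)

lemma length_cell [simp]: "length (cell0 ws) = length ws" "length (cell1 k ws) = length ws"
  by (simp_all add: cell0_def cell1_def)

lemma nth_cell0: "l < length ws \<Longrightarrow> cell0 ws ! l = {vt (ws ! l)}"
  by (simp add: cell0_def)

lemma nth_cell1:
  "k < length ws \<Longrightarrow> l < length ws \<Longrightarrow> cell1 k ws ! l = (if l = k then edge (ws ! k) else {vt (ws ! l)})"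
  by (simp add: cell1_def nth_cell0)

lemma cell0_mem:
  assumes "valid0 ws"
  shows "cell0 ws \<in> cells T n" "dim T (cell0 ws) = 0"
proof -
  note v = valid0D[OF assms]
  show "cell0 ws \<in> cells T n" using v by (auto simp: mem_cells_iff nth_cell0 is_cell_iff)
  show "dim T (cell0 ws) = 0" using v by (auto simp: dim_def nth_cell0 singleton_not_edge)
qed

lemma cell0E:
  assumes "a \<in> cells T n" "dim T a = 0"
  obtains ws where "valid0 ws" "a = cell0 ws"
proof -
  have "\<exists>\<alpha>. \<alpha> \<in> D \<and> a ! i = {vt \<alpha>}" if "i < n" for i
  proof -
    have "finite {i. i < length a \<and> a ! i \<in> edges T}" by simp
    then have "a ! i \<notin> edges T" using assms that by (auto simp: dim_def mem_cells_iff)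
    then show ?thesis using assms(1) that edge_mem by (auto simp: mem_cells_iff is_cell_iff)
  qed
  then obtain w where w: "\<And>i. i < n \<Longrightarrow> w i \<in> D \<and> a ! i = {vt (w i)}" by metis
  have "w i \<noteq> w j" if "i < n" "j < n" "i \<noteq> j" for i j
  proof -
    have "a ! i \<inter> a ! j = {}" using assms that by (simp add: mem_cells_iff)
    then show ?thesis using w that by auto
  qed
  then have "valid0 (map w [0..<n])" using w by (auto simp: valid0_def distinct_conv_nth)
  moreover have "a = cell0 (map w [0..<n])"
    using assms(1) w by (auto simp: cell0_def mem_cells_iff intro!: nth_equalityI)
  ultimately show ?thesis by (rule that)
qed

lemma cell1_mem:
  assumes "valid1 k ws"
  shows "cell1 k ws \<in> cells T n" "dim T (cell1 k ws) = 1"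
proof -
  note v1 = valid1D[OF assms]
  note v = valid0D[OF v1(1)]
  have disj: "edge (ws ! k) \<inter> {vt (ws ! l)} = {}" if "l < n" "l \<noteq> k" for l
    using that v v1 by (auto simp: vt_mem_edge)
  show "cell1 k ws \<in> cells T n" unfolding mem_cells_iff
  proof (intro conjI allI impI)
    fix i j assume "i < n" "j < n" "i \<noteq> j"
    then show "cell1 k ws ! i \<inter> cell1 k ws ! j = {}"
      using disj[of i] disj[of j] v v1(2) by (auto simp: nth_cell1)
  qed (use v v1 in \<open>auto simp: nth_cell1 is_cell_iff\<close>)
  have "{i. i < length (cell1 k ws) \<and> cell1 k ws ! i \<in> edges T} = {k}"
    using v v1(2,3) edge_mem[of "ws ! k"] by (auto simp: nth_cell1 singleton_not_edge split: if_splits)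
  then show "dim T (cell1 k ws) = 1" by (simp add: dim_def)
qed

lemma cell1E:
  assumes "c \<in> cells T n" "dim T c = 1"
  obtains k ws where "valid1 k ws" "c = cell1 k ws"
proof -
  have len: "length c = n" using assms by (simp add: mem_cells_iff)
  obtain k where k: "{i. i < length c \<and> c ! i \<in> edges T} = {k}"
    using assms(2) by (auto simp: dim_def card_1_singleton_iff)
  have kn: "k < n" "c ! k \<in> edges T" using k len by auto
  obtain y where y: "y \<in> D" "y \<noteq> []" "c ! k = edge y"
    using kn(2) by (auto simp: edges_eq edge_def)
  have "\<exists>\<alpha>. \<alpha> \<in> D \<and> c ! i = {vt \<alpha>}" if "i < n" "i \<noteq> k" for i
  proof -
    have "c ! i \<notin> edges T" using k that len by auto
    then show ?thesis using assms(1) that edge_mem by (auto simp: mem_cells_iff is_cell_iff)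
  qed
  then obtain w where w: "\<And>i. i < n \<Longrightarrow> i \<noteq> k \<Longrightarrow> w i \<in> D \<and> c ! i = {vt (w i)}" by metis
  define u where "u = w(k := y)"
  define ws where "ws = map u [0..<n]"
  have u: "i < n \<Longrightarrow> u i \<in> D" "i < n \<Longrightarrow> i \<noteq> k \<Longrightarrow> c ! i = {vt (u i)}" "vt (u i) \<in> c ! i"
    if "i < n" for i using w that y by (auto simp: u_def edge_def)
  have "u i \<noteq> u j" if "i < n" "j < n" "i \<noteq> j" for i j
  proof -
    have "c ! i \<inter> c ! j = {}" using assms that by (simp add: mem_cells_iff)
    then show ?thesis using u(3)[of i] u(3)[of j] that by auto
  qed
  then have v0: "valid0 ws" using u by (auto simp: valid0_def ws_def distinct_conv_nth)
  have "butlast y \<noteq> u i" if i: "i < n" for i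
  proof (cases "i = k")
    case True
    then show ?thesis using butlast_neq[of y] y by (auto simp: u_def)
  next
    case False
    have "c ! i \<inter> c ! k = {}" using assms i kn False by (simp add: mem_cells_iff)
    then show ?thesis using u(3)[OF i] y by (auto simp: edge_def)
  qed
  moreover have "set ws = u ` {..<n}" by (auto simp: ws_def)
  ultimately have "butlast y \<notin> set ws" by blast
  moreover have "ws ! k = y" using kn by (simp add: ws_def u_def)
  ultimately have "valid1 k ws" using v0 kn y by (simp add: valid1_def)
  moreover have "c = cell1 k ws"
  proof (rule nth_equalityI)
    fix i assume "i < length c"
    then show "c ! i = cell1 k ws ! i"
      using len kn u(2)[of i] y by (auto simp: nth_cell1 ws_def u_def)
  qed (simp add: len ws_def)
  ultimately show ?thesis by (rule that)
qed

lemma cell0_inj: "valid0 ws \<Longrightarrow> valid0 ws' \<Longrightarrow> cell0 ws = cell0 ws' \<Longrightarrow> ws = ws'"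
proof (rule nth_equalityI)
  assume v: "valid0 ws" "valid0 ws'" and eq: "cell0 ws = cell0 ws'"
  show "length ws = length ws'" using v by (simp add: valid0_def)
  fix i assume "i < length ws"
  then have "i < n" using v valid0D by simp
  then show "ws ! i = ws' ! i"
    using arg_cong[OF eq, of "\<lambda>a. a ! i"] valid0D[OF v(1)] valid0D[OF v(2)] by (simp add: nth_cell0)
qed

lemma cell1_inj:
  assumes v: "valid1 k ws" "valid1 k' ws'" and eq: "cell1 k ws = cell1 k' ws'"
  shows "k = k'" "ws = ws'"
proof -
  note a = valid1D[OF v(1)] valid0D[OF valid1D(1)[OF v(1)]]
  note b = valid1D[OF v(2)] valid0D[OF valid1D(1)[OF v(2)]]
  have "cell1 k' ws' ! k = edge (ws ! k)" using eq a by (metis nth_cell1)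
  moreover have "edge (ws ! k) \<in> edges T" using a by (simp add: edge_mem)
  ultimately have "cell1 k' ws' ! k \<in> edges T" by simp
  then show k: "k = k'" using a b by (auto simp: nth_cell1 singleton_not_edge split: if_splits)
  show "ws = ws'"
  proof (rule nth_equalityI)
    show "length ws = length ws'" using a b by simp
    fix i assume "i < length ws"
    then have i: "i < n" using a by simp
    have "cell1 k ws ! i = cell1 k ws' ! i" using eq k by simp
    then show "ws ! i = ws' ! i"
      using a b i k edge_inj[of "ws ! k" "ws' ! k"] by (auto simp: nth_cell1 split: if_splits)
  qed
qed

section \<open>Unblocked coordinates and critical cells\<close>

lemma cell_vertex:
  assumes "a \<in> cells T n" "i < n" "is_vtx (a ! i)"
  obtains \<alpha> where "\<alpha> \<in> D" "a ! i = {vt \<alpha>}" "vx (a ! i) = vt \<alpha>"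
proof -
  have "a ! i \<notin> edges T" using assms(3) singleton_not_edge by (auto simp: is_vtx_def)
  then obtain \<alpha> where "\<alpha> \<in> D" "a ! i = {vt \<alpha>}"
    using assms edge_mem by (auto simp: mem_cells_iff is_cell_iff)
  then show thesis using that by (simp add: vx_def)
qed

text \<open>The vertex \<open>vt \<alpha>\<close> itself lies in no other coordinate, as the
  closures are disjoint, so only its parent can block.\<close>

lemma unblocked_iff:
  assumes a: "a \<in> cells T n" "i < n" "a ! i = {vt \<alpha>}" "\<alpha> \<in> D"
  shows "unblocked T a i \<longleftrightarrow> \<alpha> \<noteq> [] \<and> (\<forall>j<n. j \<noteq> i \<longrightarrow> vt (butlast \<alpha>) \<notin> a ! j)"
proof (cases "\<alpha> = []")
  case True
  then show ?thesis using a by (simp add: unblocked_def blocked_def root_eq vx_def)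
next
  case False
  have len: "length a = n" using a by (simp add: mem_cells_iff)
  have "cl (eup T (vx (a ! i))) \<inter> cl (a ! j) = {} \<longleftrightarrow> vt (butlast \<alpha>) \<notin> a ! j" if "j < n" "j \<noteq> i" for j
  proof -
    have "a ! i \<inter> a ! j = {}" using cells_disjoint[OF a(1,2)] that by blast
    then have "vt \<alpha> \<notin> a ! j" using a(3) by auto
    moreover have "a ! j \<noteq> {}" using a that by (auto simp: mem_cells_iff dest: cell_nonempty)
    ultimately show ?thesis
      using False a eup_eq[of \<alpha>] by (simp add: cl_disjoint_iff vx_def)
  qed
  then show ?thesis
    using False a len nil by (auto simp: unblocked_def blocked_def root_eq vx_def is_vtx_def)
qed

lemma unblocked_cell0:
  assumes v: "valid0 ws"
  shows "unblocked T (cell0 ws) i \<longleftrightarrow> i < n \<and> ws ! i \<noteq> [] \<and> butlast (ws ! i) \<notin> set ws"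
proof (cases "i < n")
  case True
  note v0 = valid0D[OF v]
  have "unblocked T (cell0 ws) i \<longleftrightarrow>
      ws ! i \<noteq> [] \<and> (\<forall>j<n. j \<noteq> i \<longrightarrow> butlast (ws ! i) \<noteq> ws ! j)"
    using True v0 by (subst unblocked_iff[OF cell0_mem(1)[OF v] True, of "ws ! i"]) (auto simp: nth_cell0)
  also have "\<dots> \<longleftrightarrow> ws ! i \<noteq> [] \<and> butlast (ws ! i) \<notin> set ws"
    using v0 True butlast_neq[of "ws ! i"] by (metis in_set_conv_nth)
  finally show ?thesis using True by simp
qed (use v in \<open>simp add: unblocked_def valid0_def\<close>)

lemma unblocked_cell1:
  assumes v: "valid1 k ws"
  shows "unblocked T (cell1 k ws) i \<longleftrightarrow> i < n \<and> i \<noteq> k \<and> ws ! i \<noteq> [] \<and>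
    butlast (ws ! i) \<notin> set ws \<and> butlast (ws ! i) \<noteq> butlast (ws ! k)"
proof (cases "i < n \<and> i \<noteq> k")
  case True
  note v1 = valid1D[OF v] and v0 = valid0D[OF valid1D(1)[OF v]]
  have "unblocked T (cell1 k ws) i \<longleftrightarrow> ws ! i \<noteq> [] \<and>
      (\<forall>j<n. j \<noteq> i \<longrightarrow> vt (butlast (ws ! i)) \<notin> cell1 k ws ! j)"
    using True v0 v1
    by (intro unblocked_iff[OF cell1_mem(1)[OF v]]) (auto simp: nth_cell1)
  also have "(\<forall>j<n. j \<noteq> i \<longrightarrow> vt (butlast (ws ! i)) \<notin> cell1 k ws ! j) \<longleftrightarrow>
      (\<forall>j<n. j \<noteq> i \<longrightarrow> butlast (ws ! i) \<noteq> ws ! j) \<and> butlast (ws ! i) \<noteq> butlast (ws ! k)"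
    using True v0 v1(2) by (auto simp: nth_cell1 vt_mem_edge)
  also have "ws ! i \<noteq> [] \<and> \<dots> \<longleftrightarrow> ws ! i \<noteq> [] \<and> butlast (ws ! i) \<notin> set ws \<and>
      butlast (ws ! i) \<noteq> butlast (ws ! k)"
    using v0 True butlast_neq[of "ws ! i"] by (metis in_set_conv_nth)
  finally show ?thesis using True by simp
next
  case False
  have "\<not> is_vtx (edge (ws ! k))"
    using singleton_not_edge edge_mem[of "ws ! k"] valid1D[OF v] valid0D[OF valid1D(1)[OF v]]
    by (metis is_vtx_def)
  then have "\<not> unblocked T (cell1 k ws) i"
    using False valid1D(2)[OF v] valid0D(1)[OF valid1D(1)[OF v]]
    by (auto simp: unblocked_def nth_cell1)
  then show ?thesis using False by blast
qed

text \<open>The unblocked coordinates are distinct vertices with linearly ordered addresses, so the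
  description in \<open>pr_idx\<close> has exactly one solution, the one of minimal address.\<close>

lemma pr_idx:
  assumes a: "a \<in> cells T n" "has_pr T a"
  shows "unblocked T a (pr_idx T a)"
    "unblocked T a j \<Longrightarrow> j \<noteq> pr_idx T a \<Longrightarrow> vless T (vx (a ! pr_idx T a)) (vx (a ! j))"
proof -
  have len: "length a = n" using a by (simp add: mem_cells_iff)
  have "\<exists>\<alpha>. \<alpha> \<in> D \<and> a ! i = {vt \<alpha>} \<and> vx (a ! i) = vt \<alpha>" if "unblocked T a i" for i
    using that cell_vertex[OF a(1), of i] len by (metis unblocked_def)
  then obtain w where w: "\<And>i. unblocked T a i \<Longrightarrow> w i \<in> D \<and> a ! i = {vt (w i)} \<and> vx (a ! i) = vt (w i)"
    by metis
  let ?I = "{i. unblocked T a i}"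
  have fin: "finite ?I" by (rule finite_subset[of _ "{..<n}"]) (auto simp: unblocked_def len)
  moreover have "?I \<noteq> {}" using a by (auto simp: has_pr_def)
  ultimately have "Min (w ` ?I) \<in> w ` ?I" by (intro Min_in) auto
  then obtain i where i: "unblocked T a i" "w i = Min (w ` ?I)" by auto
  have wneq: "w j \<noteq> w i" if "unblocked T a j" "j \<noteq> i" for j
  proof -
    have "a ! i \<inter> a ! j = {}" using a i that len by (auto simp: mem_cells_iff unblocked_def)
    then show ?thesis using w i that by auto
  qed
  have min: "vless T (vx (a ! i)) (vx (a ! j))" if "unblocked T a j" "j \<noteq> i" for j
  proof -
    have "w i \<le> w j" using i(2) fin that by simp
    then have "w i < w j" using wneq[OF that] by simp
    then show ?thesis using w[OF i(1)] w[OF that(1)] vless_iff by auto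
  qed
  have "pr_idx T a = i" unfolding pr_idx_def
  proof (rule the_equality)
    show "unblocked T a i \<and> (\<forall>j. unblocked T a j \<and> j \<noteq> i \<longrightarrow> vless T (vx (a ! i)) (vx (a ! j)))"
      using i min by blast
    fix k assume k: "unblocked T a k \<and> (\<forall>j. unblocked T a j \<and> j \<noteq> k \<longrightarrow> vless T (vx (a ! k)) (vx (a ! j)))"
    show "k = i"
    proof (rule ccontr)
      assume "k \<noteq> i"
      then have "vless T (vx (a ! k)) (vx (a ! i))" "vless T (vx (a ! i)) (vx (a ! k))"
        using k i min by auto
      moreover have "unblocked T a k" using k by blast
      ultimately show False using w[of i] w[of k] i(1) vless_iff by (metis less_asym)
    qed
  qed
  then show "unblocked T a (pr_idx T a)"
    "unblocked T a j \<Longrightarrow> j \<noteq> pr_idx T a \<Longrightarrow> vless T (vx (a ! pr_idx T a)) (vx (a ! j))"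
    using i min by auto
qed

text \<open>This separates the levels of \<open>Wk\<close>: a second entry of a given dimension can
  only come from the level one dimension below.\<close>

lemma dim_pr:
  assumes a: "a \<in> cells T n" "has_pr T a"
  shows "dim T (pr T a) = dim T a + 1"
proof -
  let ?i = "pr_idx T a"
  have u: "unblocked T a ?i" by (rule pr_idx(1)[OF a])
  have len: "length a = n" using a by (simp add: mem_cells_iff)
  then have i: "?i < n" "is_vtx (a ! ?i)" using u by (auto simp: unblocked_def)
  obtain \<alpha> where \<alpha>: "\<alpha> \<in> D" "a ! ?i = {vt \<alpha>}" "vx (a ! ?i) = vt \<alpha>"
    using cell_vertex[OF a(1) i] .
  have "\<alpha> \<noteq> []" using u unblocked_iff[OF a(1) i(1) \<alpha>(2,1)] by simp
  then have "eup T (vx (a ! ?i)) \<in> edges T" using \<alpha> eup_eq edge_mem by (simp add: edge_def)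
  moreover have "a ! ?i \<notin> edges T" using \<alpha> singleton_not_edge by simp
  ultimately have "{l. l < length (pr T a) \<and> pr T a ! l \<in> edges T} =
      insert ?i {l. l < length a \<and> a ! l \<in> edges T}"
    using i len by (auto simp: pr_def nth_list_update split: if_splits)
  then show ?thesis using \<open>a ! ?i \<notin> edges T\<close> by (simp add: dim_def)
qed

lemma Wk_D:
  assumes "(a, b) \<in> Wk T n k"
  shows "a \<in> cells T n" "dim T a = k" "has_pr T a" "b = pr T a"
  using assms by (cases k; auto)+

lemma critical_dim0_iff:
  assumes "a \<in> cells T n" "dim T a = 0"
  shows "critical T n a \<longleftrightarrow> \<not> has_pr T a"
proof
  assume c: "critical T n a"
  show "\<not> has_pr T a"
  proof
    assume "has_pr T a"
    then have "(a, pr T a) \<in> Wk T n 0" using assms by auto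
    then have "(a, pr T a) \<in> Wf T n" unfolding Wf_def by blast
    then show False using c by (force simp: critical_def)
  qed
next
  assume h: "\<not> has_pr T a"
  have "(b, a) \<notin> Wk T n k" for b k
  proof
    assume b: "(b, a) \<in> Wk T n k"
    show False using Wk_D[OF b] dim_pr[of b] assms by simp
  qed
  moreover have "(a, b) \<notin> Wk T n k" for b k
    using Wk_D(3) h by blast
  ultimately show "critical T n a"
    using assms by (auto simp: critical_def Wf_def)
qed

text \<open>The recursion makes a 1-cell a first entry exactly when it has a \<open>pr\<close> and
  is not a second entry. Being in no pair therefore amounts to having no \<open>pr\<close> and not
  being a second entry, and a 1-cell can be a second entry only in \<open>Wk T n 0\<close>.\<close>

lemma critical_dim1_iff:
  assumes "c \<in> cells T n" "dim T c = 1"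
  shows "critical T n c \<longleftrightarrow> \<not> has_pr T c \<and> \<not> (\<exists>b\<in>cells T n. dim T b = 0 \<and> has_pr T b \<and> c = pr T b)"
proof -
  have snd: "c \<in> snd ` Wf T n \<longleftrightarrow> c \<in> snd ` Wk T n 0"
  proof
    assume "c \<in> snd ` Wf T n"
    then obtain b k where b: "(b, c) \<in> Wk T n k" by (auto simp: Wf_def)
    then have "k = 0" using Wk_D[OF b] dim_pr assms by simp
    with b show "c \<in> snd ` Wk T n 0" by force
  next
    assume "c \<in> snd ` Wk T n 0"
    then show "c \<in> snd ` Wf T n" unfolding Wf_def by blast
  qed
  have fst: "c \<in> fst ` Wf T n \<longleftrightarrow> has_pr T c \<and> c \<notin> snd ` Wk T n 0"
  proof
    assume "c \<in> fst ` Wf T n"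
    then obtain b k where b: "(c, b) \<in> Wk T n k" by (auto simp: Wf_def)
    then have "k = Suc 0" using Wk_D(2)[OF b] assms by simp
    with b show "has_pr T c \<and> c \<notin> snd ` Wk T n 0" by auto
  next
    assume "has_pr T c \<and> c \<notin> snd ` Wk T n 0"
    then have "(c, pr T c) \<in> Wk T n (Suc 0)" using assms by auto
    then have "(c, pr T c) \<in> Wf T n" unfolding Wf_def by blast
    then show "c \<in> fst ` Wf T n" by (metis fst_conv image_eqI)
  qed
  have "c \<in> snd ` Wk T n 0 \<longleftrightarrow> (\<exists>b\<in>cells T n. dim T b = 0 \<and> has_pr T b \<and> c = pr T b)"
    by (auto simp: image_iff)
  with fst snd assms(1) show ?thesis unfolding critical_def by blast
qed

definition first_unblocked :: "nat \<Rightarrow> nat list list \<Rightarrow> bool" where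
  "first_unblocked i ws \<longleftrightarrow> i < n \<and> ws ! i \<noteq> [] \<and> butlast (ws ! i) \<notin> set ws \<and>
     (\<forall>l<n. l \<noteq> i \<longrightarrow> ws ! l \<noteq> [] \<longrightarrow> butlast (ws ! l) \<notin> set ws \<longrightarrow> ws ! i < ws ! l)"

lemma pr_cell0:
  assumes v: "valid0 ws" and h: "has_pr T (cell0 ws)"
  obtains i where "first_unblocked i ws" "valid1 i ws" "pr T (cell0 ws) = cell1 i ws"
proof -
  let ?i = "pr_idx T (cell0 ws)"
  note p = pr_idx[OF cell0_mem(1)[OF v] h] and v0 = valid0D[OF v]
  have i: "?i < n" "ws ! ?i \<noteq> []" "butlast (ws ! ?i) \<notin> set ws"
    using p(1) by (auto simp: unblocked_cell0[OF v])
  have vx: "vx (cell0 ws ! l) = vt (ws ! l)" if "l < n" for l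
    using that v0 by (simp add: nth_cell0 vx_def)
  have "ws ! ?i < ws ! l" if "l < n" "l \<noteq> ?i" "ws ! l \<noteq> []" "butlast (ws ! l) \<notin> set ws" for l
    using p(2)[of l] that v0 i vx by (simp add: unblocked_cell0[OF v] vless_iff)
  then have "first_unblocked ?i ws" using i by (simp add: first_unblocked_def)
  moreover have "valid1 ?i ws" using v i by (simp add: valid1_def)
  moreover have "pr T (cell0 ws) = cell1 ?i ws"
    using i v0 vx by (simp add: pr_def cell1_def edge_def eup_eq)
  ultimately show thesis by (rule that)
qed

lemma has_pr_cell0: "valid1 k ws \<Longrightarrow> has_pr T (cell0 ws)"
  using valid1D unblocked_cell0 unfolding has_pr_def by blast

text \<open>The only 0-cell that \<open>pr\<close> can send to \<open>cell1 k ws\<close> is the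
  upper face \<open>cell0 ws\<close>, and it does so unless a smaller coordinate is unblocked
  there.\<close>

lemma critical_cell1_iff:
  assumes v: "valid1 k ws"
  shows "critical T n (cell1 k ws) \<longleftrightarrow> conf (ws ! k) (set ws - {ws ! k})"
proof -
  note v1 = valid1D[OF v] and v0 = valid0D[OF valid1D(1)[OF v]]
  have setD: "set ws \<subseteq> D" using v1(1) by (simp add: valid0_def)
  have others: "a \<in> set ws - {ws ! k} \<longleftrightarrow> (\<exists>i<n. i \<noteq> k \<and> a = ws ! i)" for a
    using v0(1,5) v1(2) by (auto simp: in_set_conv_nth)
  have pr: "\<not> has_pr T (cell1 k ws) \<longleftrightarrow>
      (\<forall>a\<in>set ws - {ws ! k}. a = [] \<or> butlast a \<in> set ws - {ws ! k} \<union> {ws ! k, butlast (ws ! k)})"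
  proof -
    have "set ws - {ws ! k} \<union> {ws ! k, butlast (ws ! k)} = insert (butlast (ws ! k)) (set ws)"
      using v0(1) v1(2) by auto
    then show ?thesis unfolding has_pr_def unblocked_cell1[OF v] Ball_def others by auto
  qed
  have im: "(\<exists>b\<in>cells T n. dim T b = 0 \<and> has_pr T b \<and> cell1 k ws = pr T b) \<longleftrightarrow> first_unblocked k ws"
  proof
    assume "\<exists>b\<in>cells T n. dim T b = 0 \<and> has_pr T b \<and> cell1 k ws = pr T b"
    then obtain us where us: "valid0 us" "has_pr T (cell0 us)" "cell1 k ws = pr T (cell0 us)"
      by (metis cell0E)
    obtain i where i: "first_unblocked i us" "valid1 i us" "pr T (cell0 us) = cell1 i us"
      using pr_cell0[OF us(1,2)] .
    then have "k = i" "ws = us" using cell1_inj[OF v i(2)] us(3) by auto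
    with i show "first_unblocked k ws" by simp
  next
    assume k: "first_unblocked k ws"
    obtain i where i: "first_unblocked i ws" "pr T (cell0 ws) = cell1 i ws"
      using pr_cell0[OF v1(1) has_pr_cell0[OF v]] .
    have "i = k" using i(1) k unfolding first_unblocked_def by (metis less_asym)
    then show "\<exists>b\<in>cells T n. dim T b = 0 \<and> has_pr T b \<and> cell1 k ws = pr T b"
      using i cell0_mem[OF v1(1)] has_pr_cell0[OF v] by metis
  qed
  have fu: "\<not> first_unblocked k ws \<longleftrightarrow>
      (\<exists>a\<in>set ws - {ws ! k}. a \<noteq> [] \<and> butlast a \<notin> set ws \<and> a < ws ! k)"
  proof
    assume "\<not> first_unblocked k ws"
    then obtain l where "l < n" "l \<noteq> k" "ws ! l \<noteq> []" "butlast (ws ! l) \<notin> set ws" "\<not> ws ! k < ws ! l"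
      using v1 by (auto simp: first_unblocked_def)
    moreover from this have "ws ! l \<noteq> ws ! k" using v0 v1 by simp
    ultimately show "\<exists>a\<in>set ws - {ws ! k}. a \<noteq> [] \<and> butlast a \<notin> set ws \<and> a < ws ! k"
      using v0 by (intro bexI[of _ "ws ! l"]) auto
  next
    assume "\<exists>a\<in>set ws - {ws ! k}. a \<noteq> [] \<and> butlast a \<notin> set ws \<and> a < ws ! k"
    then obtain a where a: "a \<in> set ws - {ws ! k}" "a \<noteq> []" "butlast a \<notin> set ws" "a < ws ! k" by blast
    then obtain l where "l < n" "l \<noteq> k" "a = ws ! l" using others by blast
    with a show "\<not> first_unblocked k ws" unfolding first_unblocked_def by (metis less_asym)
  qed
  have "critical T n (cell1 k ws) \<longleftrightarrow> \<not> has_pr T (cell1 k ws) \<and> \<not> first_unblocked k ws"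
    using critical_dim1_iff[OF cell1_mem[OF v]] im by simp
  also have "\<dots> \<longleftrightarrow> conf (ws ! k) (set ws - {ws ! k})"
  proof -
    \<comment> \<open>If everything is blocked in the 1-cell, a coordinate unblocked in the upper
      face can only be blocked by the added lower end of the edge. It is thus a sibling of
      \<open>ws ! k\<close>, which is the last clause of \<open>conf\<close>.\<close>
    have "(\<exists>a\<in>set ws - {ws ! k}. a \<noteq> [] \<and> butlast a \<notin> set ws \<and> a < ws ! k) \<longleftrightarrow>
        (\<exists>a\<in>set ws - {ws ! k}. a \<noteq> [] \<and> butlast a = butlast (ws ! k) \<and> a < ws ! k)"
      if "\<forall>a\<in>set ws - {ws ! k}. a = [] \<or> butlast a \<in> set ws - {ws ! k} \<union> {ws ! k, butlast (ws ! k)}"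
      using that v0(1) v1(2,4) by (metis Diff_iff Un_iff empty_iff insert_iff nth_mem)
    moreover have "ws ! k \<in> D" "set ws - {ws ! k} \<subseteq> D" using setD v0 v1(2) by auto
    ultimately show ?thesis using v1(3,4) unfolding pr fu conf_def by blast
  qed
  finally show ?thesis .
qed

end

lemma act_eq_reindex: "act a \<mu> = reindex \<mu> a"
  by (simp add: act_def reindex_def)

context addr_tree
begin

section \<open>Critical 0-cells and their permutations\<close>

lemma ones_subset: "ones n \<subseteq> D"
proof
  fix \<alpha> assume "\<alpha> \<in> ones n"
  then obtain m where "\<alpha> = replicate m 1" "m < n" by (auto simp: ones_def)
  moreover from this have "m \<le> n - 1" by linarith
  ultimately show "\<alpha> \<in> D" using replicate_mem by blast
qed

lemma replicate_less_replicate: "replicate k (a :: nat) < replicate m a \<longleftrightarrow> k < m"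
proof (cases "k < m")
  case True
  then have "replicate m a = replicate k a @ replicate (m - k) a"
    by (simp flip: replicate_add)
  then show ?thesis using True by (metis less_append length_replicate list.size(3) zero_less_diff less_irrefl)
next
  case False
  then have "replicate k a = replicate m a @ replicate (k - m) a"
    by (simp flip: replicate_add)
  then show ?thesis using False by (metis not_append_less)
qed

lemma below_stem:
  assumes "m < n"
  shows "{\<beta> \<in> D. \<beta> < replicate m 1} = ones m"
proof (intro equalityI subsetI)
  fix \<beta> assume \<beta>: "\<beta> \<in> {\<beta> \<in> D. \<beta> < replicate m 1}"
  have "length \<beta> \<le> n - 1"
  proof (rule ccontr)
    assume "\<not> length \<beta> \<le> n - 1"
    then have "replicate m 1 < \<beta>" using assms \<beta> by (intro stem_less) auto
    then show False using \<beta> by auto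
  qed
  then have "\<beta> = replicate (length \<beta>) 1" using \<beta> stem_eq by blast
  with \<beta> have "length \<beta> < m" using replicate_less_replicate[of "length \<beta>" 1 m] by simp
  with \<open>\<beta> = _\<close> show "\<beta> \<in> ones m" unfolding ones_def by blast
next
  fix \<beta> assume "\<beta> \<in> ones m"
  then obtain k where k: "\<beta> = replicate k 1" "k < m" unfolding ones_def by blast
  then have "\<beta> \<in> ones n" using assms unfolding ones_def by auto
  then have "\<beta> \<in> D" using ones_subset by blast
  then show "\<beta> \<in> {\<beta> \<in> D. \<beta> < replicate m 1}" using k by (simp only: mem_Collect_eq replicate_less_replicate simp_thms)
qed

lemma rank_eq:
  assumes "\<alpha> \<in> D"
  shows "rank T (vt \<alpha>) = card {\<beta> \<in> D. \<beta> < \<alpha>}"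
proof -
  have "{u \<in> verts T. vless T u (vt \<alpha>)} = vt ` {\<beta> \<in> D. \<beta> < \<alpha>}"
    using assms by (auto simp: verts_eq vless_iff)
  moreover have "inj_on vt {\<beta> \<in> D. \<beta> < \<alpha>}" using inj_vt by (rule inj_on_subset) auto
  ultimately show ?thesis by (simp add: rank_def card_image)
qed

lemma rank_stem: "m < n \<Longrightarrow> rank T (vt (replicate m 1)) = m"
  using rank_eq[of "replicate m 1"] replicate_mem[of m] below_stem[of m] ones_simps(2)[of m] by simp

text \<open>Up to depth \<open>n - 1\<close> the tree is just the stem, and a vertex at greater
  depth is preceded by all \<open>n\<close> vertices of the stem.\<close>

lemma rank_less_iff:
  assumes "\<alpha> \<in> D"
  shows "rank T (vt \<alpha>) < n \<longleftrightarrow> \<alpha> \<in> ones n"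
proof
  assume "\<alpha> \<in> ones n"
  then obtain m where "\<alpha> = replicate m 1" "m < n" unfolding ones_def by blast
  then show "rank T (vt \<alpha>) < n" using rank_stem by simp
next
  assume r: "rank T (vt \<alpha>) < n"
  have "length \<alpha> \<le> n - 1"
  proof (rule ccontr)
    assume l: "\<not> length \<alpha> \<le> n - 1"
    have "ones n \<subseteq> {\<beta> \<in> D. \<beta> < \<alpha>}"
    proof
      fix \<beta> assume \<beta>: "\<beta> \<in> ones n"
      then obtain m where m: "\<beta> = replicate m 1" "m < n" unfolding ones_def by blast
      then have "\<beta> < \<alpha>" using stem_less[OF assms, of m] l by auto
      then show "\<beta> \<in> {\<beta> \<in> D. \<beta> < \<alpha>}" using \<beta> ones_subset by blast
    qed
    then have "card (ones n) \<le> card {\<beta> \<in> D. \<beta> < \<alpha>}" using fin by (intro card_mono) auto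
    then show False using r rank_eq[OF assms] by (simp add: ones_simps)
  qed
  then have "\<alpha> = replicate (length \<alpha>) 1" "length \<alpha> < n" using assms stem_eq n2 by (blast, linarith)
  then show "\<alpha> \<in> ones n" unfolding ones_def by blast
qed

text \<open>The left side says that every coordinate of the 0-cell is blocked. A set of
  \<open>n\<close> addresses closed under parents reaches depth at most \<open>n - 1\<close>, where
  the tree does not branch, so \<open>chain_set\<close> applies.\<close>

lemma parent_closed_iff:
  assumes v: "valid0 ws"
  shows "(\<forall>w\<in>set ws. w = [] \<or> butlast w \<in> set ws) \<longleftrightarrow> set ws = ones n"
proof
  assume c: "\<forall>w\<in>set ws. w = [] \<or> butlast w \<in> set ws"
  have card: "card (set ws) = n" using v by (simp add: valid0_def distinct_card)
  have "set ws = (\<lambda>m. replicate m 1) ` {..<card (set ws)}"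
  proof (rule chain_set)
    show "\<gamma> @ [h] \<in> set ws \<Longrightarrow> \<gamma> \<in> set ws" for \<gamma> h using c by fastforce
    show "\<gamma> \<in> set ws \<Longrightarrow> length \<gamma> < card (set ws) \<Longrightarrow> \<gamma> = replicate (length \<gamma>) 1" for \<gamma>
      using v card by (intro stem_eq) (auto simp: valid0_def)
  qed simp
  then show "set ws = ones n" by (simp only: card ones_def)
next
  assume s: "set ws = ones n"
  show "\<forall>w\<in>set ws. w = [] \<or> butlast w \<in> set ws"
  proof
    fix w assume "w \<in> set ws"
    then obtain m where "w = replicate m 1" "m < n" unfolding s ones_def by blast
    then have "butlast w = replicate (m - 1) 1" "m - 1 < n" by (auto simp: butlast_replicate)
    then show "w = [] \<or> butlast w \<in> set ws" unfolding s ones_def by blast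
  qed
qed

lemma valid0_ones: "set ws = ones n \<Longrightarrow> valid0 ws \<longleftrightarrow> distinct ws"
  using ones_subset distinct_card[of ws] by (auto simp: valid0_def ones_simps)

lemma critical_cell0_iff:
  assumes v: "valid0 ws"
  shows "critical T n (cell0 ws) \<longleftrightarrow> set ws = ones n"
proof -
  have "has_pr T (cell0 ws) \<longleftrightarrow> \<not> (\<forall>w\<in>set ws. w = [] \<or> butlast w \<in> set ws)"
    using valid0D(1)[OF v] unfolding has_pr_def unblocked_cell0[OF v] by (metis in_set_conv_nth)
  then show ?thesis
    using critical_dim0_iff[OF cell0_mem[OF v]] parent_closed_iff[OF v] by simp
qed

lemma Gverts_eq: "Gverts T n = cell0 ` {ws. distinct ws \<and> set ws = ones n}"
proof (intro equalityI subsetI)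
  fix a assume a: "a \<in> Gverts T n"
  then obtain ws where ws: "valid0 ws" "a = cell0 ws"
    by (metis (mono_tags, lifting) Gverts_def critical_def cell0E mem_Collect_eq)
  then show "a \<in> cell0 ` {ws. distinct ws \<and> set ws = ones n}"
    using a critical_cell0_iff[OF ws(1)] by (auto simp: Gverts_def valid0_def)
next
  fix a assume "a \<in> cell0 ` {ws. distinct ws \<and> set ws = ones n}"
  then obtain ws where ws: "valid0 ws" "set ws = ones n" "a = cell0 ws" using valid0_ones by auto
  then show "a \<in> Gverts T n"
    using critical_cell0_iff[OF ws(1)] cell0_mem[OF ws(1)] by (simp add: Gverts_def)
qed

lemma rank_set_iff:
  assumes v: "valid0 ws"
  shows "{rank T (vx (cell0 ws ! k)) | k. k < n} = {0..<n} \<longleftrightarrow> set ws = ones n"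
proof -
  note v0 = valid0D[OF v]
  have setD: "set ws \<subseteq> D" using v by (simp add: valid0_def)
  have vx: "vx (cell0 ws ! k) = vt (ws ! k)" if "k < n" for k
    using that v0 by (simp add: nth_cell0 vx_def)
  have "{rank T (vx (cell0 ws ! k)) | k. k < n} = {rank T (vt (ws ! k)) | k. k < n}"
    using vx by (intro Collect_cong ex_cong1) auto
  also have "\<dots> = (\<lambda>\<alpha>. rank T (vt \<alpha>)) ` set ws" unfolding set_conv_nth using v0(1) by auto
  finally have eq: "{rank T (vx (cell0 ws ! k)) | k. k < n} = (\<lambda>\<alpha>. rank T (vt \<alpha>)) ` set ws" .
  show ?thesis unfolding eq
  proof
    assume r: "(\<lambda>\<alpha>. rank T (vt \<alpha>)) ` set ws = {0..<n}"
    have "set ws \<subseteq> ones n"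
    proof
      fix \<alpha> assume a: "\<alpha> \<in> set ws"
      then have "rank T (vt \<alpha>) \<in> {0..<n}" using r by blast
      then show "\<alpha> \<in> ones n" using rank_less_iff a setD by auto
    qed
    then show "set ws = ones n"
      using v0 by (intro card_subset_eq) (auto simp: ones_simps distinct_card)
  next
    assume "set ws = ones n"
    then show "(\<lambda>\<alpha>. rank T (vt \<alpha>)) ` set ws = {0..<n}"
      using rank_stem by (force simp: ones_def image_image)
  qed
qed

lemma Gverts_rank:
  "Gverts T n = {a \<in> cells T n. dim T a = 0 \<and> {rank T (vx (a ! k)) | k. k < n} = {0..<n}}"
proof (intro equalityI subsetI)
  fix a assume "a \<in> Gverts T n"
  then obtain ws where ws: "valid0 ws" "set ws = ones n" "a = cell0 ws"
    using valid0_ones by (auto simp: Gverts_eq)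
  then show "a \<in> {a \<in> cells T n. dim T a = 0 \<and> {rank T (vx (a ! k)) | k. k < n} = {0..<n}}"
    using cell0_mem[OF ws(1)] rank_set_iff[OF ws(1)] by blast
next
  fix a assume a: "a \<in> {a \<in> cells T n. dim T a = 0 \<and> {rank T (vx (a ! k)) | k. k < n} = {0..<n}}"
  then obtain ws where ws: "valid0 ws" "a = cell0 ws" using cell0E by blast
  then have "set ws = ones n" using a rank_set_iff[OF ws(1)] by blast
  then show "a \<in> Gverts T n" using ws valid0_ones by (auto simp: Gverts_eq)
qed

text \<open>The set \<open>ones n\<close> is an initial segment of the vertex order, so ranks in the
  tree and ranks within the list agree on it.\<close>

lemma perm_of_cell0:
  assumes "distinct ws" "set ws = ones n"
  shows "perm_of T (cell0 ws) = order_perm ws"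
proof
  fix k
  show "perm_of T (cell0 ws) k = order_perm ws k"
  proof (cases "1 \<le> k \<and> k \<le> length ws")
    case True
    then have "ws ! (k - 1) \<in> set ws" by (intro nth_mem) auto
    then have "ws ! (k - 1) \<in> ones n" by (simp only: assms(2))
    then obtain m where m: "ws ! (k - 1) = replicate m 1" "m < n" unfolding ones_def by blast
    have "{a \<in> ones n. a < replicate m 1} = {\<beta> \<in> D. \<beta> < replicate m 1}"
      using ones_subset below_stem[OF m(2)] m(2) unfolding ones_def by auto
    then have "card {a \<in> set ws. a < ws ! (k - 1)} = m"
      using m below_stem[OF m(2)] ones_simps(2)[of m] by (simp only: assms(2))
    moreover have "k - 1 < length ws" using True by auto
    then have "rank T (vx (cell0 ws ! (k - 1))) = m"
      using m rank_stem by (simp add: nth_cell0 vx_def)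
    ultimately show ?thesis using True by (simp add: perm_of_def order_perm_def)
  next
    case False
    then show ?thesis by (auto simp: perm_of_def order_perm_def)
  qed
qed

lemma bij_betw_perm_of: "bij_betw (perm_of T) (Gverts T n) {\<tau>. \<tau> permutes {1..n}}"
proof -
  let ?L = "{ws. distinct ws \<and> set ws = ones n}"
  have b: "bij_betw order_perm ?L {\<tau>. \<tau> permutes {1..n}}"
    using bij_betw_order_perm[of "ones n"] by (simp add: ones_simps)
  have "inj_on cell0 ?L" using cell0_inj valid0_ones by (intro inj_onI) auto
  then have c: "bij_betw cell0 ?L (Gverts T n)" by (simp add: Gverts_eq bij_betw_def)
  have "bij_betw (perm_of T \<circ> cell0) ?L {\<tau>. \<tau> permutes {1..n}}"
    using b by (subst bij_betw_cong[of _ _ order_perm]) (auto simp: perm_of_cell0)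
  then show ?thesis using c bij_betw_comp_iff by blast
qed

lemma card_Gverts: "card (Gverts T n) = fact n"
  using bij_betw_same_card[OF bij_betw_perm_of] card_permutations[of "{1..n}" n] by simp

section \<open>Faces of 1-cells and the reduction to critical 0-cells\<close>

lemma edge_ends:
  assumes "y \<in> D" "y \<noteq> []"
  shows "elo T (edge y) = vt (butlast y)" "ehi T (edge y) = vt y"
proof -
  have lt: "vless T (vt (butlast y)) (vt y)" "\<not> vless T (vt y) (vt (butlast y))"
    using assms butlast_mem[of y] butlast_less[of y] by (auto simp: vless_iff)
  then show "elo T (edge y) = vt (butlast y)" unfolding elo_def edge_def
    by (intro the_equality) (auto simp: doubleton_eq_iff)
  show "ehi T (edge y) = vt y" unfolding ehi_def edge_def
    using lt by (intro the_equality) (auto simp: doubleton_eq_iff)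
qed

lemma faces_cell1:
  assumes "valid1 k ws"
  shows "lo_face T (cell1 k ws) = cell0 (ws[k := butlast (ws ! k)])"
    "hi_face T (cell1 k ws) = cell0 ws"
proof -
  note v1 = valid1D[OF assms] and v0 = valid0D[OF valid1D(1)[OF assms]]
  have y: "ws ! k \<in> D" using v0 v1 by simp
  have "eidx T (cell1 k ws) = k" unfolding eidx_def
  proof (rule the_equality)
    show "k < length (cell1 k ws) \<and> cell1 k ws ! k \<in> edges T"
      using v0(1) v1(2,3) y by (simp add: nth_cell1 edge_mem)
    fix l assume "l < length (cell1 k ws) \<and> cell1 k ws ! l \<in> edges T"
    then show "l = k" using v0(1) v1(2) by (auto simp: nth_cell1 singleton_not_edge split: if_splits)
  qed
  moreover have "cell1 k ws ! k = edge (ws ! k)" using v0(1) v1(2) by (simp add: nth_cell1)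
  ultimately show "lo_face T (cell1 k ws) = cell0 (ws[k := butlast (ws ! k)])"
    "hi_face T (cell1 k ws) = cell0 ws"
    using edge_ends[OF y v1(3)] v0(1) v1(2)
    by (simp_all add: lo_face_def hi_face_def cell1_def cell0_def map_update list_update_same_conv)
qed

lemma valid0_lower:
  assumes "valid1 k ws"
  shows "valid0 (ws[k := butlast (ws ! k)])"
proof -
  note v1 = valid1D[OF assms] and v0 = valid0D[OF valid1D(1)[OF assms]]
  have "set (ws[k := butlast (ws ! k)]) \<subseteq> insert (butlast (ws ! k)) (set ws)"
    by (rule set_update_subset_insert)
  then show ?thesis
    using v0 v1 by (auto simp: valid0_def intro: distinct_list_update)
qed

text \<open>A coordinate between the old and the new position of the sliding one would have a smallest
  representative, and that one would be unblocked.\<close>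
lemma slide_order_perm:
  assumes f: "first_unblocked i ws" and v: "valid1 i ws"
  shows "order_perm (ws[i := butlast (ws ! i)]) = order_perm ws"
proof -
  note v1 = valid1D[OF v] and v0 = valid0D[OF valid1D(1)[OF v]]
  define y where "y = ws ! i"
  define x where "x = butlast y"
  have xy: "x < y" using v1(3) by (simp add: x_def y_def butlast_less)
  have yx: "y = x @ [last y]" using v1(3) by (simp add: x_def y_def)
  have none: "\<not> (x < z \<and> z < y)" if "z \<in> set ws" for z
  proof
    assume z: "x < z \<and> z < y"
    let ?Z = "{z \<in> set ws. x < z \<and> z < y}"
    define m where "m = Min ?Z"
    have "m \<in> ?Z" unfolding m_def using z that by (intro Min_in) auto
    then have m: "m \<in> set ws" "x < m" "m < y" by auto
    obtain h \<gamma> where h: "m = x @ h # \<gamma>"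
      using between_siblings[of x m "last y"] m yx by metis
    \<comment> \<open>As \<open>m\<close> properly extends \<open>x\<close>, its parent is
      \<open>x\<close> or lies strictly between \<open>x\<close> and \<open>y\<close>. The former is
      not a coordinate because coordinate \<open>i\<close> is unblocked, and the latter would
      contradict the minimality of \<open>m\<close>.\<close>
    have "butlast m \<notin> set ws"
    proof
      assume b: "butlast m \<in> set ws"
      have "x \<notin> set ws" using v1(4) by (simp add: x_def y_def)
      with b h have "x < butlast m" by (auto simp: butlast_append split: if_splits)
      moreover have bm: "butlast m < m" using h by (intro butlast_less) simp
      ultimately have "butlast m \<in> ?Z" using b m by auto
      then have "m \<le> butlast m" unfolding m_def by (intro Min_le) auto
      with bm show False by simp
    qed
    moreover obtain l where l: "l < n" "m = ws ! l" using m(1) v0(1) by (auto simp: in_set_conv_nth)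
    moreover have "l \<noteq> i" using m l by (auto simp: y_def)
    moreover have "m \<noteq> []" using h by simp
    ultimately have "y < m" using f by (auto simp: first_unblocked_def y_def)
    with m show False by simp
  qed
  have same: "(x < ws ! l \<longleftrightarrow> y < ws ! l) \<and> (ws ! l < x \<longleftrightarrow> ws ! l < y)" if l: "l < n" "l \<noteq> i" for l
  proof -
    have "ws ! l \<in> set ws" using l v0(1) by simp
    then have "\<not> (x < ws ! l \<and> ws ! l < y)" by (rule none)
    moreover have "ws ! l \<noteq> x" "ws ! l \<noteq> y" using l v0 v1 by (auto simp: x_def y_def)
    ultimately show ?thesis using xy by (meson less_trans linorder_less_linear)
  qed
  show ?thesis
  proof (rule order_perm_cong)
    show "distinct (ws[i := butlast (ws ! i)])" using valid0_lower[OF v] by (simp add: valid0_def)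
    fix l m assume "l < length (ws[i := butlast (ws ! i)])" "m < length (ws[i := butlast (ws ! i)])"
    then show "ws[i := butlast (ws ! i)] ! l < ws[i := butlast (ws ! i)] ! m \<longleftrightarrow> ws ! l < ws ! m"
      using same[of l] same[of m] v0(1) v1(2)
      by (cases "l = i"; cases "m = i") (auto simp: x_def y_def)
  qed (use v0 in auto)
qed

text \<open>Every step is a slide and keeps \<open>order_perm\<close>; at a critical 0-cell, where
  the steps end, \<open>order_perm\<close> is \<open>perm_of\<close>.\<close>

lemma phi_rel_result:
  assumes "phi_rel T n u c" "valid0 ws" "u = cell0 ws"
  shows "c \<in> Gverts T n \<and> perm_of T c = order_perm ws"
  using assms
proof (induction arbitrary: ws)
  case (crit u)
  then have "set ws = ones n" using critical_cell0_iff by blast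
  then show ?case using crit perm_of_cell0[of ws] by (auto simp: Gverts_eq valid0_def)
next
  case (step u w u' c)
  obtain k where "(u, w) \<in> Wk T n k" using step.hyps by (auto simp: Wf_def)
  from Wk_D[OF this] have w: "has_pr T (cell0 ws)" "w = pr T (cell0 ws)" using step.prems by auto
  obtain i where i: "first_unblocked i ws" "valid1 i ws" "pr T (cell0 ws) = cell1 i ws"
    using pr_cell0[OF step.prems(1) w(1)] .
  \<comment> \<open>The upper face is \<open>u\<close> itself, so \<open>u' \<noteq> u\<close>
    leaves only the lower face.\<close>
  then have "u' = cell0 (ws[i := butlast (ws ! i)])"
    using step.hyps step.prems w by (auto simp: faces_cell1)
  then show ?case
    using step.IH[OF valid0_lower[OF i(2)]] slide_order_perm[OF i(1,2)] by simp
qed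

text \<open>A slide shortens one address by one digit, so the total depth of the coordinates
  decreases.\<close>

lemma phi_rel_exists: "valid0 ws \<Longrightarrow> \<exists>c. phi_rel T n (cell0 ws) c"
proof (induction "sum_list (map length ws)" arbitrary: ws rule: less_induct)
  case less
  show ?case
  proof (cases "has_pr T (cell0 ws)")
    case False
    then show ?thesis
      using critical_dim0_iff cell0_mem[OF less.prems] phi_rel.crit by blast
  next
    case True
    obtain i where i: "first_unblocked i ws" "valid1 i ws" "pr T (cell0 ws) = cell1 i ws"
      using pr_cell0[OF less.prems True] .
    note v1 = valid1D[OF i(2)] and v0 = valid0D[OF valid1D(1)[OF i(2)]]
    let ?us = "ws[i := butlast (ws ! i)]"
    have us: "valid0 ?us" by (rule valid0_lower[OF i(2)])
    have "length (ws ! i) \<le> sum_list (map length ws)"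
      using v0(1) v1(2) by (intro member_le_sum_list) auto
    moreover have "0 < length (ws ! i)" using v1(3) by simp
    moreover have "sum_list (map length ?us) =
        sum_list (map length ws) + (length (ws ! i) - 1) - length (ws ! i)"
      using v0(1) v1(2) by (simp add: map_update sum_list_update)
    ultimately have "sum_list (map length ?us) < sum_list (map length ws)" by linarith
    then obtain c where c: "phi_rel T n (cell0 ?us) c" using less.hyps us by blast
    have "?us \<noteq> ws" using v0(1) v1(2,3) butlast_neq[of "ws ! i"] by (metis nth_list_update_eq)
    then have "cell0 ?us \<noteq> cell0 ws" using cell0_inj us less.prems by blast
    moreover have "(cell0 ws, cell1 i ws) \<in> Wk T n 0"
      using True i(3) cell0_mem[OF less.prems] by auto
    then have "(cell0 ws, cell1 i ws) \<in> Wf T n" unfolding Wf_def by blast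
    ultimately show ?thesis
      using phi_rel.step[of "cell0 ws" "cell1 i ws" T n "cell0 ?us" c] c
        cell0_mem[OF less.prems] faces_cell1[OF i(2)] by auto
  qed
qed

text \<open>Uniqueness of the end of the reduction comes from the invariant: every possible end has
  permutation \<open>order_perm ws\<close>, and \<open>perm_of\<close> is injective on critical
  0-cells.\<close>

lemma phi_cell0:
  assumes "valid0 ws"
  shows "perm_of T (phi T n (cell0 ws)) = order_perm ws"
proof -
  obtain c where c: "phi_rel T n (cell0 ws) c" using phi_rel_exists[OF assms] by blast
  have "phi T n (cell0 ws) = c" unfolding phi_def
  proof (rule the_equality[where P = "phi_rel T n (cell0 ws)", OF c])
    fix d assume "phi_rel T n (cell0 ws) d"
    then show "d = c"
      using phi_rel_result[OF _ assms refl] c bij_betw_perm_of by (metis bij_betw_def inj_onD)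
  qed
  then show ?thesis using phi_rel_result[OF c assms refl] by simp
qed

lemma perm_of_Gsrc: "valid1 k ws \<Longrightarrow> perm_of T (Gsrc T n (cell1 k ws)) = order_perm (ws[k := butlast (ws ! k)])"
  by (simp add: Gsrc_def faces_cell1 phi_cell0 valid0_lower)

lemma perm_of_Gtgt: "valid1 k ws \<Longrightarrow> perm_of T (Gtgt T n (cell1 k ws)) = order_perm ws"
  by (simp add: Gtgt_def faces_cell1 phi_cell0 valid1D(1))

section \<open>The classes of edges: ends, number and symmetry\<close>

lemma Gedges_iff:
  "c \<in> Gedges T n \<longleftrightarrow> (\<exists>k ws. c = cell1 k ws \<and> valid1 k ws \<and> conf (ws ! k) (set ws - {ws ! k}))"
proof
  assume c: "c \<in> Gedges T n"
  then obtain k ws where "valid1 k ws" "c = cell1 k ws"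
    by (metis (mono_tags, lifting) Gedges_def critical_def cell1E mem_Collect_eq)
  then show "\<exists>k ws. c = cell1 k ws \<and> valid1 k ws \<and> conf (ws ! k) (set ws - {ws ! k})"
    using c critical_cell1_iff by (auto simp: Gedges_def)
qed (use critical_cell1_iff cell1_mem in \<open>auto simp: Gedges_def\<close>)

definition edge_class :: "nat \<Rightarrow> nat \<Rightarrow> 'a set list set" where
  "edge_class i j = {cell1 k ws | k ws. valid1 k ws \<and> (ws ! k, set ws - {ws ! k}) \<in> confs i j}"

lemma edge_class_subset: "edge_class i j \<subseteq> Gedges T n"
  unfolding edge_class_def confs_def Gedges_iff[abs_def] subset_iff by blast

text \<open>If p coordinates lie below the lower end and q between the two ends, the class is read
  off as i = n-p and j = q+1. Then \<open>j \<le> i\<close> holds because p+q is at most n-1, and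
  \<open>2 \<le> j\<close> because the smaller sibling of the upper end lies between the
  ends.\<close>

lemma edge_class_unique:
  assumes c: "c \<in> Gedges T n"
  shows "\<exists>!ij. 2 \<le> snd ij \<and> snd ij \<le> fst ij \<and> fst ij \<le> n \<and> c \<in> edge_class (fst ij) (snd ij)"
proof -
  obtain k ws where kw: "c = cell1 k ws" "valid1 k ws" "conf (ws ! k) (set ws - {ws ! k})"
    using c unfolding Gedges_iff by blast
  note v1 = valid1D[OF kw(2)] and v0 = valid0D[OF valid1D(1)[OF kw(2)]]
  define y where "y = ws ! k"
  define A where "A = set ws - {y}"
  have cA: "card A = n - 1" using v0(1,2) v1(2) by (simp add: A_def y_def distinct_card)
  define p where "p = card {a \<in> A. a < butlast y}"
  define q where "q = card {a \<in> A. butlast y < a \<and> a < y}"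
  have "finite A" by (simp add: A_def)
  moreover have "{a \<in> A. a < butlast y} \<inter> {a \<in> A. butlast y < a \<and> a < y} = {}" by auto
  ultimately have "p + q = card ({a \<in> A. a < butlast y} \<union> {a \<in> A. butlast y < a \<and> a < y})"
    by (simp add: p_def q_def card_Un_disjoint)
  also have "\<dots> \<le> card A" using \<open>finite A\<close> by (intro card_mono) auto
  finally have pq: "p + q \<le> n - 1" using cA by simp
  obtain v where v: "v \<in> A" "v \<noteq> []" "butlast v = butlast y" "v < y"
    using kw(3) by (auto simp: conf_def A_def y_def)
  then have "v \<in> {a \<in> A. butlast y < a \<and> a < y}" using butlast_less[of v] by auto
  then have q0: "0 < q" unfolding q_def using \<open>finite A\<close> by (intro card_gt_0_iff[THEN iffD2]) auto
  have iff: "c \<in> edge_class i j \<longleftrightarrow> p = n - i \<and> q = j - 1" for i j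
  proof
    assume "c \<in> edge_class i j"
    then obtain l us where us: "c = cell1 l us" "valid1 l us" "(us ! l, set us - {us ! l}) \<in> confs i j"
      by (auto simp: edge_class_def)
    then have "k = l" "ws = us" using cell1_inj[OF kw(2) us(2)] kw(1) by auto
    then show "p = n - i \<and> q = j - 1" using us(3) by (simp add: confs_def p_def q_def A_def y_def)
  next
    assume "p = n - i \<and> q = j - 1"
    then have "(ws ! k, set ws - {ws ! k}) \<in> confs i j"
      using kw(3) cA by (simp add: confs_def p_def q_def A_def y_def)
    then show "c \<in> edge_class i j" using kw by (auto simp: edge_class_def)
  qed
  show ?thesis
  proof (rule ex1I[of _ "(n - p, q + 1)"])
    show "2 \<le> snd (n - p, q + 1) \<and> snd (n - p, q + 1) \<le> fst (n - p, q + 1) \<and> fst (n - p, q + 1) \<le> n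
        \<and> c \<in> edge_class (fst (n - p, q + 1)) (snd (n - p, q + 1))"
      using pq q0 n2 iff by auto
    fix ij assume "2 \<le> snd ij \<and> snd ij \<le> fst ij \<and> fst ij \<le> n \<and> c \<in> edge_class (fst ij) (snd ij)"
    then have "2 \<le> snd ij" "fst ij \<le> n" "p = n - fst ij" "q = snd ij - 1" using iff by auto
    then show "ij = (n - p, q + 1)" by (cases ij) auto
  qed
qed

context
  fixes i j :: nat
  assumes ij: "2 \<le> j" "j \<le> i" "i \<le> n"
begin

lemma Gtgt_edge_class:
  assumes "c \<in> edge_class i j"
  shows "perm_of T (Gtgt T n c) = inv (sigma n i j) \<circ> perm_of T (Gsrc T n c)"
proof -
  obtain k ws where kw: "c = cell1 k ws" "valid1 k ws" "(ws ! k, set ws - {ws ! k}) \<in> confs i j"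
    using assms unfolding edge_class_def by blast
  note v1 = valid1D[OF kw(2)] and v0 = valid0D[OF valid1D(1)[OF kw(2)]]
  have "order_perm ws = inv (sigma (length ws) i j) \<circ> order_perm (ws[k := butlast (ws ! k)])"
    using kw(3) v0 v1 ij butlast_less[of "ws ! k"]
    by (intro order_perm_move) (auto simp: confs_def)
  then show ?thesis using perm_of_Gsrc[OF kw(2)] perm_of_Gtgt[OF kw(2)] kw(1) v0(1) by simp
qed

text \<open>Passing from \<open>(k, ws)\<close> to the pair in \<open>confs i j\<close> forgets the
  arrangement. Conversely, a pair \<open>(y, A)\<close> fixes the entries of the lower face, namely
  \<open>A\<close> and \<open>butlast y\<close>; exactly one ordering of them has rank permutation
  \<open>\<tau>\<close>, and the place of \<open>butlast y\<close> in it is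
  \<open>k\<close>.\<close>

lemma card_edge_class:
  assumes \<tau>: "\<tau> permutes {1..n}"
  shows "card {c \<in> edge_class i j. perm_of T (Gsrc T n c) = \<tau> \<and>
    perm_of T (Gtgt T n c) = inv (sigma n i j) \<circ> \<tau>} = card (confs i j)"
proof -
  let ?S = "{(k, ws). valid1 k ws \<and> (ws ! k, set ws - {ws ! k}) \<in> confs i j \<and>
    order_perm (ws[k := butlast (ws ! k)]) = \<tau>}"
  let ?g = "\<lambda>(k, ws :: nat list list). (ws ! k, set ws - {ws ! k})"
  have inj: "inj_on ?g ?S"
  proof (rule inj_onI)
    fix z z' assume z: "z \<in> ?S" "z' \<in> ?S" "?g z = ?g z'"
    obtain k ws where zz1: "z = (k, ws)" by (cases z)
    obtain k' ws' where zz2: "z' = (k', ws')" by (cases z')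
    note zz = zz1 zz2
    have v: "valid1 k ws" "valid1 k' ws'" and o: "order_perm (ws[k := butlast (ws ! k)]) = \<tau>"
        "order_perm (ws'[k' := butlast (ws' ! k')]) = \<tau>"
      and y: "ws ! k = ws' ! k'" "set ws - {ws ! k} = set ws' - {ws' ! k'}"
      using z unfolding zz mem_Collect_eq prod.case prod.inject by blast+
    note v1 = valid1D[OF v(1)] valid1D[OF v(2)]
    note v0 = valid0D[OF valid1D(1)[OF v(1)]] valid0D[OF valid1D(1)[OF v(2)]]
    define x where "x = butlast (ws ! k)"
    have s: "set (ws[k := x]) = insert x (set ws - {ws ! k})"
      "set (ws'[k' := x]) = insert x (set ws - {ws ! k})"
      using v0 v1 y set_update_distinct[of ws k x] set_update_distinct[of ws' k' x] by simp_all
    have d: "distinct (ws[k := x])" "distinct (ws'[k' := x])"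
      using valid0_lower[OF v(1)] valid0_lower[OF v(2)] y by (simp_all add: valid0_def x_def)
    have o': "order_perm (ws[k := x]) = \<tau>" "order_perm (ws'[k' := x]) = \<tau>"
      using o y(1) by (simp_all add: x_def)
    have "inj_on order_perm {us. distinct us \<and> set us = insert x (set ws - {ws ! k})}"
      by (rule bij_betw_imp_inj_on[OF bij_betw_order_perm]) simp
    then have "ws[k := x] = ws'[k' := x]"
      by (rule inj_onD) (simp_all add: d s o')
    moreover have "ws[k := x] ! k = x" "ws'[k' := x] ! k' = x" using v0 v1 by simp_all
    ultimately have kk: "k = k'" using d v0(1,6) v1(2) v1(7)
      by (metis length_list_update nth_eq_iff_index_eq)
    then have "(ws[k := x])[k := ws ! k] = (ws'[k' := x])[k' := ws' ! k']"
      using \<open>ws[k := x] = ws'[k' := x]\<close> y by simp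
    then show "z = z'" using kk zz by simp
  qed
  have "{c \<in> edge_class i j. perm_of T (Gsrc T n c) = \<tau> \<and>
      perm_of T (Gtgt T n c) = inv (sigma n i j) \<circ> \<tau>} =
      {c \<in> edge_class i j. perm_of T (Gsrc T n c) = \<tau>}"
    using Gtgt_edge_class by auto
  also have "\<dots> = (\<lambda>(k, ws). cell1 k ws) ` ?S"
    by (auto simp: edge_class_def perm_of_Gsrc image_iff)
  finally have "card {c \<in> edge_class i j. perm_of T (Gsrc T n c) = \<tau> \<and>
      perm_of T (Gtgt T n c) = inv (sigma n i j) \<circ> \<tau>} = card ((\<lambda>(k, ws). cell1 k ws) ` ?S)"
    by (rule arg_cong)
  also have "\<dots> = card ?S"
    by (intro card_image inj_onI) (auto dest: cell1_inj)
  also have "\<dots> = card (?g ` ?S)"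
    using card_image[OF inj] by (rule sym)
  also have "\<dots> = card (confs i j)"
  proof (rule arg_cong[of _ _ card])
    show "?g ` ?S = confs i j"
    proof (intro equalityI subsetI)
      fix z assume z: "z \<in> confs i j"
      obtain y A where yA: "z = (y, A)" by fastforce
      define x where "x = butlast y"
      have c: "y \<in> D" "y \<noteq> []" "A \<subseteq> D" "y \<notin> A" "x \<notin> A" "card A = n - 1"
        using z yA by (auto simp: confs_def conf_def x_def)
      have finA: "finite A" using c(3) fin finite_subset by blast
      then have cB: "card (insert x A) = n" using c n2 by simp
      have "\<tau> \<in> order_perm ` {us. distinct us \<and> set us = insert x A}"
        using bij_betw_order_perm[of "insert x A"] finA \<tau> cB by (simp add: bij_betw_def)
      then obtain us where us: "distinct us" "set us = insert x A" "order_perm us = \<tau>" by auto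
      then have len: "length us = n" using cB distinct_card by metis
      obtain k where k: "k < n" "us ! k = x" using us(2) len by (metis in_set_conv_nth insertI1)
      define ws where "ws = us[k := y]"
      have xy: "x \<noteq> y" using butlast_neq c(2) x_def by simp
      have set: "set ws = insert y A"
        using set_update_distinct[OF us(1), of k y] k len us(2) c(5) by (simp add: ws_def)
      have y: "ws ! k = y" using k len by (simp add: ws_def)
      have "distinct ws" unfolding ws_def using us(1,2) c(4) xy by (intro distinct_list_update) auto
      moreover have "length ws = n" by (simp add: ws_def len)
      ultimately have "valid1 k ws"
        using k c xy unfolding valid1_def valid0_def y set x_def[symmetric] by simp
      moreover have "set ws - {ws ! k} = A" using set y c(4) by auto
      moreover have "ws[k := x] = us" using list_update_id[of us k] k(2) by (simp add: ws_def)
      then have "ws[k := butlast (ws ! k)] = us" by (simp only: y x_def)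
      ultimately have "(k, ws) \<in> ?S" "?g (k, ws) = z"
        using us z yA y by simp_all
      then show "z \<in> ?g ` ?S" by (metis (no_types, lifting) image_eqI)
    qed auto
  qed
  finally show ?thesis .
qed

text \<open>The class depends only on the edge and on the set of coordinates, which reordering
  leaves alone. The edge moves to the position that \<open>\<mu>\<close> sends to its old
  one.\<close>

lemma act_edge_class:
  assumes \<mu>: "\<mu> permutes {1..n}" and c: "c \<in> edge_class i j"
  shows "act c \<mu> \<in> edge_class i j"
    "perm_of T (Gsrc T n (act c \<mu>)) = perm_of T (Gsrc T n c) \<circ> \<mu>"
proof -
  obtain k ws where kw: "c = cell1 k ws" "valid1 k ws" "(ws ! k, set ws - {ws ! k}) \<in> confs i j"
    using c unfolding edge_class_def by blast
  note v1 = valid1D[OF kw(2)] and v0 = valid0D[OF valid1D(1)[OF kw(2)]]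
  obtain l where l: "l < n" "\<mu> (l + 1) - 1 = k" using permutes_shift_surj[OF \<mu> v1(2)] .
  let ?us = "reindex \<mu> ws"
  have us: "length ?us = n" "set ?us = set ws" "distinct ?us" "?us ! l = ws ! k"
    using v0 set_reindex[OF \<mu>] distinct_reindex[OF \<mu>] l by (simp_all add: nth_reindex)
  then have valid: "valid1 l ?us" using kw(2) l by (simp add: valid1_def valid0_def)
  have "reindex \<mu> (cell0 ws) = cell0 ?us"
    using permutes_shift(1)[OF \<mu>] v0(1) by (intro nth_equalityI) (simp_all add: nth_reindex nth_cell0)
  then have act: "act c \<mu> = cell1 l ?us"
    using reindex_update[OF \<mu>, of "cell0 ws" l "edge (ws ! k)"] l v0(1) us(4)
    by (simp add: kw(1) act_eq_reindex cell1_def)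
  have "(?us ! l, set ?us - {?us ! l}) \<in> confs i j" using kw(3) us(2,4) by simp
  then show "act c \<mu> \<in> edge_class i j" using valid act unfolding edge_class_def by blast
  have "?us[l := butlast (ws ! k)] = reindex \<mu> (ws[k := butlast (ws ! k)])"
    using reindex_update[OF \<mu>, of ws l "butlast (ws ! k)"] l v0(1) by simp
  then show "perm_of T (Gsrc T n (act c \<mu>)) = perm_of T (Gsrc T n c) \<circ> \<mu>"
    using act kw(1) perm_of_Gsrc[OF valid] perm_of_Gsrc[OF kw(2)] us(4) v0(1)
      order_perm_reindex[OF \<mu>, of "ws[k := butlast (ws ! k)]"] by simp
qed

end

lemma sum_m_num:
  assumes "2 \<le> i"
  shows "(\<Sum>l = 2..i. ((i - 2) choose (l - 2)) * m_num T l) = (\<Sum>x\<in>D. (kids x + i - 2) choose i)"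
proof -
  have "m_num T l = (\<Sum>x\<in>D. kids x choose l)" if l: "2 \<le> l" for l
  proof -
    have fv: "finite (verts T)" using fin by (simp add: verts_eq)
    have "m_num T l = (\<Sum>v\<in>verts T. (deg T v - 1) choose l)" unfolding m_num_def
      \<comment> \<open>Vertices of degree at most \<open>l\<close> may be added, since their
        binomial coefficient is 0.\<close>
      using fv l by (intro sum.mono_neutral_left) auto
    also have "\<dots> = (\<Sum>x\<in>D. (deg T (vt x) - 1) choose l)"
      unfolding verts_eq using inj_vt by (simp add: sum.reindex)
    also have "\<dots> = (\<Sum>x\<in>D. kids x choose l)"
    proof (rule sum.cong)
      fix x assume x: "x \<in> D"
      show "(deg T (vt x) - 1) choose l = kids x choose l"
      proof (cases "x = []")
        case True
        \<comment> \<open>At the root, the degree minus one is 0 whereas \<open>kids\<close> is 1;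
          both binomial coefficients vanish because \<open>l \<ge> 2\<close>.\<close>
        have "kids [] = 1" using stem[OF nil] n2 by simp
        then show ?thesis using True l deg_eq(2) by (simp add: binomial_eq_0)
      qed (use x deg_eq in simp)
    qed simp
    finally show ?thesis .
  qed
  then have "(\<Sum>l = 2..i. ((i - 2) choose (l - 2)) * m_num T l) =
      (\<Sum>l = 2..i. \<Sum>x\<in>D. ((i - 2) choose (l - 2)) * (kids x choose l))"
    by (simp add: sum_distrib_left)
  also have "\<dots> = (\<Sum>x\<in>D. \<Sum>l = 2..i. ((i - 2) choose (l - 2)) * (kids x choose l))"
    by (rule sum.swap)
  also have "\<dots> = (\<Sum>x\<in>D. (kids x + i - 2) choose i)"
    using choose_shifted_Vandermonde[OF assms] by simp
  finally show ?thesis .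
qed

end

section \<open>Addresses of the vertices of a rooted tree\<close>

lemma is_path_iff:
  "is_path T p u v \<longleftrightarrow> p \<noteq> [] \<and> hd p = u \<and> last p = v \<and> distinct p \<and> set p \<subseteq> verts T \<and>
     successively (\<lambda>a b. {a, b} \<in> edges T) p"
  by (simp add: is_path_def successively_conv_nth)

lemma is_cycle_iff:
  "is_cycle T p \<longleftrightarrow> 3 \<le> length p \<and> distinct p \<and> set p \<subseteq> verts T \<and>
     successively (\<lambda>a b. {a, b} \<in> edges T) p \<and> {last p, hd p} \<in> edges T"
  by (simp add: is_cycle_def successively_conv_nth)

lemma successively_rev_edges:
  "successively (\<lambda>a b. {a, b} \<in> edges T) (rev p) \<longleftrightarrow> successively (\<lambda>a b. {a, b} \<in> edges T) p"
  by (simp add: insert_commute)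

lemma is_path_rev: "is_path T p u v \<Longrightarrow> is_path T (rev p) v u"
  using successively_rev_edges[of T p] by (auto simp: is_path_iff hd_rev last_rev)

lemma is_path_prefix: "is_path T (p @ w # q) u v \<Longrightarrow> is_path T (p @ [w]) u w"
  by (cases p) (auto simp: is_path_iff successively_append_iff successively_Cons hd_append)

lemma is_path_suffix: "is_path T (p @ w # q) u v \<Longrightarrow> is_path T (w # q) w v"
  by (auto simp: is_path_iff successively_append_iff)

text \<open>Where two paths with the same ends part at \<open>u\<close>, follow the first to its
  first vertex \<open>c\<close> on the second and return along the second. This closes a cycle
  through \<open>u\<close>, of length at least 3 because the first steps differ.\<close>

lemma acyclic_path_unique:
  assumes acyclic: "\<nexists>c. is_cycle T c"
  shows "is_path T p u v \<Longrightarrow> is_path T q u v \<Longrightarrow> p = q"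
proof (induction p arbitrary: u q)
  case Nil
  then show ?case by (simp add: is_path_iff)
next
  case (Cons a p)
  then have [simp]: "a = u" by (simp add: is_path_iff)
  from Cons.prems obtain q' where q: "q = u # q'" by (cases q) (auto simp: is_path_iff)
  show ?case
  proof (cases "u = v")
    case True
    then have "p = []" "q' = []" using Cons.prems q by (auto simp: is_path_iff split: if_splits)
    then show ?thesis using q by simp
  next
    case False
    then have ne: "p \<noteq> []" "q' \<noteq> []" using Cons.prems q by (auto simp: is_path_iff)
    then have p: "is_path T p (hd p) v" and q': "is_path T q' (hd q') v"
      and up: "{u, hd p} \<in> edges T" "u \<notin> set p" and uq: "{u, hd q'} \<in> edges T" "u \<notin> set q'"
      and uV: "u \<in> verts T"
      using Cons.prems q by (auto simp: is_path_iff successively_Cons)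
    show ?thesis
    proof (cases "hd p = hd q'")
      case True
      then show ?thesis using Cons.IH[OF p] q' q by simp
    next
      case False
      have "v \<in> set p \<inter> set q'" using p q' ne by (metis IntI is_path_iff last_in_set)
      then obtain p1 c p2 where p1: "p = p1 @ c # p2" "c \<in> set q'" "\<forall>z\<in>set p1. z \<notin> set q'"
        using split_list_first_prop[of p "\<lambda>z. z \<in> set q'"] by blast
      then obtain q1 q2 where q1: "q' = q1 @ c # q2" by (metis split_list)
      have P1: "is_path T (p1 @ [c]) (hd p) c" using is_path_prefix p p1(1) by metis
      have Q1: "is_path T (q1 @ [c]) (hd q') c" using is_path_prefix q' q1 by metis
      have Q1': "is_path T (c # rev q1) c (hd q')" using is_path_rev[OF Q1] by simp
      have "q1 \<noteq> [] \<or> p1 \<noteq> []" using False p1(1) q1 by auto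
      then have len: "3 \<le> length (u # p1 @ c # rev q1)" by (cases q1; cases p1) auto
      have "successively (\<lambda>a b. {a, b} \<in> edges T) ((p1 @ [c]) @ rev q1)"
        using P1 Q1' by (cases "rev q1") (auto simp: is_path_iff successively_append_iff successively_Cons)
      moreover have "hd (p1 @ c # rev q1) = hd p" using p1(1) by (cases p1) auto
      ultimately have "successively (\<lambda>a b. {a, b} \<in> edges T) (u # p1 @ c # rev q1)"
        using up by (auto simp: successively_Cons)
      moreover have "{last (u # p1 @ c # rev q1), u} \<in> edges T"
        using Q1' uq(1) by (auto simp: is_path_iff insert_commute)
      moreover have "distinct (u # p1 @ c # rev q1)"
        using P1 Q1' p1 q1 up uq by (auto simp: is_path_iff)
      moreover have "set (u # p1 @ c # rev q1) \<subseteq> verts T"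
        using P1 Q1' uV by (auto simp: is_path_iff)
      ultimately have "is_cycle T (u # p1 @ c # rev q1)" using len by (simp add: is_cycle_iff)
      then show ?thesis using acyclic by blast
    qed
  qed
qed

fun dirs :: "'a rtree \<Rightarrow> 'a list \<Rightarrow> nat list" where
  "dirs T (a # b # p) = num T a {a, b} # dirs T (b # p)"
| "dirs T p = []"

lemma dirs_append: "dirs T (p @ a # q) = dirs T (p @ [a]) @ dirs T (a # q)"
proof (induction p)
  case (Cons b p)
  then show ?case by (cases p) auto
qed simp

locale rooted_tree =
  fixes T :: "'a rtree"
  assumes tree: "is_tree T"
    and root: "root T \<in> verts T" "deg T (root T) = 1"
    and numbering: "good_numbering T"
begin

abbreviation rt :: 'a where "rt \<equiv> root T"

lemma path_unique: "is_path T p u v \<Longrightarrow> is_path T q u v \<Longrightarrow> p = q"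
  using tree by (intro acyclic_path_unique[of T]) (auto simp: is_tree_def)

lemma tpath_eq: "is_path T p u v \<Longrightarrow> tpath T u v = p"
  unfolding tpath_def by (rule the_equality) (auto intro: path_unique)

definition root_path :: "'a \<Rightarrow> 'a list" where
  "root_path v = tpath T rt v"

lemma root_path: "v \<in> verts T \<Longrightarrow> is_path T (root_path v) rt v"
proof -
  assume "v \<in> verts T"
  then obtain p where "is_path T p rt v" using tree root(1) unfolding is_tree_def by blast
  then show ?thesis using tpath_eq by (simp add: root_path_def)
qed

lemma root_path_eq: "is_path T p rt v \<Longrightarrow> root_path v = p"
  by (simp add: root_path_def tpath_eq)

lemma root_path_root: "root_path rt = [rt]"
  using root by (intro root_path_eq) (simp add: is_path_iff)

lemma root_path_props:
  assumes "v \<in> verts T"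
  shows "root_path v \<noteq> []" "hd (root_path v) = rt" "last (root_path v) = v" "distinct (root_path v)"
    "set (root_path v) \<subseteq> verts T"
  using root_path[OF assms] by (auto simp: is_path_iff)

lemma root_path_split:
  assumes "v \<in> verts T" "root_path v = p @ w # q"
  shows "root_path w = p @ [w]"
  using root_path[OF assms(1)] assms(2) by (metis is_path_prefix root_path_eq)

text \<open>If \<open>v\<close> is not on the root path of \<open>u\<close>, the edge prolongs that
  path. Otherwise \<open>v\<close> must be its last vertex but one, or the edge would close a cycle
  with the path from \<open>v\<close> to \<open>u\<close>.\<close>

lemma edge_cases:
  assumes "{u, v} \<in> edges T"
  shows "root_path v = root_path u @ [v] \<or> root_path u = root_path v @ [u]"
proof -
  have uv: "u \<noteq> v" "u \<in> verts T" "v \<in> verts T"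
    using tree assms unfolding is_tree_def by (metis doubleton_eq_iff singletonI)+
  have U: "is_path T (root_path u) rt u" using root_path uv by simp
  show ?thesis
  proof (cases "v \<in> set (root_path u)")
    case False
    then have "is_path T (root_path u @ [v]) rt v"
      using U uv assms by (auto simp: is_path_iff successively_append_iff)
    then show ?thesis using root_path_eq by blast
  next
    case True
    then obtain p q where pq: "root_path u = p @ v # q" by (meson split_list)
    then have v: "root_path v = p @ [v]" using root_path_split uv by blast
    have path: "is_path T (v # q) v u" using is_path_suffix U pq by metis
    then obtain q' where q': "q = q' @ [u]" using uv
      by (cases q rule: rev_cases) (auto simp: is_path_iff)
    have "q' = []"
    proof (rule ccontr)
      assume "q' \<noteq> []"
      then have "is_cycle T (v # q)" using path q' assms
        by (cases q') (auto simp: is_cycle_iff is_path_iff)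
      then show False using tree by (auto simp: is_tree_def)
    qed
    then show ?thesis using pq v q' by simp
  qed
qed

definition par :: "'a \<Rightarrow> 'a" where
  "par v = last (butlast (root_path v))"

lemma par:
  assumes "v \<in> verts T" "v \<noteq> rt"
  shows "par v \<in> verts T" "root_path v = root_path (par v) @ [v]" "{v, par v} \<in> edges T"
    "eup T v = {v, par v}"
proof -
  note sp = root_path_props[OF assms(1)]
  have ne: "butlast (root_path v) \<noteq> []"
  proof
    assume "butlast (root_path v) = []"
    then have "root_path v = [v]" using sp by (metis append_butlast_last_id append_Nil)
    then show False using sp assms by simp
  qed
  then have split: "root_path v = butlast (butlast (root_path v)) @ par v # [v]"
    using sp unfolding par_def by (metis append_assoc append_butlast_last_id append_Cons append_Nil)
  then have "root_path (par v) = butlast (butlast (root_path v)) @ [par v]"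
    using root_path_split[OF assms(1)] by blast
  with split show eq: "root_path v = root_path (par v) @ [v]" by simp
  show "par v \<in> verts T" using sp(5) split by (metis in_set_conv_decomp subsetD)
  have "is_path T (butlast (butlast (root_path v)) @ par v # [v]) rt v"
    using root_path[OF assms(1)] split by simp
  then show "{v, par v} \<in> edges T"
    by (auto simp: is_path_iff successively_append_iff insert_commute)
  have "tpath T v rt = rev (root_path v)" using root_path[OF assms(1)] by (intro tpath_eq is_path_rev)
  also have "\<dots> = v # par v # rev (butlast (butlast (root_path v)))" by (subst split) simp
  finally show "eup T v = {v, par v}" by (simp add: eup_def)
qed

lemma par_eqI: "root_path v = root_path u @ [v] \<Longrightarrow> u \<in> verts T \<Longrightarrow> par v = u"
  using root_path_props[of u] by (simp add: par_def)

lemma edges_par: "edges T = {{v, par v} | v. v \<in> verts T \<and> v \<noteq> rt}"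
proof (intro equalityI subsetI)
  fix e assume e: "e \<in> edges T"
  then obtain u v where uv: "u \<in> verts T" "v \<in> verts T" "e = {u, v}"
    using tree unfolding is_tree_def by blast
  have "root_path w \<noteq> [rt]" if "root_path w = root_path z @ [w]" "z \<in> verts T" for w z
    using that root_path_props[of z] by auto
  then have nr: "w \<noteq> rt" if "root_path w = root_path z @ [w]" "z \<in> verts T" for w z
    using that root_path_root by metis
  from edge_cases e uv have "root_path v = root_path u @ [v] \<or> root_path u = root_path v @ [u]" by blast
  then have "e = {v, par v} \<and> v \<noteq> rt \<or> e = {u, par u} \<and> u \<noteq> rt"
    using par_eqI uv nr by (metis insert_commute)
  then show "e \<in> {{v, par v} | v. v \<in> verts T \<and> v \<noteq> rt}" using uv by blast
next
  fix e assume "e \<in> {{v, par v} | v. v \<in> verts T \<and> v \<noteq> rt}"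
  then show "e \<in> edges T" using par(3) by auto
qed

lemma vertex_induct [consumes 1, case_names root step]:
  assumes "v \<in> verts T" "P rt"
    and "\<And>v. v \<in> verts T \<Longrightarrow> v \<noteq> rt \<Longrightarrow> P (par v) \<Longrightarrow> P v"
  shows "P v"
  using assms(1)
proof (induction "length (root_path v)" arbitrary: v rule: less_induct)
  case less
  show ?case
  proof (cases "v = rt")
    case False
    note p = par[OF less.prems False]
    have "length (root_path (par v)) < length (root_path v)" using arg_cong[OF p(2), of length] by simp
    then show ?thesis using less.hyps p(1) assms(3) less.prems False by blast
  qed (use assms in simp)
qed

definition addr :: "'a \<Rightarrow> nat list" where
  "addr v = dirs T (root_path v)"

lemma addr_root: "addr rt = []"
  by (simp add: addr_def root_path_root)

lemma addr_append:
  assumes "w \<in> verts T" "root_path v = root_path w @ q"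
  shows "addr v = addr w @ dirs T (w # q)"
proof -
  have "root_path w = butlast (root_path w) @ [w]"
    using root_path_props[OF assms(1)] by (metis append_butlast_last_id)
  then have "root_path v = butlast (root_path w) @ w # q" "root_path w = butlast (root_path w) @ [w]"
    using assms(2) by (metis append.assoc append_Cons append_Nil)+
  then show ?thesis unfolding addr_def by (metis dirs_append)
qed

lemma addr_par:
  assumes "v \<in> verts T" "v \<noteq> rt"
  shows "addr v = addr (par v) @ [num T (par v) {v, par v}]"
  using addr_append[OF par(1,2)[OF assms]] by (simp add: insert_commute)

lemma addr_eq_Nil: "v \<in> verts T \<Longrightarrow> addr v = [] \<longleftrightarrow> v = rt"
  using addr_par addr_root by fastforce

lemma finite_edges_at: "finite (edges_at T v)"
proof (rule finite_subset)
  show "edges_at T v \<subseteq> Pow (verts T)" using tree by (auto simp: edges_at_def is_tree_def)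
qed (use tree in \<open>simp add: is_tree_def\<close>)

lemma num_inj: "v \<in> verts T \<Longrightarrow> inj_on (num T v) (edges_at T v)"
proof (cases "v = rt")
  case True
  then obtain e where "edges_at T v = {e}" using root by (auto simp: deg_def card_1_singleton_iff)
  then show ?thesis by simp
next
  case False
  assume "v \<in> verts T"
  then show ?thesis using False numbering by (auto simp: good_numbering_def bij_betw_def)
qed

lemma par_edge_at: "v \<in> verts T \<Longrightarrow> v \<noteq> rt \<Longrightarrow> {v, par v} \<in> edges_at T (par v)"
  using par(3) by (simp add: edges_at_def)

lemma par_neq: "v \<in> verts T \<Longrightarrow> v \<noteq> rt \<Longrightarrow> par v \<noteq> v"
  using par(2)[of v] by (metis append_self_conv not_Cons_self2)

lemma addr_inj: "inj_on addr (verts T)"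
proof (rule inj_onI)
  fix u v assume "u \<in> verts T" "v \<in> verts T" "addr u = addr v"
  then show "u = v"
  proof (induction u arbitrary: v rule: vertex_induct)
    case root
    then show ?case using addr_eq_Nil addr_root by metis
  next
    case (step u)
    then have v: "v \<noteq> rt" using addr_eq_Nil addr_root by metis
    have eq: "addr (par u) = addr (par v)" "num T (par u) {u, par u} = num T (par v) {v, par v}"
      using step.prems addr_par[OF step.hyps(1,2)] addr_par[of v] v by auto
    have pp: "par u = par v" using step.IH[of "par v"] eq(1) par(1)[of v] step.prems(1) v by simp
    have "{u, par u} = {v, par v}"
      using num_inj[of "par v"] eq(2) par_edge_at[OF step.hyps(1,2)] par_edge_at[of v] step.prems(1) v pp
        par(1)[of v] by (auto dest: inj_onD)
    then show ?case using pp by (metis doubleton_eq_iff)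
  qed
qed

definition kids_of :: "'a \<Rightarrow> nat" where
  "kids_of v = (if v = rt then 1 else deg T v - 1)"

text \<open>Away from the root, the edge to the parent takes number 0, so the edges to the children
  take exactly 1 up to the degree minus one. The single edge at the root has number 1.\<close>

lemma child_addr_iff:
  assumes v: "v \<in> verts T"
  shows "(\<exists>w\<in>verts T. addr w = addr v @ [g]) \<longleftrightarrow> 1 \<le> g \<and> g \<le> kids_of v"
proof -
  let ?C = "{w \<in> verts T. w \<noteq> rt \<and> par w = v}"
  have "(\<exists>w\<in>verts T. addr w = addr v @ [g]) \<longleftrightarrow> (\<exists>w\<in>?C. num T v {w, v} = g)"
  proof
    assume "\<exists>w\<in>verts T. addr w = addr v @ [g]"
    then obtain w where w: "w \<in> verts T" "addr w = addr v @ [g]" by blast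
    then have "w \<noteq> rt" using addr_root by auto
    then have "addr (par w) = addr v" "num T (par w) {w, par w} = g"
      using addr_par[of w] w by auto
    then have "par w = v" using addr_inj par(1)[of w] w v \<open>w \<noteq> rt\<close> by (auto dest: inj_onD)
    then show "\<exists>w\<in>?C. num T v {w, v} = g" using w \<open>w \<noteq> rt\<close> \<open>num T (par w) {w, par w} = g\<close> by auto
  next
    assume "\<exists>w\<in>?C. num T v {w, v} = g"
    then show "\<exists>w\<in>verts T. addr w = addr v @ [g]" using addr_par by auto
  qed
  also have "\<dots> \<longleftrightarrow> g \<in> num T v ` {{w, v} | w. w \<in> ?C}" by auto
  also have "num T v ` {{w, v} | w. w \<in> ?C} = {1..kids_of v}"
  proof (cases "v = rt")
    case True
    have "{{w, v} | w. w \<in> ?C} = edges_at T v"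
      using True by (auto simp: edges_at_def edges_par)
    moreover obtain e where "edges_at T v = {e}"
      using root True by (auto simp: deg_def card_1_singleton_iff)
    moreover have "\<forall>e\<in>edges_at T rt. num T rt e = 1" using numbering by (simp add: good_numbering_def)
    ultimately show ?thesis using True by (simp add: kids_of_def)
  next
    case False
    have "{{w, v} | w. w \<in> ?C} = edges_at T v - {{v, par v}}"
    proof (intro equalityI subsetI)
      fix e assume "e \<in> {{w, v} | w. w \<in> ?C}"
      then obtain w where w: "w \<in> verts T" "w \<noteq> rt" "par w = v" "e = {w, v}" by auto
      have "w \<noteq> par v"
      proof
        assume "w = par v"
        then have "root_path v = root_path v @ [w] @ [v]"
          using par(2)[OF v False] par(2)[OF w(1,2)] w(3) by simp
        then show False by simp
      qed
      then have "e \<noteq> {v, par v}" using w par_neq by (metis doubleton_eq_iff)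
      then show "e \<in> edges_at T v - {{v, par v}}" using w par(3)[of w] by (auto simp: edges_at_def)
    next
      fix e assume "e \<in> edges_at T v - {{v, par v}}"
      then obtain w where "w \<in> verts T" "w \<noteq> rt" "e = {w, par w}" "v \<in> e" "e \<noteq> {v, par v}"
        by (auto simp: edges_at_def edges_par)
      then show "e \<in> {{w, v} | w. w \<in> ?C}" by auto
    qed
    moreover have b: "bij_betw (num T v) (edges_at T v) {0..<deg T v}" "num T v {v, par v} = 0"
      using numbering v False par(4)[OF v False] by (auto simp: good_numbering_def)
    moreover have "{v, par v} \<in> edges_at T v" using par(3)[OF v False] by (simp add: edges_at_def)
    then have "num T v ` (edges_at T v - {{v, par v}}) = num T v ` edges_at T v - num T v ` {{v, par v}}"
      using b by (intro inj_on_image_set_diff[of _ "edges_at T v"]) (auto simp: bij_betw_def)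
    ultimately have "num T v ` {{w, v} | w. w \<in> ?C} = {0..<deg T v} - {0}"
      by (simp add: bij_betw_def)
    also have "\<dots> = {1..kids_of v}" using False by (auto simp: kids_of_def)
    finally show ?thesis .
  qed
  finally show ?thesis by simp
qed

section \<open>Addresses, descending paths and the vertex order\<close>

lemma addr_extension:
  assumes "v \<in> verts T" "w \<in> verts T" "addr w = addr v @ \<beta>"
  shows "\<exists>q. root_path w = root_path v @ q \<and> length q = length \<beta>"
  using assms(2,3)
proof (induction \<beta> arbitrary: w rule: rev_induct)
  case Nil
  then have "w = v" using addr_inj assms(1) by (auto dest: inj_onD)
  then show ?case by simp
next
  case (snoc g \<beta>)
  then have "w \<noteq> rt" using addr_root by auto
  then have "addr (par w) = addr v @ \<beta>" using addr_par[of w] snoc.prems by simp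
  then obtain q where q: "root_path (par w) = root_path v @ q" "length q = length \<beta>"
    using snoc.IH par(1)[of w] snoc.prems \<open>w \<noteq> rt\<close> by blast
  have "root_path w = root_path v @ (q @ [w])"
    using par(2)[of w] snoc.prems(1) \<open>w \<noteq> rt\<close> q by simp
  then show ?case using q(2) by (intro exI[of _ "q @ [w]"]) simp
qed

text \<open>This brings the subdivision hypothesis to addresses: the number of appended digits is
  the number of edges of a path.\<close>

lemma descending_path:
  assumes "v \<in> verts T" "w \<in> verts T" "addr w = addr v @ \<beta>"
  obtains p where "is_path T p v w" "length p = length \<beta> + 1"
proof -
  obtain q where q: "root_path w = root_path v @ q" "length q = length \<beta>"
    using addr_extension[OF assms] by blast
  have "root_path w = butlast (root_path v) @ v # q"
    using q root_path_props[OF assms(1)] by (metis append.assoc append_Cons append_Nil append_butlast_last_id)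
  then have "is_path T (v # q) v w" using root_path[OF assms(2)] is_path_suffix by metis
  then show ?thesis using that q(2) by simp
qed

text \<open>The vertices on a root path determine its end: if two root paths have the same vertices,
  each end lies on the other path, so each path is at most as long as the other.\<close>

lemma meet_eq:
  assumes "w \<in> verts T" "set (root_path u) \<inter> set (root_path v) = set (root_path w)"
  shows "meet T u v = w"
  unfolding meet_def root_path_def[symmetric]
proof (rule the_equality)
  show "w \<in> verts T \<and> set (root_path u) \<inter> set (root_path v) = set (root_path w)" using assms by simp
  fix z assume z: "z \<in> verts T \<and> set (root_path u) \<inter> set (root_path v) = set (root_path z)"
  then have eq: "set (root_path z) = set (root_path w)" using assms by simp
  have "z \<in> set (root_path w)" "w \<in> set (root_path z)"
    using eq root_path_props[of z] root_path_props[of w] z assms(1) last_in_set by metis+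
  then obtain p q p' q' where pq: "root_path w = p @ z # q" "root_path z = p' @ w # q'"
    by (meson split_list)
  have "root_path z = p @ [z]" by (rule root_path_split[OF assms(1) pq(1)])
  then have "length (root_path z) \<le> length (root_path w)" using pq(1) by simp
  moreover have w: "root_path w = p' @ [w]" using root_path_split[OF _ pq(2)] z by blast
  ultimately have "q' = []" using pq(2) by simp
  then have "root_path z = root_path w" using pq(2) w by simp
  then show "z = w" using root_path_props(3) z assms(1) by metis
qed

lemma gnum_eq:
  assumes "v \<in> verts T" "w \<in> verts T" "root_path v = root_path w @ b # q"
  shows "gnum T w v = num T w {w, b}"
proof -
  have "root_path v = butlast (root_path w) @ w # b # q"
    using assms(3) root_path_props[OF assms(2)] by (metis append.assoc append_Cons append_Nil append_butlast_last_id)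
  then have "tpath T w v = w # b # q"
    using root_path[OF assms(1)] by (intro tpath_eq) (metis is_path_suffix)
  then show ?thesis by (simp add: gnum_def)
qed

text \<open>If one vertex lies on the root path of the other, its address is a prefix. Otherwise the
  root paths part at a last common vertex \<open>w\<close>, which is the meet, and the first
  differing digits of the addresses are the two numbers that \<open>gnum\<close> compares at
  \<open>w\<close>.\<close>

lemma vless_addr:
  assumes u: "u \<in> verts T" and v: "v \<in> verts T"
  shows "vless T u v \<longleftrightarrow> addr u < addr v"
proof -
  note pu = root_path_props[OF u] and pv = root_path_props[OF v]
  consider (eq) "u = v" | (pre) q where "root_path v = root_path u @ q" "u \<noteq> v"
    | (post) q where "root_path u = root_path v @ q" "u \<noteq> v"
    | (par) as b bs c cs where "b \<noteq> c" "root_path u = as @ b # bs" "root_path v = as @ c # cs"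
    by (meson parallelI parallel_decomp prefix_def)
  then show ?thesis
  proof cases
    case eq
    then show ?thesis by (simp add: vless_def)
  next
    case pre
    then have "q \<noteq> []" using pu pv by auto
    have "meet T u v = u" using pre u by (intro meet_eq) auto
    moreover have "addr v = addr u @ dirs T (u # q)" using addr_append u pre by blast
    moreover have "dirs T (u # q) \<noteq> []" using \<open>q \<noteq> []\<close> by (cases q) auto
    ultimately show ?thesis using pre by (simp add: vless_def)
  next
    case post
    have "meet T u v = v" using post v by (intro meet_eq) auto
    moreover have "addr u = addr v @ dirs T (v # q)" using addr_append v post by blast
    ultimately show ?thesis using post by (auto simp: vless_def Let_def)
  next
    case par
    have "as \<noteq> []" using par pu(2) pv(2) by auto
    then obtain as' w where as: "as = as' @ [w]" by (metis rev_exhaust)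
    have su: "root_path w = as" using root_path_split[OF u, of as' w "b # bs"] par as by simp
    have w: "w \<in> verts T" using pu(5) par as by auto
    \<comment> \<open>A vertex common to both paths after they part would have two different root
      paths.\<close>
    have "set (b # bs) \<inter> set (c # cs) = {}"
    proof (rule ccontr)
      assume "set (b # bs) \<inter> set (c # cs) \<noteq> {}"
      then obtain z where "z \<in> set (b # bs)" "z \<in> set (c # cs)" by blast
      then obtain p q p' q' where s: "b # bs = p @ z # q" "c # cs = p' @ z # q'" by (meson split_list)
      then have "root_path z = as @ p @ [z]" "root_path z = as @ p' @ [z]"
        using root_path_split[OF u, of "as @ p" z q] root_path_split[OF v, of "as @ p'" z q'] par by auto
      then have "p = p'" by simp
      then show False using s par(1) by (cases p) auto
    qed
    then have "set (root_path u) \<inter> set (root_path v) = set (root_path w)"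
      using par pu(4) pv(4) su by auto
    then have m: "meet T u v = w" using meet_eq w by blast
    have g: "gnum T w u = num T w {w, b}" "gnum T w v = num T w {w, c}"
      using gnum_eq[OF u w] gnum_eq[OF v w] par su by auto
    have "u \<noteq> w" "v \<noteq> w" using par su by auto
    moreover have "u \<noteq> v" using par by auto
    ultimately have "vless T u v \<longleftrightarrow> num T w {w, b} < num T w {w, c}"
      by (simp add: vless_def m g)
    moreover have "addr u = addr w @ num T w {w, b} # dirs T (b # bs)"
      "addr v = addr w @ num T w {w, c} # dirs T (c # cs)"
      using addr_append[OF w, of u "b # bs"] addr_append[OF w, of v "c # cs"] par su by auto
    moreover have "num T w {w, b} \<noteq> num T w {w, c}"
    proof -
      have "is_path T (as' @ w # b # bs) rt u" "is_path T (as' @ w # c # cs) rt v"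
        using root_path[OF u] root_path[OF v] par as by auto
      then have "{w, b} \<in> edges_at T w" "{w, c} \<in> edges_at T w"
        by (auto simp: is_path_iff successively_append_iff edges_at_def)
      moreover have "{w, b} \<noteq> {w, c}" using par(1) by (metis doubleton_eq_iff)
      ultimately show ?thesis using num_inj[OF w] by (auto dest: inj_onD)
    qed
    ultimately show ?thesis by auto
  qed
qed

text \<open>A vertex other than the root, at depth less than \<open>n - 1\<close> or less than
  \<open>n - 1\<close> below a branching vertex, has degree 2. Otherwise the descending path to it
  would have too few edges, since it starts at the root, of degree 1, or at a branching vertex, of
  degree at least 3.\<close>

lemma addr_tree:
  assumes n2: "2 \<le> n" and subdiv: "sufficiently_subdivided n T"
  shows "addr_tree n (addr ` verts T) (\<lambda>\<alpha>. kids_of (inv_into (verts T) addr \<alpha>)) T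
    (inv_into (verts T) addr)"
proof -
  let ?vt = "inv_into (verts T) addr"
  have vt [simp]: "?vt (addr v) = v" if "v \<in> verts T" for v
    using addr_inj that by simp
  have vt_Nil [simp]: "?vt [] = rt" using vt[OF root(1)] by (simp add: addr_root)
  have par_vt: "?vt (butlast (addr v)) = par v" "v \<noteq> rt" if "v \<in> verts T" "addr v \<noteq> []" for v
  proof -
    show "v \<noteq> rt" using that addr_root by auto
    then show "?vt (butlast (addr v)) = par v" using addr_par[of v] par(1)[of v] that(1) by simp
  qed
  have deg: "deg T v = kids_of v + 1" if "v \<in> verts T" "v \<noteq> rt" for v
  proof -
    have "{v, par v} \<in> edges_at T v" using par(3)[OF that] by (simp add: edges_at_def)
    then have "0 < deg T v" using finite_edges_at by (auto simp: deg_def card_gt_0_iff)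
    then show ?thesis using that by (simp add: kids_of_def)
  qed
  have stem: "kids_of v = 1" if v: "v \<in> verts T" "length (addr v) < n - 1" for v
  proof (cases "v = rt")
    case False
    have "deg T v = 2"
    proof (rule ccontr)
      assume d: "deg T v \<noteq> 2"
      obtain p where p: "is_path T p rt v" "length p = length (addr v) + 1"
        using descending_path[OF root(1) v(1), of "addr v"] by (auto simp: addr_root)
      have "deg T rt \<noteq> 2" using root by simp
      then have "n - 1 \<le> length p - 1"
        using subdiv d False v(1) root(1) p(1) unfolding sufficiently_subdivided_def by metis
      then show False using p(2) v(2) by simp
    qed
    then show ?thesis using deg[OF v(1) False] by simp
  qed (simp add: kids_of_def)
  have segment: "kids_of w = 1"
    if vw: "v \<in> verts T" "2 \<le> kids_of v" "w \<in> verts T" "addr w = addr v @ \<beta>" "\<beta> \<noteq> []" "length \<beta> < n - 1"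
    for v w \<beta>
  proof -
    have "v \<noteq> rt" using vw(2) by (auto simp: kids_of_def)
    then have dv: "deg T v \<noteq> 2" using deg vw by fastforce
    have w: "w \<noteq> rt" "v \<noteq> w" using vw(4,5) addr_root by auto
    have "deg T w = 2"
    proof (rule ccontr)
      assume d: "deg T w \<noteq> 2"
      obtain p where p: "is_path T p v w" "length p = length \<beta> + 1"
        using descending_path[OF vw(1,3,4)] .
      then have "n - 1 \<le> length p - 1"
        using subdiv d dv w(2) vw(1,3) unfolding sufficiently_subdivided_def by metis
      then show False using p(2) vw(6) by simp
    qed
    then show ?thesis using deg[OF vw(3) w(1)] by simp
  qed
  have fin: "finite (verts T)" using tree by (simp add: is_tree_def)
  show ?thesis
  proof
    show "[] \<in> addr ` verts T" using addr_root root(1) by (metis image_eqI)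
    fix \<alpha> \<beta> :: "nat list" and g
    show "\<alpha> \<in> addr ` verts T" if a: "\<alpha> @ [g] \<in> addr ` verts T"
    proof -
      obtain v where v: "\<alpha> @ [g] = addr v" "v \<in> verts T" using a by (rule imageE)
      have "v \<noteq> rt"
      proof
        assume "v = rt"
        then show False using v(1) by (simp add: addr_root)
      qed
      then have "addr (par v) = \<alpha>" "par v \<in> verts T"
        using addr_par[OF v(2)] par(1)[OF v(2)] unfolding v(1)[symmetric] by simp_all
      then show ?thesis by blast
    qed
    show "\<alpha> @ [g] \<in> addr ` verts T \<longleftrightarrow> 1 \<le> g \<and> g \<le> kids_of (?vt \<alpha>)" if a: "\<alpha> \<in> addr ` verts T"
    proof -
      obtain v where v: "v \<in> verts T" "\<alpha> = addr v" using a by auto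
      have "\<alpha> @ [g] \<in> addr ` verts T \<longleftrightarrow> (\<exists>w\<in>verts T. addr w = addr v @ [g])"
        unfolding image_iff v(2) by metis
      then show ?thesis using child_addr_iff[OF v(1), of g] v by simp
    qed
    show "kids_of (?vt \<alpha>) = 1" if "\<alpha> \<in> addr ` verts T" "length \<alpha> < n - 1"
      using that stem by auto
    show "kids_of (?vt (\<alpha> @ \<beta>)) = 1"
      if a: "\<alpha> \<in> addr ` verts T" "2 \<le> kids_of (?vt \<alpha>)" "\<alpha> @ \<beta> \<in> addr ` verts T" "\<beta> \<noteq> []" "length \<beta> < n - 1"
    proof -
      obtain v w where vw: "v \<in> verts T" "\<alpha> = addr v" "w \<in> verts T" "\<alpha> @ \<beta> = addr w"
        using a(1,3) by blast
      have "kids_of w = 1" using segment[of v w \<beta>] a vw by simp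
      then show ?thesis using vw by simp
    qed
    show "inj_on ?vt (addr ` verts T)" by (auto intro!: inj_onI)
    show "verts T = ?vt ` addr ` verts T" by (simp add: image_image)
    show "edges T = {{?vt \<alpha>, ?vt (butlast \<alpha>)} | \<alpha>. \<alpha> \<in> addr ` verts T \<and> \<alpha> \<noteq> []}"
    proof -
      have "{{?vt \<alpha>, ?vt (butlast \<alpha>)} | \<alpha>. \<alpha> \<in> addr ` verts T \<and> \<alpha> \<noteq> []} =
          {{?vt (addr v), ?vt (butlast (addr v))} | v. v \<in> verts T \<and> addr v \<noteq> []}" by auto
      also have "\<dots> = {{v, par v} | v. v \<in> verts T \<and> v \<noteq> rt}"
        using par_vt(1) addr_eq_Nil by (intro Collect_cong ex_cong1) auto
      finally show ?thesis using edges_par by simp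
    qed
    show "eup T (?vt \<alpha>) = {?vt \<alpha>, ?vt (butlast \<alpha>)}" if "\<alpha> \<in> addr ` verts T" "\<alpha> \<noteq> []"
      using that par_vt par(4) by auto
    show "vless T (?vt \<alpha>) (?vt \<beta>) \<longleftrightarrow> \<alpha> < \<beta>" if "\<alpha> \<in> addr ` verts T" "\<beta> \<in> addr ` verts T"
      using that vless_addr by auto
    show "deg T (?vt \<alpha>) = kids_of (?vt \<alpha>) + 1" if "\<alpha> \<in> addr ` verts T" "\<alpha> \<noteq> []"
      using that par_vt(2) deg by auto
    show "rt = ?vt []" "deg T (?vt []) = 1" using root by simp_all
  qed (use n2 fin in simp_all)
qed

end

theorem theorem4p5:
  fixes T :: "'a rtree" and n :: nat
  assumes tree: "is_tree T"
    and root: "root T \<in> verts T" "deg T (root T) = 1"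
    and numbering: "good_numbering T"
    and subdiv: "sufficiently_subdivided n T"
    and ess: "\<exists>v \<in> verts T. essential T v"
    and n2: "2 \<le> n"
  shows "Gverts T n = {a \<in> cells T n. dim T a = 0 \<and> {rank T (vx (a ! k)) | k. k < n} = {0..<n}}
       \<and> card (Gverts T n) = fact n
       \<and> bij_betw (perm_of T) (Gverts T n) {\<tau>. \<tau> permutes {1..n}}
       \<and> (\<exists>E :: nat \<Rightarrow> nat \<Rightarrow> 'a set list set.
            (\<forall>i j. 2 \<le> j \<and> j \<le> i \<and> i \<le> n \<longrightarrow> E i j \<subseteq> Gedges T n)
          \<and> (\<forall>c \<in> Gedges T n. \<exists>!ij. 2 \<le> snd ij \<and> snd ij \<le> fst ij \<and> fst ij \<le> n \<and> c \<in> E (fst ij) (snd ij))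
          \<and> (\<forall>i j. 2 \<le> j \<and> j \<le> i \<and> i \<le> n \<longrightarrow>
               (\<forall>\<tau>. \<tau> permutes {1..n} \<longrightarrow>
                  card {c \<in> E i j. perm_of T (Gsrc T n c) = \<tau> \<and>
                                  perm_of T (Gtgt T n c) = inv (sigma n i j) \<circ> \<tau>}
                  = (\<Sum>l = 2..i. ((i - 2) choose (l - 2)) * m_num T l))
             \<and> (\<forall>c \<in> E i j. perm_of T (Gtgt T n c) = inv (sigma n i j) \<circ> perm_of T (Gsrc T n c))
             \<and> (\<forall>\<mu>. \<mu> permutes {1..n} \<longrightarrow> (\<forall>c \<in> E i j.
                  act c \<mu> \<in> E i j
                \<and> perm_of T (Gsrc T n (act c \<mu>)) = perm_of T (Gsrc T n c) \<circ> \<mu>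
                \<and> perm_of T (Gtgt T n (act c \<mu>)) = inv (sigma n i j) \<circ> perm_of T (Gsrc T n c) \<circ> \<mu>))))"
proof -
  interpret rooted_tree T
    using tree root numbering by unfold_locales
  interpret A: addr_tree n "addr ` verts T" "\<lambda>\<alpha>. kids_of (inv_into (verts T) addr \<alpha>)" T
    "inv_into (verts T) addr"
    by (rule addr_tree[OF n2 subdiv])
  show ?thesis
  proof (intro conjI A.Gverts_rank A.card_Gverts A.bij_betw_perm_of exI[of _ A.edge_class] allI impI ballI)
    fix i j :: nat assume ij: "2 \<le> j \<and> j \<le> i \<and> i \<le> n"
    then have i: "2 \<le> j" "j \<le> i" "i \<le> n" "2 \<le> i" by auto
    show "A.edge_class i j \<subseteq> Gedges T n" by (rule A.edge_class_subset)
    show "card {c \<in> A.edge_class i j. perm_of T (Gsrc T n c) = \<tau> \<and>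
        perm_of T (Gtgt T n c) = inv (sigma n i j) \<circ> \<tau>} =
        (\<Sum>l = 2..i. ((i - 2) choose (l - 2)) * m_num T l)" if "\<tau> permutes {1..n}" for \<tau>
      using A.card_edge_class[OF i(1-3) that] A.card_confs(2)[OF i(1-3)] A.sum_m_num[OF i(4)] by simp
    fix c assume c: "c \<in> A.edge_class i j"
    show "perm_of T (Gtgt T n c) = inv (sigma n i j) \<circ> perm_of T (Gsrc T n c)"
      by (rule A.Gtgt_edge_class[OF i(1-3) c])
    fix \<mu> assume \<mu>: "\<mu> permutes {1..n}"
    note act = A.act_edge_class[OF i(1-3) \<mu> c]
    show "act c \<mu> \<in> A.edge_class i j"
      "perm_of T (Gsrc T n (act c \<mu>)) = perm_of T (Gsrc T n c) \<circ> \<mu>"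
      by (rule act)+
    show "perm_of T (Gtgt T n (act c \<mu>)) = inv (sigma n i j) \<circ> perm_of T (Gsrc T n c) \<circ> \<mu>"
      using A.Gtgt_edge_class[OF i(1-3) act(1)] act(2) by (simp add: comp_assoc)
  qed (rule A.edge_class_unique)
qed

end
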